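(* Let $\mathfrak{p} \in \mathcal{M}_2(\mathbb{Q})$ be such that $\operatorname{Aut}(\mathfrak{p}) \cong V_4$. Then there is a genus 2 curve $\mathcal{X}$ (over an algebraic closure of $\mathbb{Q}$) corresponding to $\mathfrak{p}$ with equation $y^2 z^4 = f(x,z)$, where $$f(x,z) = x^6 - s_1 x^4 z^2 + s_2 x^2 z^4 - z^6 .$$ If $f \in \mathbb{Z}[x,z]$, then $f(x,z)$ or $f(-z,x)$ is a reduced binary form.
   Context: $\mathcal{M}_2$ is the (coarse) moduli space of smooth projective curves of genus 2. For $\mathfrak{p} \in \mathcal{M}_2(\mathbb{Q})$, $\operatorname{Aut}(\mathfrak{p})$ denotes the automorphism group, over an algebraic closure of $\mathbb{Q}$, of a genus 2 curve representing $\mathfrak{p}$. $V_4$ is the Klein 4-group. Saying that $\mathcal{X}$ has equation $y^2z^4=f(x,z)$ means that $\mathcal{X}$ is the smooth projective genus 2 curve with affine equation $y^2=f(x,1)$; in particular $f$ has distinct roots. Reduced binary forms. Let $f(x,z)=a_0x^n+a_1x^{n-1}z+\cdots+a_nz^n\in\mathbb{R}[x,z]$ with $a_0\neq 0$ and distinct roots (here $n=6$). Let $\alpha_1,\dots,\alpha_r$ be the real roots of $f(x,1)$ and $\beta_1,\bar\beta_1,\dots,\beta_s,\bar\beta_s$ the pairs of complex conjugate non-real roots, $r+2s=n$. For nonzero real parameters $t_1,\dots,t_r,u_1,\dots,u_s$ define the positive definite binary quadratic form $Q_f$ by $$Q_f(x,1)=\sum_{i=1}^r t_i^2(x-\alpha_i)^2+\sum_{j=1}^s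 2u_j^2(x-\beta_j)(x-\bar\beta_j),$$ let $\mathfrak{D}_f$ be its discriminant, and put $$\theta_0(t_1,\dots,t_r,u_1,\dots,u_s)=\frac{a_0^2\,|\mathfrak{D}_f|^{n/2}}{\prod_{i=1}^r t_i^2\,\prod_{j=1}^s u_j^4}.$$ The function $\theta_0$ attains its minimum at a point that is unique up to the signs of the parameters and a common scaling of them. The quadratic form $Q_f$ for this minimizing choice (well defined up to a positive scalar) is the Julia quadratic $\mathcal{J}_f$ of $f$. Let $\zeta(f)$ be the unique root of $\mathcal{J}_f(x,1)$ in the upper half-plane. The form $f$ is called reduced if $\zeta(f)$ lies in the classical fundamental domain $\{\tau : \operatorname{Im}\tau>0,\ |\operatorname{Re}\tau|\le \tfrac12,\ |\tau|\ge 1\}$ of the modular group $SL_2(\mathbb{Z})/\{\pm I\}$ (up to the usual boundary identifications). *)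

theory Defs
  imports "HOL-Analysis.Analysis" "HOL-Algebra.Elementary_Groups" "HOL-Algebra.Algebraic_Closure_Type"
begin

section \<open>Curves over an algebraically closed field, given by their function fields\<close>

text \<open>
  A smooth projective (irreducible) curve over an algebraically closed field \<open>k\<close> is represented
  by its function field: a field \<open>F\<close> (a type) with an embedding \<open>e :: k \<Rightarrow> F\<close>. Isomorphisms of
  curves over \<open>k\<close> are the field isomorphisms that are compatible with the embeddings of \<open>k\<close>.
\<close>

definition field_embedding :: "('k::field \<Rightarrow> 'f::field) \<Rightarrow> bool" where
  "field_embedding e \<longleftrightarrow>
     e 1 = 1 \<and> (\<forall>a b. e (a + b) = e a + e b) \<and> (\<forall>a b. e (a * b) = e a * e b)"

definition field_automorphism :: "('f::field \<Rightarrow> 'f) \<Rightarrow> bool" where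
  "field_automorphism \<phi> \<longleftrightarrow> field_embedding \<phi> \<and> bij \<phi>"

definition is_subfield :: "'f::field set \<Rightarrow> bool" where
  "is_subfield E \<longleftrightarrow> 1 \<in> E \<and> (\<forall>a\<in>E. \<forall>b\<in>E. a - b \<in> E \<and> a * b \<in> E) \<and> (\<forall>a\<in>E. inverse a \<in> E)"

definition adjoin :: "('k::field \<Rightarrow> 'f::field) \<Rightarrow> 'f set \<Rightarrow> 'f set" where
  "adjoin e S = is_subfield hull (range e \<union> S)"

definition transcendental_over :: "('k::field \<Rightarrow> 'f::field) \<Rightarrow> 'f \<Rightarrow> bool" where
  "transcendental_over e x \<longleftrightarrow> (\<forall>p. p \<noteq> 0 \<longrightarrow> poly (map_poly e p) x \<noteq> 0)"

text \<open>A finite extension of \<open>k(x)\<close> for some \<open>x\<close> that is transcendental over \<open>k\<close>.\<close>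

definition function_field :: "('k::field \<Rightarrow> 'f::field) \<Rightarrow> bool" where
  "function_field e \<longleftrightarrow> field_embedding e \<and>
     (\<exists>x B. transcendental_over e x \<and> finite B \<and>
        (\<forall>y. \<exists>c. (\<forall>b\<in>B. c b \<in> adjoin e {x}) \<and> y = (\<Sum>b\<in>B. c b * b)))"

text \<open>
  The points of the curve are the normalised discrete valuations of \<open>F\<close> that are trivial on \<open>k\<close>.
  The value at \<open>0\<close>, mathematically \<open>\<infinity>\<close>, is set to \<open>0\<close>, so that each point is
  represented by exactly one function.
\<close>

definition places :: "('k::field \<Rightarrow> 'f::field) \<Rightarrow> ('f \<Rightarrow> int) set" where
  "places e = {v. v 0 = 0 \<and>
     (\<forall>a b. a \<noteq> 0 \<longrightarrow> b \<noteq> 0 \<longrightarrow> v (a * b) = v a + v b) \<and>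
     (\<forall>a b. a \<noteq> 0 \<longrightarrow> b \<noteq> 0 \<longrightarrow> a + b \<noteq> 0 \<longrightarrow> min (v a) (v b) \<le> v (a + b)) \<and>
     (\<forall>c. v (e c) = 0) \<and>
     (\<exists>a. v a = 1)}"

definition divisors :: "('k::field \<Rightarrow> 'f::field) \<Rightarrow> (('f \<Rightarrow> int) \<Rightarrow> int) set" where
  "divisors e = {D. finite {v. D v \<noteq> 0} \<and> {v. D v \<noteq> 0} \<subseteq> places e}"

text \<open>Over an algebraically closed field all points have degree one.\<close>

definition divisor_degree :: "(('f::field \<Rightarrow> int) \<Rightarrow> int) \<Rightarrow> int" where
  "divisor_degree D = (\<Sum>v | D v \<noteq> 0. D v)"

definition riemann_roch_space :: "('k::field \<Rightarrow> 'f::field) \<Rightarrow> (('f \<Rightarrow> int) \<Rightarrow> int) \<Rightarrow> 'f set" where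
  "riemann_roch_space e D = {h. h = 0 \<or> (\<forall>v\<in>places e. v h + D v \<ge> 0)}"

definition riemann_roch_dim :: "('k::field \<Rightarrow> 'f::field) \<Rightarrow> (('f \<Rightarrow> int) \<Rightarrow> int) \<Rightarrow> nat" where
  "riemann_roch_dim e D = vector_space.dim (\<lambda>c h. e c * h) (riemann_roch_space e D)"

text \<open>The genus is the maximum of \<open>deg D - l(D) + 1\<close> over all divisors \<open>D\<close>.\<close>

definition has_genus :: "('k::field \<Rightarrow> 'f::field) \<Rightarrow> nat \<Rightarrow> bool" where
  "has_genus e g \<longleftrightarrow>
     (\<forall>D\<in>divisors e. divisor_degree D - int (riemann_roch_dim e D) + 1 \<le> int g) \<and>
     (\<exists>D\<in>divisors e. divisor_degree D - int (riemann_roch_dim e D) + 1 = int g)"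

text \<open>
  The automorphism group of the function field over \<open>k\<close>; it is the opposite group of, hence
  isomorphic to, the automorphism group of the curve.
\<close>

definition Aut_group :: "('k::field \<Rightarrow> 'f::field) \<Rightarrow> ('f \<Rightarrow> 'f) monoid" where
  "Aut_group e = \<lparr>carrier = {\<phi>. field_automorphism \<phi> \<and> (\<forall>c. \<phi> (e c) = e c)},
                  monoid.mult = (\<circ>), one = id\<rparr>"

definition klein_four_group :: "(int \<times> int) monoid" where
  "klein_four_group = integer_mod_group 2 \<times>\<times> integer_mod_group 2"

section \<open>Rational points of the moduli space\<close>

type_synonym qbar = "rat alg_closure"

text \<open>
  The \<open>qbar\<close>-points of the coarse moduli space are the isomorphism classes of genus 2 curves over
  \<open>qbar\<close>, and its rational points are those classes that are fixed by the absolute Galois group,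
  that is, by all field automorphisms of \<open>qbar\<close>. The conjugates of a curve \<open>e :: qbar \<Rightarrow> F\<close> are the
  curves \<open>e \<circ> \<sigma> :: qbar \<Rightarrow> F\<close>; the map \<open>\<phi>\<close> below is an isomorphism between the two.
\<close>

definition represents_point_of_M2_Q :: "(qbar \<Rightarrow> 'f::field) \<Rightarrow> bool" where
  "represents_point_of_M2_Q e \<longleftrightarrow> function_field e \<and> has_genus e 2 \<and>
     (\<forall>\<sigma>. field_automorphism \<sigma> \<longrightarrow> (\<exists>\<phi>. field_automorphism \<phi> \<and> \<phi> \<circ> e = e \<circ> \<sigma>))"

section \<open>Binary forms\<close>

text \<open>
  The binary form \<open>f\<close> of degree \<open>n = degree p\<close> with \<open>f(x,1) = p(x)\<close>; the coefficient of \<open>x^n\<close> in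
  this form is \<open>lead_coeff p\<close>.
\<close>

definition binary_form :: "'a::comm_semiring_1 poly \<Rightarrow> 'a \<Rightarrow> 'a \<Rightarrow> 'a" where
  "binary_form p x z = (\<Sum>i\<le>Polynomial.degree p. Polynomial.coeff p i * x ^ i * z ^ (Polynomial.degree p - i))"

definition even_sextic :: "'a::comm_ring_1 \<Rightarrow> 'a \<Rightarrow> 'a \<Rightarrow> 'a \<Rightarrow> 'a" where
  "even_sextic s1 s2 x z = x ^ 6 - s1 * x ^ 4 * z ^ 2 + s2 * x ^ 2 * z ^ 4 - z ^ 6"

text \<open>
  The curve is the smooth projective model of the affine curve \<open>y\<^sup>2 = f(x,1)\<close>, for a binary sextic
  \<open>f\<close> with distinct roots and nonzero coefficient of \<open>x^6\<close>.
\<close>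

definition has_equation :: "('k::field \<Rightarrow> 'f::field) \<Rightarrow> ('k \<Rightarrow> 'k \<Rightarrow> 'k) \<Rightarrow> bool" where
  "has_equation e f \<longleftrightarrow> (\<exists>p. f = binary_form p \<and> Polynomial.degree p = 6 \<and> card {a. poly p a = 0} = 6 \<and>
     (\<exists>x y. transcendental_over e x \<and> y ^ 2 = poly (map_poly e p) x \<and> adjoin e {x, y} = UNIV))"

section \<open>The Julia quadratic and reduced forms\<close>

definition real_roots :: "real poly \<Rightarrow> real set" where
  "real_roots p = {\<alpha>. poly p \<alpha> = 0}"

definition upper_roots :: "real poly \<Rightarrow> complex set" where
  "upper_roots p = {\<beta>. poly (map_poly complex_of_real p) \<beta> = 0 \<and> Im \<beta> > 0}"

text \<open>The real polynomial \<open>Q\<^sub>f(x,1)\<close>; note that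
  \<open>(x - \<beta>) (x - cnj \<beta>) = x\<^sup>2 - 2 Re \<beta> x + \<bar>\<beta>\<bar>\<^sup>2\<close>.\<close>

definition Q_form :: "real poly \<Rightarrow> (real \<Rightarrow> real) \<Rightarrow> (complex \<Rightarrow> real) \<Rightarrow> real poly" where
  "Q_form p t u =
     (\<Sum>\<alpha>\<in>real_roots p. Polynomial.smult ((t \<alpha>)\<^sup>2) ([:- \<alpha>, 1:] ^ 2)) +
     (\<Sum>\<beta>\<in>upper_roots p. Polynomial.smult (2 * (u \<beta>)\<^sup>2) [:(cmod \<beta>)\<^sup>2, - 2 * Re \<beta>, 1:])"

definition quadratic_discriminant :: "real poly \<Rightarrow> real" where
  "quadratic_discriminant q = (Polynomial.coeff q 1)\<^sup>2 - 4 * Polynomial.coeff q 2 * Polynomial.coeff q 0"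

definition theta0 :: "real poly \<Rightarrow> (real \<Rightarrow> real) \<Rightarrow> (complex \<Rightarrow> real) \<Rightarrow> real" where
  "theta0 p t u =
     (Polynomial.lead_coeff p)\<^sup>2 * \<bar>quadratic_discriminant (Q_form p t u)\<bar> powr (real (Polynomial.degree p) / 2) /
     ((\<Prod>\<alpha>\<in>real_roots p. (t \<alpha>)\<^sup>2) * (\<Prod>\<beta>\<in>upper_roots p. (u \<beta>) ^ 4))"

definition admissible :: "real poly \<Rightarrow> (real \<Rightarrow> real) \<Rightarrow> (complex \<Rightarrow> real) \<Rightarrow> bool" where
  "admissible p t u \<longleftrightarrow> (\<forall>\<alpha>\<in>real_roots p. t \<alpha> \<noteq> 0) \<and> (\<forall>\<beta>\<in>upper_roots p. u \<beta> \<noteq> 0)"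

definition is_julia_quadratic :: "real poly \<Rightarrow> real poly \<Rightarrow> bool" where
  "is_julia_quadratic p J \<longleftrightarrow> (\<exists>t u. admissible p t u \<and>
     (\<forall>t' u'. admissible p t' u' \<longrightarrow> theta0 p t u \<le> theta0 p t' u') \<and> J = Q_form p t u)"

definition julia_zeta :: "real poly \<Rightarrow> complex" where
  "julia_zeta p = (THE \<zeta>. Im \<zeta> > 0 \<and>
     (\<exists>J. is_julia_quadratic p J \<and> poly (map_poly complex_of_real J) \<zeta> = 0))"

definition fundamental_domain :: "complex set" where
  "fundamental_domain = {\<tau>. Im \<tau> > 0 \<and> \<bar>Re \<tau>\<bar> \<le> 1 / 2 \<and> cmod \<tau> \<ge> 1}"

definition reduced_form :: "(real \<Rightarrow> real \<Rightarrow> real) \<Rightarrow> bool" where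
  "reduced_form f \<longleftrightarrow> (\<exists>p. f = binary_form p \<and> p \<noteq> 0 \<and>
     card {z. poly (map_poly complex_of_real p) z = 0} = Polynomial.degree p \<and>
     julia_zeta p \<in> fundamental_domain)"

end

theory Submission
  imports Defs
begin

text \<open>
  Let \<open>l(D)\<close> be the dimension of the Riemann--Roch space. With the genus defined as the maximum of
  \<open>deg D - l(D) + 1\<close>, Riemann's inequality \<open>l(D) \<ge> deg D - 1\<close> is part of the hypothesis; it already
  forces \<open>L(0) = k\<close>, finiteness of zeros and poles, and principal divisors of degree 0. A pairing
  argument in the style of Weil differentials produces a function \<open>x\<close> of degree 2. Comparing
  dimensions of \<open>L(n D)\<close> for the pole divisor \<open>D\<close> of \<open>x\<close> gives \<open>y \<in> L(3D)\<close> with \<open>y\<^sup>2 = g(x)\<close>, where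
  \<open>g\<close> is squarefree of degree 5 or 6. An automorphism that moves \<open>x\<close> acts on it as a Moebius
  involution, so \<open>x\<close> may be chosen with image \<open>-x\<close>; since all elements of the group are involutions,
  \<open>y\<close> goes to \<open>\<plusminus>y\<close>, hence \<open>g\<close> is even, and it is normalised by scaling \<open>x\<close> and \<open>y\<close>.

  For the second half, the arithmetic-geometric mean inequality shows that the root of the Julia
  quadratic is the point \<open>s + i h\<close> that minimises the product of \<open>(\<bar>s - z\<bar>\<^sup>2 + h\<^sup>2) / h\<close> over the six
  roots \<open>z\<close>. As the roots are symmetric about \<open>0\<close>, the minimum lies at \<open>i r\<close> for some \<open>r > 0\<close>; passing
  from \<open>f(x, z)\<close> to \<open>f(-z, x)\<close> replaces \<open>r\<close> by \<open>1 / r\<close>.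
\<close>

section \<open>Linear algebra over the constant field\<close>

text \<open>The hypothesis on the genus bounds deg D - l(D) for every divisor and gives equality for
  one of them; it comes without duality or a canonical divisor. Most of the first half therefore
  rests on one device: when the products x^i w_k in some L(E) outnumber l(E), they satisfy a linear
  relation, whose coefficients are read as polynomials in x. Finding a function of degree two is
  harder, since a place P may well have l(2P) = 1; there a special divisor has to be constructed,
  and two linear forms on F stand in for differentials.

  The obstacle in the second half is that the roots of f are known to be distinct in the abstract
  field \<open>qbar\<close>, while reduction concerns complex roots; separability is carried over by
  a gcd computed over the rationals. The minimum lies on the imaginary axis because each pair of
  roots z, -z contributes |q - z^2|^2 / h^2 + 4 (Re z)^2 with q = s^2 + h^2: for fixed q this can
  only fall as h grows, that is, as the point slides along its circle towards the axis.\<close>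

locale field_extension =
  fixes e :: "'k::field \<Rightarrow> 'f::field"
  assumes embedding: "field_embedding e"
begin

lemma e_1 [simp]: "e 1 = 1" and e_add: "e (a + b) = e a + e b" and e_mult: "e (a * b) = e a * e b"
  using embedding by (auto simp: field_embedding_def)

lemma e_0 [simp]: "e 0 = 0"
  using e_add[of 0 0] by (metis add.right_neutral add_cancel_left_right)

lemma e_minus: "e (- a) = - e a"
  using e_add[of a "- a"] by (simp add: eq_neg_iff_add_eq_0 add.commute)

lemma e_diff: "e (a - b) = e a - e b"
  using e_add[of a "- b"] by (simp add: e_minus)

lemma e_eq_0_iff [simp]: "e a = 0 \<longleftrightarrow> a = 0"
proof
  assume "e a = 0"
  then have "e (a * inverse a) = 0" by (simp add: e_mult)
  then show "a = 0" by (metis e_1 right_inverse zero_neq_one)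
qed auto

lemma e_eq_iff [simp]: "e a = e b \<longleftrightarrow> a = b"
  using e_eq_0_iff[of "a - b"] by (simp add: e_diff)

lemma e_inverse: "e (inverse a) = inverse (e a)"
  by (cases "a = 0") (simp, metis e_1 e_mult inverse_unique right_inverse)

lemma e_divide: "e (a / b) = e a / e b"
  by (simp add: divide_inverse e_mult e_inverse)

lemma e_power: "e (a ^ n) = e a ^ n"
  by (induction n) (auto simp: e_mult)

sublocale vs: vector_space "\<lambda>c h. e c * h"
  by unfold_locales (auto simp: e_add e_mult algebra_simps)

abbreviation ev :: "'k poly \<Rightarrow> 'f \<Rightarrow> 'f" where
  "ev p x \<equiv> poly (map_poly e p) x"

lemma map_poly_e_add: "map_poly e (p + q) = map_poly e p + map_poly e q"
  by (rule poly_eqI) (simp add: coeff_map_poly e_add)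

lemma ev_pCons [simp]: "ev (pCons a p) x = e a + x * ev p x"
  by (simp add: map_poly_pCons)

lemma ev_add: "ev (p + q) x = ev p x + ev q x"
  by (simp add: map_poly_e_add)

lemma ev_smult: "ev (Polynomial.smult c p) x = e c * ev p x"
  by (induction p) (auto simp: e_mult algebra_simps)

lemma ev_minus: "ev (- p) x = - ev p x"
  by (metis add.right_inverse ev_add map_poly_0 minus_unique poly_0)

lemma ev_diff: "ev (p - q) x = ev p x - ev q x"
  using ev_add[of p "- q" x] by (simp add: ev_minus)

lemma ev_mult: "ev (p * q) x = ev p x * ev q x"
  by (induction p) (auto simp: ev_add ev_smult algebra_simps)

lemma ev_power: "ev (p ^ n) x = ev p x ^ n"
  by (induction n) (auto simp: ev_mult)

lemma ev_monom: "ev (Polynomial.monom c n) x = e c * x ^ n"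
  by (simp add: map_poly_monom poly_monom)

lemma ev_sum: "ev (sum f A) x = (\<Sum>i\<in>A. ev (f i) x)"
  by (induction A rule: infinite_finite_induct) (auto simp: ev_add)

lemma ev_altdef:
  assumes "Polynomial.degree p \<le> n"
  shows "ev p x = (\<Sum>i\<le>n. e (Polynomial.coeff p i) * x ^ i)"
proof -
  have "p = (\<Sum>i\<le>n. Polynomial.monom (Polynomial.coeff p i) i)"
    using assms by (metis poly_as_sum_of_monoms')
  then show ?thesis by (metis (mono_tags, lifting) ev_monom ev_sum sum.cong)
qed

lemma ev_pcompose: "ev (pcompose p q) x = ev p (ev q x)"
  by (induction p) (auto simp: pcompose_pCons ev_add ev_mult)

text \<open>Indexed families are used because monomials such as z^i h^j may coincide; a repetition
  is itself a relation, and the injective case is the usual exchange bound.\<close>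

lemma family_dependent:
  assumes "finite I" and T: "finite T" "f ` I \<subseteq> vs.span T" "card T < card I"
  shows "\<exists>c. (\<exists>i\<in>I. c i \<noteq> 0) \<and> (\<Sum>i\<in>I. e (c i) * f i) = 0"
proof (cases "inj_on f I")
  case True
  have "vs.dependent (f ` I)"
    using vs.independent_span_bound[OF T(1) _ T(2)] T(3) card_image[OF True] by fastforce
  then obtain u where u: "\<exists>v\<in>f ` I. u v \<noteq> 0" "(\<Sum>v\<in>f ` I. e (u v) * v) = 0"
    using vs.dependent_finite[of "f ` I"] \<open>finite I\<close> by auto
  then show ?thesis
    using True by (intro exI[of _ "u \<circ> f"]) (auto simp: sum.reindex)
next
  case False
  then obtain i j where ij: "i \<in> I" "j \<in> I" "i \<noteq> j" "f i = f j" by (auto simp: inj_on_def)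
  define c where "c k = (if k = i then 1 else if k = j then -1 else (0::'k))" for k
  have "(\<Sum>k\<in>I. e (c k) * f k) = (\<Sum>k\<in>{i,j}. e (c k) * f k)"
    using ij \<open>finite I\<close> by (intro sum.mono_neutral_right) (auto simp: c_def)
  also have "\<dots> = 0" using ij by (simp add: c_def e_minus)
  finally show ?thesis using ij by (intro exI[of _ c]) (auto simp: c_def)
qed

text \<open>\<open>vs.dim\<close> is the cardinality of a basis, hence 0 for an infinite-dimensional
  space. Bounds on it say little until this predicate is known.\<close>

definition fin_span :: "'f set \<Rightarrow> bool" where
  "fin_span V \<longleftrightarrow> (\<exists>T. finite T \<and> V \<subseteq> vs.span T)"

lemma fin_span_basis:
  assumes "fin_span V" "vs.subspace V"
  obtains T where "finite T" "T \<subseteq> V" "vs.independent T" "vs.span T = V" "card T = vs.dim V"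
proof -
  obtain B where B: "B \<subseteq> V" "vs.independent B" "V \<subseteq> vs.span B" "card B = vs.dim V"
    using vs.basis_exists by blast
  moreover have "finite B"
    using assms(1) vs.independent_span_bound[of _ B] B by (auto simp: fin_span_def)
  moreover have "vs.span B = V"
    using B assms(2) vs.span_minimal[of B V] by blast
  ultimately show ?thesis using that by blast
qed

lemma fin_span_dependent:
  assumes "fin_span V" "vs.subspace V" "finite I" "\<And>i. i \<in> I \<Longrightarrow> f i \<in> V" "vs.dim V < card I"
  shows "\<exists>c. (\<exists>i\<in>I. c i \<noteq> 0) \<and> (\<Sum>i\<in>I. e (c i) * f i) = 0"
proof -
  obtain T where "finite T" "vs.span T = V" "card T = vs.dim V"
    using fin_span_basis[OF assms(1,2)] by metis
  then show ?thesis
    using family_dependent[OF assms(3), of T f] assms(4,5) by (metis image_subsetI)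
qed

lemma dim_not_fin_span:
  assumes "\<not> fin_span V" "vs.subspace V"
  shows "vs.dim V = 0"
proof -
  obtain B where B: "B \<subseteq> V" "vs.independent B" "V \<subseteq> vs.span B" "card B = vs.dim V"
    using vs.basis_exists by blast
  moreover have "infinite B" using assms(1) B(3) by (auto simp: fin_span_def)
  ultimately show ?thesis by (metis card.infinite)
qed

lemma dim_mono:
  assumes "V \<subseteq> W" "fin_span W" "vs.subspace W"
  shows "vs.dim V \<le> vs.dim W"
  by (metis assms vs.dim_le_card fin_span_basis)

lemma fin_span_subset: "V \<subseteq> W \<Longrightarrow> fin_span W \<Longrightarrow> fin_span V"
  by (auto simp: fin_span_def)

lemma dim_insert_le:
  assumes "V \<subseteq> vs.span (insert w W)" "fin_span W" "vs.subspace W"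
  shows "fin_span V" and "vs.dim V \<le> vs.dim W + 1"
proof -
  obtain T where T: "finite T" "vs.span T = W" "card T = vs.dim W"
    using fin_span_basis[OF assms(2,3)] by metis
  have sub: "V \<subseteq> vs.span (insert w T)"
    using assms(1) T(2)
    by (smt (verit) insert_subset subset_trans vs.span_base vs.span_minimal vs.span_mono vs.subspace_span insertI1 subset_insertI)
  then show "fin_span V" using T(1) by (auto simp: fin_span_def)
  have "vs.dim V \<le> card (insert w T)" using sub T(1) by (intro vs.dim_le_card) auto
  then show "vs.dim V \<le> vs.dim W + 1" using T(1,3) by (simp add: card_insert_if split: if_splits)
qed

lemma dim_eq_subset:
  assumes "V \<subseteq> W" "vs.subspace V" "vs.subspace W" "fin_span W" "vs.dim W \<le> vs.dim V"
  shows "V = W"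
proof (rule ccontr)
  assume "V \<noteq> W"
  then obtain w where w: "w \<in> W" "w \<notin> V" using assms(1) by blast
  obtain T where T: "finite T" "vs.independent T" "vs.span T = V" "card T = vs.dim V" "T \<subseteq> V"
    using fin_span_basis[OF fin_span_subset[OF assms(1,4)] assms(2)] by metis
  have "vs.independent (insert w T)" using w T by (simp add: vs.independent_insertI)
  moreover obtain S where S: "finite S" "vs.span S = W" "card S = vs.dim W"
    using fin_span_basis[OF assms(4,3)] by metis
  moreover have "insert w T \<subseteq> W" using w T assms(1) by auto
  ultimately have "card (insert w T) \<le> card S"
    by (metis vs.independent_span_bound)
  moreover have "w \<notin> T" using w T by auto
  ultimately show False using T S assms(5) by simp
qed

section \<open>The field k(x) of rational functions in x\<close>

definition ratl :: "'f \<Rightarrow> 'f set" where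
  "ratl x = {ev p x / ev q x | p q. q \<noteq> 0}"

lemma ratlI: "q \<noteq> 0 \<Longrightarrow> ev p x / ev q x \<in> ratl x"
  by (auto simp: ratl_def)

lemma ev_in_ratl: "ev p x \<in> ratl x"
  using ratlI[of 1 p x] by simp

lemma e_in_ratl: "e c \<in> ratl x"
  using ev_in_ratl[of "[:c:]" x] by simp

lemma transcendentalD: "transcendental_over e x \<Longrightarrow> ev p x = 0 \<longleftrightarrow> p = 0"
  by (auto simp: transcendental_over_def)

lemma ratl_subfield:
  assumes "transcendental_over e x"
  shows "is_subfield (ratl x)"
  unfolding is_subfield_def
proof (intro conjI ballI)
  note [simp] = transcendentalD[OF assms]
  show "1 \<in> ratl x" using ev_in_ratl[of 1 x] by simp
  fix a b assume "a \<in> ratl x" "b \<in> ratl x"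
  then obtain p q r s where pq: "a = ev p x / ev q x" "b = ev r x / ev s x" "q \<noteq> 0" "s \<noteq> 0"
    by (auto simp: ratl_def)
  have "a - b = ev (p * s - r * q) x / ev (q * s) x"
    using pq by (simp add: ev_mult ev_diff diff_frac_eq)
  then show "a - b \<in> ratl x" using pq ratlI[of "q * s"] by simp
  have "a * b = ev (p * r) x / ev (q * s) x"
    using pq by (simp add: ev_mult)
  then show "a * b \<in> ratl x" using pq ratlI[of "q * s"] by simp
next
  fix a assume "a \<in> ratl x"
  then obtain p q where pq: "a = ev p x / ev q x" "q \<noteq> 0" by (auto simp: ratl_def)
  show "inverse a \<in> ratl x"
  proof (cases "p = 0")
    case True
    then show ?thesis using pq ev_in_ratl[of 0 x] by simp
  next
    case False
    then show ?thesis using pq ratlI[of p q x] by simp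
  qed
qed

lemma adjoin_subset_ratl:
  assumes "transcendental_over e x"
  shows "adjoin e {x} \<subseteq> ratl x"
proof -
  have "x \<in> ratl x" using ev_in_ratl[of "[:0,1:]" x] by simp
  then show ?thesis
    unfolding adjoin_def using ratl_subfield[OF assms] e_in_ratl by (intro hull_minimal) auto
qed

lemma subfieldD:
  assumes "is_subfield E" "a \<in> E" "b \<in> E"
  shows "a - b \<in> E" "a * b \<in> E" "a + b \<in> E" "- a \<in> E" "a / b \<in> E"
proof -
  have *: "a - b \<in> E" "a * b \<in> E" if "a \<in> E" "b \<in> E" for a b
    using assms(1) that unfolding is_subfield_def by blast+
  show "a - b \<in> E" "a * b \<in> E" using * assms by auto
  have "0 \<in> E" using *(1)[of a a] assms(2) by simp
  then show "- a \<in> E" using *(1)[of 0 a] assms by simp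
  have "- b \<in> E" using *(1)[of 0 b] \<open>0 \<in> E\<close> assms by simp
  then show "a + b \<in> E" using *(1)[of a "- b"] assms by simp
  have "inverse b \<in> E" using assms unfolding is_subfield_def by blast
  then show "a / b \<in> E" using *(2)[of a "inverse b"] assms by (simp add: divide_inverse)
qed

lemma ratl_common_denominator:
  assumes "transcendental_over e x" "finite S" "\<And>s. s \<in> S \<Longrightarrow> c s \<in> ratl x"
  shows "\<exists>q p. q \<noteq> 0 \<and> (\<forall>s\<in>S. ev q x * c s = ev (p s) x)"
  using assms(2,3)
proof (induction S)
  case empty
  show ?case by (intro exI[of _ 1]) auto
next
  case (insert s S)
  obtain q p where qp: "q \<noteq> 0" "\<forall>s\<in>S. ev q x * c s = ev (p s) x"
    using insert.IH[OF insert.prems[OF insertI2]] by blast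
  obtain a b where ab: "c s = ev a x / ev b x" "b \<noteq> 0"
    using insert.prems[of s] unfolding ratl_def by blast
  have b0: "ev b x \<noteq> 0" using ab(2) transcendentalD[OF assms(1)] by simp
  have "ev (q * b) x * c t = ev (if t = s then q * a else b * p t) x" if t: "t \<in> insert s S" for t
  proof (cases "t = s")
    case True
    then show ?thesis using ab(1) b0 by (simp add: ev_mult)
  next
    case False
    then have "ev q x * c t = ev (p t) x" using qp t by blast
    then show ?thesis using False by (simp add: ev_mult mult.commute mult.left_commute)
  qed
  then have "\<forall>t\<in>insert s S. ev (q * b) x * c t = ev ((\<lambda>t. if t = s then q * a else b * p t) t) x"
    by simp
  moreover have "q * b \<noteq> 0" using qp(1) ab(2) by simp
  ultimately show ?case by (intro exI conjI)
qed

end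

text \<open>Counting monomials \<open>z\<^sup>i h\<^sup>j\<close> against the growth of spaces of bounded degree over \<open>k[x]\<close>.\<close>

lemma function_field_algebraic_dependence:
  fixes e :: "'k::field \<Rightarrow> 'f::field"
  assumes ff: "function_field e"
  shows "\<exists>M c. (\<exists>i\<le>M. \<exists>j\<le>M. c i j \<noteq> 0) \<and> (\<Sum>i\<le>M::nat. \<Sum>j\<le>M::nat. e (c i j) * z ^ i * h ^ j) = 0"
proof -
  interpret field_extension e using ff by unfold_locales (simp add: function_field_def)
  obtain x B where x: "transcendental_over e x" and B: "finite B"
    and span: "\<And>y. \<exists>c. (\<forall>b\<in>B. c b \<in> adjoin e {x}) \<and> y = (\<Sum>b\<in>B. c b * b)"
    using ff unfolding function_field_def by blast
  \<comment> \<open>Multiplication by z and by h on the spanning set \<open>B\<close>, together with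
    the element 1, is all that has to be expanded over k(x); \<open>q\<close> below clears every
    denominator at once.\<close>
  define S where "S = {1} \<union> (\<lambda>b. z * b) ` B \<union> (\<lambda>b. h * b) ` B"
  have "\<exists>c. (\<forall>b\<in>B. c b \<in> ratl x) \<and> y = (\<Sum>b\<in>B. c b * b)" for y
    using span[of y] adjoin_subset_ratl[OF x] by blast
  then obtain c where c: "\<And>y b. b \<in> B \<Longrightarrow> c y b \<in> ratl x" "\<And>y. y = (\<Sum>b\<in>B. c y b * b)"
    by metis
  have "finite (S \<times> B)" using B by (simp add: S_def)
  from ratl_common_denominator[OF x this, of "\<lambda>(s, b). c s b"] c(1)
  obtain q p where q: "q \<noteq> 0" and p: "\<And>s b. s \<in> S \<Longrightarrow> b \<in> B \<Longrightarrow> ev q x * c s b = ev (p (s, b)) x"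
    by auto
  have rep: "ev q x * s = (\<Sum>b\<in>B. ev (p (s, b)) x * b)" if "s \<in> S" for s
  proof -
    have "ev q x * s = ev q x * (\<Sum>b\<in>B. c s b * b)" using c(2)[of s] by simp
    also have "\<dots> = (\<Sum>b\<in>B. ev (p (s, b)) x * b)"
      unfolding sum_distrib_left using p[OF that] by (intro sum.cong) (auto simp: mult.assoc[symmetric])
    finally show ?thesis .
  qed
  define C where "C = Max (insert (Polynomial.degree q) ((\<lambda>sb. Polynomial.degree (p sb)) ` (S \<times> B)))"
  have finSB: "finite (insert (Polynomial.degree q) ((\<lambda>sb. Polynomial.degree (p sb)) ` (S \<times> B)))"
    using \<open>finite (S \<times> B)\<close> by simp
  have Cq: "Polynomial.degree q \<le> C" unfolding C_def using finSB by (intro Max_ge) auto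
  have Cp: "Polynomial.degree (p (s, b)) \<le> C" if "s \<in> S" "b \<in> B" for s b
    unfolding C_def using finSB that by (intro Max_ge) auto
  \<comment> \<open>A filtration by the degree of the coefficients: multiplying by q(x), q(x) z or
    q(x) h raises the index by at most \<open>C\<close>.\<close>
  define W where "W j = {(\<Sum>b\<in>B. ev (r b) x * b) | r. \<forall>b\<in>B. Polynomial.degree (r b) \<le> j}" for j
  have Wq: "ev q x * w \<in> W (j + C)" if w: "w \<in> W j" for w j
  proof -
    obtain r where r: "w = (\<Sum>b\<in>B. ev (r b) x * b)" "\<forall>b\<in>B. Polynomial.degree (r b) \<le> j"
      using w by (auto simp: W_def)
    have "ev q x * w = (\<Sum>b\<in>B. ev (r b * q) x * b)"
      by (simp add: r(1) sum_distrib_left ev_mult mult_ac)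
    moreover have "\<forall>b\<in>B. Polynomial.degree (r b * q) \<le> j + C"
      using r(2) Cq by (meson add_mono degree_mult_le order_trans)
    ultimately show ?thesis unfolding W_def by (intro CollectI exI[of _ "\<lambda>b. r b * q"] conjI)
  qed
  have Wm: "ev q x * (m * w) \<in> W (j + C)" if w: "w \<in> W j" and m: "(\<lambda>b. m * b) ` B \<subseteq> S" for w j m
  proof -
    obtain r where r: "w = (\<Sum>b\<in>B. ev (r b) x * b)" "\<forall>b\<in>B. Polynomial.degree (r b) \<le> j"
      using w by (auto simp: W_def)
    have "ev q x * (m * w) = (\<Sum>b\<in>B. ev (r b) x * (ev q x * (m * b)))"
      by (simp add: r(1) sum_distrib_left mult_ac)
    also have "\<dots> = (\<Sum>b\<in>B. ev (r b) x * (\<Sum>b'\<in>B. ev (p (m * b, b')) x * b'))"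
      using m rep by (intro sum.cong) auto
    also have "\<dots> = (\<Sum>b'\<in>B. \<Sum>b\<in>B. ev (r b) x * (ev (p (m * b, b')) x * b'))"
      unfolding sum_distrib_left by (rule sum.swap)
    also have "\<dots> = (\<Sum>b'\<in>B. ev (\<Sum>b\<in>B. r b * p (m * b, b')) x * b')"
      by (simp add: ev_sum ev_mult sum_distrib_right sum_distrib_left mult_ac)
    finally have *: "ev q x * (m * w) = (\<Sum>b'\<in>B. ev (\<Sum>b\<in>B. r b * p (m * b, b')) x * b')" .
    have "\<forall>b'\<in>B. Polynomial.degree (\<Sum>b\<in>B. r b * p (m * b, b')) \<le> j + C"
    proof
      fix b' assume b': "b' \<in> B"
      show "Polynomial.degree (\<Sum>b\<in>B. r b * p (m * b, b')) \<le> j + C"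
      proof (rule degree_sum_le[OF B])
        fix b assume b: "b \<in> B"
        have "Polynomial.degree (r b * p (m * b, b')) \<le> Polynomial.degree (r b) + Polynomial.degree (p (m * b, b'))"
          by (rule degree_mult_le)
        also have "\<dots> \<le> j + C" using r(2) b b' Cp[of "m * b" b'] m by (intro add_mono) auto
        finally show "Polynomial.degree (r b * p (m * b, b')) \<le> j + C" .
      qed
    qed
    with * show ?thesis
      unfolding W_def by (intro CollectI exI[of _ "\<lambda>b'. \<Sum>b\<in>B. r b * p (m * b, b')"] conjI)
  qed
  have W1: "ev q x ^ 1 \<in> W C"
  proof -
    have "ev q x = (\<Sum>b\<in>B. ev (p (1, b)) x * b)" using rep[of 1] by (simp add: S_def)
    moreover have "\<forall>b\<in>B. Polynomial.degree (p (1, b)) \<le> C" using Cp[of 1] by (auto simp: S_def)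
    ultimately show ?thesis unfolding W_def by (intro CollectI exI[of _ "\<lambda>b. p (1, b)"] conjI) auto
  qed
  have Wz: "ev q x ^ (1 + i) * z ^ i \<in> W (C * (1 + i))" for i
  proof (induction i)
    case 0 then show ?case using W1 by simp
  next
    case (Suc i)
    have "ev q x ^ (1 + Suc i) * z ^ Suc i = ev q x * (z * (ev q x ^ (1 + i) * z ^ i))" by simp
    also have "\<dots> \<in> W (C * (1 + i) + C)" by (rule Wm[OF Suc]) (auto simp: S_def)
    finally show ?case by (simp add: algebra_simps)
  qed
  have Wzh: "ev q x ^ (1 + i + j) * (z ^ i * h ^ j) \<in> W (C * (1 + i + j))" for i j
  proof (induction j)
    case 0 then show ?case using Wz[of i] by simp
  next
    case (Suc j)
    have "ev q x ^ (1 + i + Suc j) * (z ^ i * h ^ Suc j) = ev q x * (h * (ev q x ^ (1 + i + j) * (z ^ i * h ^ j)))"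
      by (simp add: mult_ac)
    also have "\<dots> \<in> W (C * (1 + i + j) + C)" by (rule Wm[OF Suc]) (auto simp: S_def)
    finally show ?case by (simp add: algebra_simps)
  qed
  \<comment> \<open>The \<open>l\<close> extra factors q(x) bring all monomials to the same power of
    q(x), which can then be cancelled at the end.\<close>
  have Wzhl: "ev q x ^ (1 + i + j + l) * (z ^ i * h ^ j) \<in> W (C * (1 + i + j + l))" for i j l
  proof (induction l)
    case 0 then show ?case using Wzh[of i j] by simp
  next
    case (Suc l)
    have "ev q x ^ (1 + i + j + Suc l) * (z ^ i * h ^ j) = ev q x * (ev q x ^ (1 + i + j + l) * (z ^ i * h ^ j))"
      by (simp add: mult_ac)
    also have "\<dots> \<in> W (C * (1 + i + j + l) + C)" by (rule Wq[OF Suc])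
    finally show ?case by (simp add: algebra_simps)
  qed
  define N where "N = card B"
  \<comment> \<open>\<open>W J\<close> has at most (J + 1) N generators over k, which is linear in M
    with slope 2 C N, against (M + 1)^2 monomials. This M is large enough for the square to
    win.\<close>
  define M where "M = (2 * C + 1) * N"
  define J where "J = C * (1 + 2 * M)"
  define T where "T = (\<lambda>(i, b). x ^ i * b) ` ({..J} \<times> B)"
  have W_span: "W J \<subseteq> vs.span T"
  proof
    fix w assume "w \<in> W J"
    then obtain r where r: "w = (\<Sum>b\<in>B. ev (r b) x * b)" "\<forall>b\<in>B. Polynomial.degree (r b) \<le> J"
      by (auto simp: W_def)
    have "w = (\<Sum>b\<in>B. \<Sum>i\<le>J. e (Polynomial.coeff (r b) i) * (x ^ i * b))"
      unfolding r(1) using r(2) by (intro sum.cong) (auto simp: ev_altdef[of _ J] sum_distrib_right sum_distrib_left mult_ac)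
    also have "\<dots> \<in> vs.span T"
      by (intro vs.span_sum vs.span_scale vs.span_base) (auto simp: T_def)
    finally show "w \<in> vs.span T" .
  qed
  have "card T \<le> (J + 1) * N"
    unfolding T_def N_def using card_image_le[of "{..J} \<times> B" "\<lambda>(i, b). x ^ i * b"] B by simp
  also have "\<dots> < (M + 1) * (M + 1)"
  proof -
    have "(J + 1) * N = 2 * C * N * M + (C + 1) * N" by (simp add: J_def algebra_simps)
    moreover have "M * M = 2 * C * N * M + N * M" by (simp add: M_def algebra_simps)
    moreover have "(C + 1) * N \<le> M" by (simp add: M_def algebra_simps)
    ultimately show ?thesis by (simp add: algebra_simps)
  qed
  also have "\<dots> = card ({..M} \<times> {..M})" by simp
  finally have card: "card T < card ({..M} \<times> {..M})" .
  define f where "f = (\<lambda>(i, j). ev q x ^ (1 + 2 * M) * (z ^ i * h ^ j))"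
  have "f (i, j) \<in> W J" if "i \<le> M" "j \<le> M" for i j
    using Wzhl[of i j "2 * M - i - j"] that by (simp add: f_def J_def)
  then have fI: "f ` ({..M} \<times> {..M}) \<subseteq> vs.span T" using W_span by auto
  have "finite T" using B by (simp add: T_def)
  from family_dependent[OF _ this fI card] obtain d where d: "\<exists>i\<in>{..M} \<times> {..M}. d i \<noteq> 0"
    "(\<Sum>i\<in>{..M} \<times> {..M}. e (d i) * f i) = 0" by auto
  have "(\<Sum>i\<in>{..M} \<times> {..M}. e (d i) * f i) = (\<Sum>i\<le>M. \<Sum>j\<le>M. e (d (i, j)) * f (i, j))"
    by (simp add: sum.cartesian_product)
  also have "\<dots> = ev q x ^ (1 + 2 * M) * (\<Sum>i\<le>M. \<Sum>j\<le>M. e (d (i, j)) * z ^ i * h ^ j)"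
    unfolding sum_distrib_left by (intro sum.cong) (auto simp: f_def mult_ac)
  finally have "(\<Sum>i\<le>M. \<Sum>j\<le>M. e (d (i, j)) * z ^ i * h ^ j) = 0"
    using d(2) transcendentalD[OF x, of q] q by simp
  then show ?thesis using d(1) by (intro exI[of _ M] exI[of _ "\<lambda>i j. d (i, j)"]) auto
qed

section \<open>Places\<close>

text \<open>Order at least n, with the value infinity at 0 restored; the places themselves take the
  value 0 there.\<close>

definition ordge :: "('f \<Rightarrow> int) \<Rightarrow> int \<Rightarrow> 'f::field \<Rightarrow> bool" where
  "ordge v n a \<longleftrightarrow> a = 0 \<or> n \<le> v a"

context field_extension
begin

lemma place_e: "v \<in> places e \<Longrightarrow> v (e c) = 0"
  and place_mult: "v \<in> places e \<Longrightarrow> a \<noteq> 0 \<Longrightarrow> b \<noteq> 0 \<Longrightarrow> v (a * b) = v a + v b"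
  and place_0: "v \<in> places e \<Longrightarrow> v 0 = 0"
  by (auto simp: places_def)

lemma place_1: "v \<in> places e \<Longrightarrow> v 1 = 0"
  using place_e[of v 1] by simp

lemma place_minus: "v \<in> places e \<Longrightarrow> v (- a) = v a"
  using place_mult[of v "e (- 1)" a] place_e[of v "- 1"] by (cases "a = 0") (auto simp: e_minus)

lemma place_inverse: "v \<in> places e \<Longrightarrow> v (inverse a) = - v a"
  using place_mult[of v a "inverse a"] place_1[of v] by (cases "a = 0") (auto simp: place_0)

lemma place_divide: "v \<in> places e \<Longrightarrow> a \<noteq> 0 \<Longrightarrow> b \<noteq> 0 \<Longrightarrow> v (a / b) = v a - v b"
  by (simp add: divide_inverse place_mult place_inverse)

lemma place_power: "v \<in> places e \<Longrightarrow> a \<noteq> 0 \<Longrightarrow> v (a ^ n) = int n * v a"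
  by (induction n) (auto simp: place_1 place_mult algebra_simps)

lemma ordge_0 [simp]: "ordge v n 0"
  by (simp add: ordge_def)

lemma ordge_add: "v \<in> places e \<Longrightarrow> ordge v n a \<Longrightarrow> ordge v n b \<Longrightarrow> ordge v n (a + b)"
  unfolding ordge_def places_def by (cases "a = 0 \<or> b = 0 \<or> a + b = 0") (auto, smt (verit))

lemma ordge_mult: "v \<in> places e \<Longrightarrow> ordge v n a \<Longrightarrow> ordge v m b \<Longrightarrow> ordge v (n + m) (a * b)"
  by (cases "a = 0 \<or> b = 0") (auto simp: ordge_def place_mult)

lemma ordge_e: "v \<in> places e \<Longrightarrow> n \<le> 0 \<Longrightarrow> ordge v n (e c)"
  by (simp add: ordge_def place_e)

lemma ordge_scale: "v \<in> places e \<Longrightarrow> ordge v n a \<Longrightarrow> ordge v n (e c * a)"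
  using ordge_mult[of v 0 "e c" n a] ordge_e[of v 0 c] by simp

lemma ordge_minus: "v \<in> places e \<Longrightarrow> ordge v n (- a) \<longleftrightarrow> ordge v n a"
  by (simp add: ordge_def place_minus)

lemma ordge_diff: "v \<in> places e \<Longrightarrow> ordge v n a \<Longrightarrow> ordge v n b \<Longrightarrow> ordge v n (a - b)"
  using ordge_add[of v n a "- b"] by (simp add: ordge_minus)

lemma ordge_sum: "v \<in> places e \<Longrightarrow> (\<And>i. i \<in> A \<Longrightarrow> ordge v n (f i)) \<Longrightarrow> ordge v n (sum f A)"
  by (induction A rule: infinite_finite_induct) (auto intro: ordge_add)

lemma ordge_mono: "ordge v n a \<Longrightarrow> m \<le> n \<Longrightarrow> ordge v m a"
  by (auto simp: ordge_def)

lemma ordge_power: "v \<in> places e \<Longrightarrow> ordge v n a \<Longrightarrow> ordge v (int i * n) (a ^ i)"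
  by (cases "a = 0") (auto simp: ordge_def place_power power_0_left place_1 intro: mult_left_mono)

lemma place_add_eq:
  assumes v: "v \<in> places e" and a: "a \<noteq> 0" and b: "ordge v (v a + 1) b"
  shows "a + b \<noteq> 0" "v (a + b) = v a"
proof -
  show nz: "a + b \<noteq> 0"
  proof
    assume "a + b = 0"
    then have "b = - a" by (simp add: eq_neg_iff_add_eq_0 add.commute)
    then show False using b a by (simp add: ordge_def place_minus[OF v])
  qed
  have "ordge v (v a) (a + b)"
    using b by (intro ordge_add[OF v] ordge_mono[OF b]) (auto simp: ordge_def)
  moreover have "\<not> ordge v (v a + 1) (a + b)"
  proof
    assume "ordge v (v a + 1) (a + b)"
    then have "ordge v (v a + 1) (a + b - b)" using b by (intro ordge_diff[OF v])
    then show False using a by (simp add: ordge_def)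
  qed
  ultimately show "v (a + b) = v a" using nz by (simp add: ordge_def)
qed

lemma ordge_ev: "v \<in> places e \<Longrightarrow> ordge v 0 h \<Longrightarrow> ordge v 0 (ev p h)"
proof (induction p)
  case (pCons a p)
  then show ?case
    using ordge_mult[of v 0 h 0 "ev p h"] by (auto intro!: ordge_add ordge_e)
qed auto

text \<open>At a pole of h the leading term has strictly the lowest order, so nothing can cancel
  it.\<close>

lemma place_ev_neg:
  assumes v: "v \<in> places e" and h: "v h < 0"
  shows "p \<noteq> 0 \<Longrightarrow> ev p h \<noteq> 0 \<and> v (ev p h) = int (Polynomial.degree p) * v h"
proof (induction p)
  case (pCons a p)
  have h0: "h \<noteq> 0" using h place_0[OF v] by auto
  show ?case
  proof (cases "p = 0")
    case True
    then show ?thesis using pCons v by (auto simp: place_e)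
  next
    case False
    then have p: "ev p h \<noteq> 0" "v (ev p h) = int (Polynomial.degree p) * v h" using pCons by auto
    then have v1: "v (h * ev p h) = v h + int (Polynomial.degree p) * v h" using h0 by (simp add: place_mult[OF v])
    then have "v (h * ev p h) + 1 \<le> 0" using h
      by (smt (verit) mult_nonneg_nonpos of_nat_0_le_iff)
    then have "ordge v (v (h * ev p h) + 1) (e a)" using ordge_e[OF v] by blast
    from place_add_eq[OF v _ this] p h0 False v1 show ?thesis by (simp add: algebra_simps)
  qed
qed simp

lemma ev_divide_linear:
  obtains q where "ev p h = (h - e c) * ev q h + e (poly p c)"
proof -
  have "p = [:-c, 1:] * synthetic_div p c + [:poly p c:]"
    by (metis synthetic_div_correct' add.commute)
  then have "ev p h = ev ([:-c, 1:] * synthetic_div p c + [:poly p c:]) h" by simp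
  also have "\<dots> = (h - e c) * ev (synthetic_div p c) h + e (poly p c)"
    by (simp only: ev_add ev_mult) (simp add: e_minus)
  finally show ?thesis using that by blast
qed

text \<open>Modulo the maximal ideal of the place, h is the constant c, hence p(h) is p(c).\<close>

lemma place_ev_residue:
  assumes v: "v \<in> places e" and h: "ordge v 1 (h - e c)"
  shows "poly p c \<noteq> 0 \<Longrightarrow> ev p h \<noteq> 0 \<and> v (ev p h) = 0"
    and "poly p c = 0 \<Longrightarrow> ordge v 1 (ev p h)"
proof -
  have h0: "ordge v 0 h"
    using ordge_add[OF v ordge_mono[OF h] ordge_e[OF v], of 0 c] by simp
  obtain q where q: "ev p h = (h - e c) * ev q h + e (poly p c)" using ev_divide_linear .
  have *: "ordge v 1 ((h - e c) * ev q h)"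
    using ordge_mult[OF v h ordge_ev[OF v h0]] by simp
  show "poly p c = 0 \<Longrightarrow> ordge v 1 (ev p h)" using q * by simp
  assume "poly p c \<noteq> 0"
  then show "ev p h \<noteq> 0 \<and> v (ev p h) = 0"
    using place_add_eq[OF v, of "e (poly p c)" "(h - e c) * ev q h"] * v
    unfolding q add.commute[of "(h - e c) * ev q h"] by (simp add: place_e)
qed

end

section \<open>Constants and residues over an algebraically closed field\<close>

locale curve = field_extension e for e :: "'k::alg_closed_field \<Rightarrow> 'f::field" +
  assumes function_field: "function_field e"
begin

lemma algebraic_imp_const: "p \<noteq> 0 \<Longrightarrow> ev p h = 0 \<Longrightarrow> h \<in> range e"
proof (induction "Polynomial.degree p" arbitrary: p rule: less_induct)
  case less
  show ?case
  proof (cases "Polynomial.degree p = 0")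
    case True
    then obtain a where "p = [:a:]" by (rule degree_eq_zeroE)
    then show ?thesis using less.prems by simp
  next
    case False
    then obtain c where "poly p c = 0" using alg_closed_imp_poly_has_root[of p] by blast
    then obtain q where q: "p = [:- c, 1:] * q" using poly_eq_0_iff_dvd by blast
    have "ev p h = (h - e c) * ev q h" unfolding q by (simp only: ev_mult) (simp add: e_minus)
    moreover have "q \<noteq> 0" "Polynomial.degree q < Polynomial.degree p"
      using less.prems(1) unfolding q by (auto simp: degree_mult_eq simp del: mult_pCons_left)
    ultimately show ?thesis using less by auto
  qed
qed

lemma relation_imp_const:
  assumes c: "\<exists>i\<le>n. c i \<noteq> 0" "(\<Sum>i\<le>n. e (c i) * h ^ i) = 0"
  shows "h \<in> range e"
proof (rule algebraic_imp_const)
  let ?p = "\<Sum>j\<le>n. Polynomial.monom (c j) j"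
  have "Polynomial.coeff ?p j = c j" if "j \<le> n" for j using that by (simp add: coeff_sum)
  then show "?p \<noteq> 0" using c(1) by (metis coeff_0)
  show "ev ?p h = 0" using c(2) by (simp add: ev_sum ev_monom)
qed

lemma transcendentalI: "h \<notin> range e \<Longrightarrow> transcendental_over e h"
  using algebraic_imp_const by (auto simp: transcendental_over_def)

text \<open>The maximal ideal of the valuation ring is prime: once it contains p(h), it contains one
  of the linear factors of p(h).\<close>

lemma place_ev_root:
  assumes v: "v \<in> places e" and h: "ordge v 0 h"
  shows "p \<noteq> 0 \<Longrightarrow> ordge v 1 (ev p h) \<Longrightarrow> \<exists>c. poly p c = 0 \<and> ordge v 1 (h - e c)"
proof (induction "Polynomial.degree p" arbitrary: p rule: less_induct)
  case less
  show ?case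
  proof (cases "Polynomial.degree p = 0")
    case True
    then obtain a where "p = [:a:]" by (rule degree_eq_zeroE)
    then show ?thesis using less.prems v by (auto simp: ordge_def place_e)
  next
    case False
    then obtain c where c: "poly p c = 0" using alg_closed_imp_poly_has_root[of p] by blast
    then obtain q where q: "p = [:- c, 1:] * q" using poly_eq_0_iff_dvd by blast
    have ev: "ev p h = (h - e c) * ev q h" unfolding q by (simp only: ev_mult) (simp add: e_minus)
    have q0: "q \<noteq> 0" "Polynomial.degree q < Polynomial.degree p"
      using less.prems(1) unfolding q by (auto simp: degree_mult_eq simp del: mult_pCons_left)
    show ?thesis
    proof (cases "ordge v 1 (h - e c)")
      case True
      then show ?thesis using c by blast
    next
      case hc: False
      have "ordge v 1 (ev q h)"
        using hc less.prems(2) ev ordge_diff[OF v h ordge_e[OF v order_refl, of c]]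
        by (cases "ev q h = 0") (auto simp: ordge_def place_mult[OF v])
      then obtain c' where "poly q c' = 0" "ordge v 1 (h - e c')" using less.hyps[OF q0(2,1)] by blast
      then show ?thesis unfolding q by (intro exI[of _ c']) simp
    qed
  qed
qed

text \<open>Reduce an algebraic relation between \<open>h\<close> and a uniformiser modulo the place.\<close>

lemma residue_exists:
  assumes v: "v \<in> places e" and h: "ordge v 0 h"
  shows "\<exists>c. ordge v 1 (h - e c)"
proof -
  obtain t where t: "v t = 1" using v by (auto simp: places_def)
  then have t0: "t \<noteq> 0" using place_0[OF v] by auto
  obtain M c where c: "\<exists>i\<le>M. \<exists>j\<le>M. c i j \<noteq> 0"
    and s: "(\<Sum>i\<le>M::nat. \<Sum>j\<le>M::nat. e (c i j) * t ^ i * h ^ j) = 0"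
    using function_field_algebraic_dependence[OF function_field, of t h] by blast
  define A where "A i = (\<Sum>j\<le>M. e (c i j) * h ^ j)" for i
  have s: "(\<Sum>i\<le>M. t ^ i * A i) = 0"
    using s unfolding A_def sum_distrib_left by (simp add: mult_ac)
  \<comment> \<open>The lowest power of the uniformiser with a nonzero row of coefficients. After
    division by t^m the relation reduces to a nonzero polynomial in h alone that vanishes modulo the
    place.\<close>
  define m where "m = (LEAST i. i \<le> M \<and> (\<exists>j\<le>M. c i j \<noteq> 0))"
  have m: "m \<le> M" "\<exists>j\<le>M. c m j \<noteq> 0"
    using LeastI_ex[of "\<lambda>i. i \<le> M \<and> (\<exists>j\<le>M. c i j \<noteq> 0)"] c unfolding m_def by blast+
  have least: "c i j = 0" if "i < m" "j \<le> M" for i j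
    using not_less_Least[of i "\<lambda>i. i \<le> M \<and> (\<exists>j\<le>M. c i j \<noteq> 0)"] that m(1) unfolding m_def by auto
  have A0: "ordge v 0 (A i)" for i
    unfolding A_def using ordge_power[OF v h] by (intro ordge_sum[OF v] ordge_scale[OF v]) simp
  have "(\<Sum>i\<le>M. t ^ i * A i) = t ^ m * A m + (\<Sum>i\<in>{..M} - {m}. t ^ i * A i)"
    using m(1) by (simp add: sum.remove)
  then have eq: "t ^ m * A m = - (\<Sum>i\<in>{..M} - {m}. t ^ i * A i)" using s by (simp add: eq_neg_iff_add_eq_0)
  have "ordge v (int m + 1) (t ^ m * A m)"
    unfolding eq ordge_minus[OF v]
  proof (rule ordge_sum[OF v])
    fix i assume i: "i \<in> {..M} - {m}"
    show "ordge v (int m + 1) (t ^ i * A i)"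
    proof (cases "i < m")
      case True
      then have "A i = 0" unfolding A_def using least by (intro sum.neutral) auto
      then show ?thesis by simp
    next
      case False
      have "ordge v (int i + 0) (t ^ i * A i)"
        using t t0 by (intro ordge_mult[OF v] A0) (simp add: ordge_def place_power[OF v])
      then show ?thesis using False i by (elim ordge_mono) auto
    qed
  qed
  then have Am: "ordge v 1 (A m)"
    using t t0 by (cases "A m = 0") (auto simp: ordge_def place_mult[OF v] place_power[OF v])
  define p where "p = (\<Sum>j\<le>M. Polynomial.monom (c m j) j)"
  have "Polynomial.coeff p j = c m j" if "j \<le> M" for j
    using that by (simp add: p_def coeff_sum)
  then have "p \<noteq> 0" using m(2) by auto
  moreover have "ev p h = A m" by (simp add: p_def A_def ev_sum ev_monom)
  ultimately show ?thesis using place_ev_root[OF v h, of p] Am by auto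
qed

end

section \<open>Divisors and Riemann--Roch spaces\<close>

context field_extension
begin

abbreviation pt :: "('f \<Rightarrow> int) \<Rightarrow> ('f \<Rightarrow> int) \<Rightarrow> int" where
  "pt P \<equiv> \<lambda>v. if v = P then 1 else 0"

abbreviation L :: "(('f \<Rightarrow> int) \<Rightarrow> int) \<Rightarrow> 'f set" where "L \<equiv> riemann_roch_space e"

abbreviation l :: "(('f \<Rightarrow> int) \<Rightarrow> int) \<Rightarrow> nat" where "l \<equiv> riemann_roch_dim e"

lemma l_def: "l D = vs.dim (L D)"
  by (simp add: riemann_roch_dim_def)

lemma mem_L: "h \<in> L D \<longleftrightarrow> (\<forall>v\<in>places e. ordge v (- D v) h)"
  by (auto simp: riemann_roch_space_def ordge_def)

lemma subspace_L: "vs.subspace (L D)"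
  by (auto simp: vs.subspace_def mem_L intro: ordge_add ordge_scale)

lemma L_mono: "(\<And>v. v \<in> places e \<Longrightarrow> D v \<le> D' v) \<Longrightarrow> L D \<subseteq> L D'"
  unfolding mem_L by (meson neg_le_iff_le ordge_mono subsetI mem_L)

lemma L_mult: "f \<in> L D \<Longrightarrow> g \<in> L E \<Longrightarrow> f * g \<in> L (\<lambda>v. D v + E v)"
  using ordge_mult by (fastforce simp: mem_L)

lemma L_power: "f \<in> L D \<Longrightarrow> f ^ n \<in> L (\<lambda>v. int n * D v)"
  using ordge_power by (fastforce simp: mem_L)

lemma e_in_L: "(\<And>v. v \<in> places e \<Longrightarrow> 0 \<le> D v) \<Longrightarrow> e c \<in> L D"
  by (simp add: mem_L ordge_e)

lemma div_0 [simp, intro]: "(\<lambda>v. 0) \<in> divisors e"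
  and div_pt [simp, intro]: "P \<in> places e \<Longrightarrow> pt P \<in> divisors e"
  and div_minus [intro]: "D \<in> divisors e \<Longrightarrow> (\<lambda>v. - D v) \<in> divisors e"
  by (auto simp: divisors_def)

lemma div_mult [simp, intro]: "D \<in> divisors e \<Longrightarrow> (\<lambda>v. n * D v) \<in> divisors e"
  by (auto simp: divisors_def elim!: rev_finite_subset)

lemma div_add [simp, intro]:
  assumes "D \<in> divisors e" "E \<in> divisors e"
  shows "(\<lambda>v. D v + E v) \<in> divisors e"
proof -
  have sub: "{v. D v + E v \<noteq> 0} \<subseteq> {v. D v \<noteq> 0} \<union> {v. E v \<noteq> 0}" by auto
  show ?thesis using assms finite_subset[OF sub] sub unfolding divisors_def by blast
qed

lemma div_diff [simp, intro]: "D \<in> divisors e \<Longrightarrow> E \<in> divisors e \<Longrightarrow> (\<lambda>v. D v - E v) \<in> divisors e"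
  using div_add[of D "\<lambda>v. - E v"] div_minus[of E] by simp

lemma degree_alt: "finite S \<Longrightarrow> {v. D v \<noteq> 0} \<subseteq> S \<Longrightarrow> divisor_degree D = sum D S"
  unfolding divisor_degree_def by (rule sum.mono_neutral_left) auto

lemma finite_support: "D \<in> divisors e \<Longrightarrow> finite {v. D v \<noteq> 0}"
  by (simp add: divisors_def)

lemma div_outside: "D \<in> divisors e \<Longrightarrow> v \<notin> places e \<Longrightarrow> D v = 0"
  by (auto simp: divisors_def)

lemma degree_0 [simp]: "divisor_degree (\<lambda>v. 0) = 0"
  by (simp add: divisor_degree_def)

lemma degree_pt [simp]: "divisor_degree (pt P) = 1"
  by (simp add: degree_alt[of "{P}"])

lemma degree_mult [simp]: "divisor_degree (\<lambda>v. n * D v) = n * divisor_degree D"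
  by (cases "n = 0") (auto simp: divisor_degree_def sum_distrib_left)

lemma degree_add [simp]:
  assumes "D \<in> divisors e" "E \<in> divisors e"
  shows "divisor_degree (\<lambda>v. D v + E v) = divisor_degree D + divisor_degree E"
proof -
  let ?S = "{v. D v \<noteq> 0} \<union> {v. E v \<noteq> 0}"
  have "finite ?S" using assms by (simp add: divisors_def)
  then have "divisor_degree (\<lambda>v. D v + E v) = (\<Sum>v\<in>?S. D v + E v)"
    "divisor_degree D = sum D ?S" "divisor_degree E = sum E ?S"
    by (intro degree_alt; auto)+
  then show ?thesis by (simp add: sum.distrib)
qed

lemma degree_minus [simp]: "divisor_degree (\<lambda>v. - D v) = - divisor_degree D"
  by (simp add: divisor_degree_def sum_negf)

lemma degree_diff [simp]:
  "D \<in> divisors e \<Longrightarrow> E \<in> divisors e \<Longrightarrow> divisor_degree (\<lambda>v. D v - E v) = divisor_degree D - divisor_degree E"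
  using degree_add[of D "\<lambda>v. - E v"] div_minus[of E] by simp

lemma degree_mono:
  assumes "D \<in> divisors e" "E \<in> divisors e" "\<And>v. D v \<le> E v"
  shows "divisor_degree D \<le> divisor_degree E"
proof -
  have "0 \<le> divisor_degree (\<lambda>v. E v - D v)"
    unfolding divisor_degree_def using assms(3) by (intro sum_nonneg) auto
  then show ?thesis using assms by simp
qed

end

section \<open>Consequences of Riemann's inequality in genus two\<close>

locale genus_two_curve = curve e for e :: "'k::alg_closed_field \<Rightarrow> 'f::field" +
  assumes genus: "has_genus e 2"
begin

lemma riemann_inequality: "D \<in> divisors e \<Longrightarrow> divisor_degree D - 1 \<le> int (l D)"
  using genus by (fastforce simp: has_genus_def)

lemma nonspecial_divisor:
  obtains D where "D \<in> divisors e" "int (l D) = divisor_degree D - 1"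
proof -
  obtain D where D: "D \<in> divisors e" "divisor_degree D - int (l D) + 1 = int 2"
    using genus unfolding has_genus_def by blast
  show ?thesis by (rule that[OF D(1)]) (use D(2) in linarith)
qed

text \<open>Without places, 0 would be the only divisor, and equality in the definition of the genus
  would give it dimension -1.\<close>

lemma places_nonempty: "places e \<noteq> {}"
proof
  assume "places e = {}"
  obtain D where D: "D \<in> divisors e" "int (l D) = divisor_degree D - 1" by (rule nonspecial_divisor)
  have "D = (\<lambda>v. 0)" using D(1) \<open>places e = {}\<close> by (auto simp: divisors_def)
  then show False using D(2) by simp
qed

text \<open>By the convention that infinite-dimensional spaces have dimension 0, the bound on
  \<open>deg D - l(D)\<close> fails at \<open>D = 2P\<close> unless \<open>L(0)\<close> is finite-dimensional.\<close>

lemma fin_span_L_0: "fin_span (L (\<lambda>v. 0))"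
proof (rule ccontr)
  assume nf: "\<not> fin_span (L (\<lambda>v. 0))"
  obtain P where P: "P \<in> places e" using places_nonempty by blast
  have "\<not> fin_span (L (\<lambda>v. 2 * pt P v))"
    using nf fin_span_subset[OF L_mono[of "\<lambda>v. 0" "\<lambda>v. 2 * pt P v"]] by auto
  then have "l (\<lambda>v. 2 * pt P v) = 0"
    unfolding l_def by (intro dim_not_fin_span subspace_L)
  then show False using riemann_inequality[OF div_mult[OF div_pt[OF P]], of 2]
    unfolding degree_mult degree_pt by simp
qed

text \<open>All powers of an everywhere regular function stay in one finite-dimensional space, so
  the function is algebraic over k, hence constant.\<close>

lemma L_0: "L (\<lambda>v. 0) = range e"
proof
  show "range e \<subseteq> L (\<lambda>v. 0)" by (auto intro: e_in_L)
  show "L (\<lambda>v. 0) \<subseteq> range e"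
  proof
    fix h assume h: "h \<in> L (\<lambda>v. 0)"
    define n where "n = vs.dim (L (\<lambda>v. 0))"
    have "h ^ i \<in> L (\<lambda>v. 0)" for i using L_power[OF h, of i] by simp
    then obtain c where "\<exists>i\<le>n. c i \<noteq> 0" "(\<Sum>i\<le>n. e (c i) * h ^ i) = 0"
      using fin_span_dependent[OF fin_span_L_0 subspace_L, of "{..n}" "\<lambda>i. h ^ i"] by (auto simp: n_def)
    then show "h \<in> range e" by (rule relation_imp_const)
  qed
qed

lemma pole_exists:
  assumes "h \<notin> range e"
  obtains v where "v \<in> places e" "v h < 0"
  using assms unfolding L_0[symmetric] mem_L ordge_def by force

text \<open>If w has order exactly \<open>- D P - 1\<close> at P, any other f in the larger space
  agrees with a constant multiple of w in its leading term there; the constant is the residue of f /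
  w. One new generator therefore suffices.\<close>

lemma L_add_point:
  assumes P: "P \<in> places e" and fin: "fin_span (L D)"
  shows "fin_span (L (\<lambda>v. D v + pt P v))" "l (\<lambda>v. D v + pt P v) \<le> l D + 1"
proof -
  have "\<exists>w. L (\<lambda>v. D v + pt P v) \<subseteq> vs.span (insert w (L D))"
  proof (cases "L (\<lambda>v. D v + pt P v) \<subseteq> L D")
    case True
    moreover have "L D \<subseteq> vs.span (insert 0 (L D))" using vs.span_superset[of "insert 0 (L D)"] by simp
    ultimately have "L (\<lambda>v. D v + pt P v) \<subseteq> vs.span (insert 0 (L D))" by (rule order_trans)
    then show ?thesis ..
  next
    case False
    then obtain w where w: "w \<in> L (\<lambda>v. D v + pt P v)" "w \<notin> L D" by blast
    then have w0: "w \<noteq> 0" by (auto simp: mem_L)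
    have wP: "P w = - D P - 1"
    proof -
      obtain v where v: "v \<in> places e" "\<not> ordge v (- D v) w" using w(2) by (auto simp: mem_L)
      moreover have "ordge v (- (D v + pt P v)) w" using w(1) v(1) unfolding mem_L by blast
      ultimately show ?thesis by (cases "v = P") (auto simp: ordge_def)
    qed
    have "f \<in> vs.span (insert w (L D))" if f: "f \<in> L (\<lambda>v. D v + pt P v)" for f
    proof -
      have fP: "ordge P (- D P - 1) f" using f P unfolding mem_L by fastforce
      then have "ordge P 0 (f / w)" using w0 wP by (cases "f = 0") (auto simp: ordge_def place_divide[OF P])
      then obtain c where "ordge P 1 (f / w - e c)" using residue_exists[OF P] by blast
      then have "ordge P (- D P) ((f / w - e c) * w)"
        using ordge_mult[OF P, of 1 "f / w - e c" "- D P - 1" w] wP by (auto simp: ordge_def)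
      then have gP: "ordge P (- D P) (f - e c * w)" using w0 by (simp add: algebra_simps)
      have "f - e c * w \<in> L (\<lambda>v. D v + pt P v)"
        using f w(1) subspace_L by (intro vs.subspace_diff vs.subspace_scale) auto
      then have "ordge v (- D v) (f - e c * w)" if "v \<in> places e" "v \<noteq> P" for v
        using that unfolding mem_L by force
      with gP have "f - e c * w \<in> L D" unfolding mem_L by metis
      then have "(f - e c * w) + e c * w \<in> vs.span (insert w (L D))"
        by (intro vs.span_add vs.span_scale vs.span_base) auto
      then show ?thesis by simp
    qed
    then show ?thesis by blast
  qed
  then obtain w where w: "L (\<lambda>v. D v + pt P v) \<subseteq> vs.span (insert w (L D))" by blast
  from dim_insert_le[OF w fin subspace_L]
  show "fin_span (L (\<lambda>v. D v + pt P v))" "l (\<lambda>v. D v + pt P v) \<le> l D + 1"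
    by (auto simp: l_def)
qed

text \<open>Adding a point raises the degree by exactly one and l by at most one; the induction
  removes the points of E - D one at a time.\<close>

lemma L_chain:
  assumes D: "D \<in> divisors e" and fin: "fin_span (L D)"
  shows "E \<in> divisors e \<Longrightarrow> (\<And>v. D v \<le> E v) \<Longrightarrow>
    fin_span (L E) \<and> int (l E) - divisor_degree E \<le> int (l D) - divisor_degree D"
proof (induction "nat (divisor_degree E - divisor_degree D)" arbitrary: E rule: less_induct)
  case less
  show ?case
  proof (cases "E = D")
    case True then show ?thesis using fin by simp
  next
    case False
    then obtain P where P: "E P \<noteq> D P" by blast
    then have DP: "D P < E P" using less.prems(2)[of P] by simp
    have Pp: "P \<in> places e" using P D less.prems(1) div_outside by metis
    define F where "F = (\<lambda>v. E v - pt P v)"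
    have F: "F \<in> divisors e" using less.prems(1) Pp by (simp add: F_def)
    have DF: "D v \<le> F v" for v using DP less.prems(2)[of v] by (auto simp: F_def)
    have degF: "divisor_degree F = divisor_degree E - 1"
      using less.prems(1) Pp unfolding F_def by (subst degree_diff) auto
    have "divisor_degree D \<le> divisor_degree F" using degree_mono[OF D F DF] .
    then have IH: "fin_span (L F)" "int (l F) - divisor_degree F \<le> int (l D) - divisor_degree D"
      using less.hyps[OF _ F DF] degF by auto
    have "E = (\<lambda>v. F v + pt P v)" by (auto simp: F_def)
    then show ?thesis using L_add_point[OF Pp IH(1)] IH(2) degF by auto
  qed
qed

lemma fin_span_L: 
  assumes D: "D \<in> divisors e"
  shows "fin_span (L D)"
proof -
  have "(\<lambda>v. max 0 (D v)) \<in> divisors e"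
    using D by (auto simp: divisors_def elim!: rev_finite_subset)
  then have "fin_span (L (\<lambda>v. max 0 (D v)))" using L_chain[OF div_0 fin_span_L_0] by simp
  then show ?thesis by (rule fin_span_subset[rotated]) (rule L_mono, simp)
qed

lemma l_chain:
  "D \<in> divisors e \<Longrightarrow> E \<in> divisors e \<Longrightarrow> (\<And>v. D v \<le> E v) \<Longrightarrow>
    int (l E) - divisor_degree E \<le> int (l D) - divisor_degree D"
  using L_chain[OF _ fin_span_L] by blast

lemma l_0: "l (\<lambda>v. 0) = 1"
proof -
  have "vs.span {1} = range e"
    by (auto simp: vs.span_singleton image_def)
  moreover have "vs.independent {1}" by (simp add: vs.dependent_single)
  ultimately show ?thesis unfolding l_def L_0 by (metis One_nat_def card.empty card.insert empty_iff finite.emptyI vs.dim_span_eq_card_independent)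
qed

lemma l_effective_le: "D \<in> divisors e \<Longrightarrow> (\<And>v. 0 \<le> D v) \<Longrightarrow> int (l D) \<le> divisor_degree D + 1"
  using l_chain[OF div_0, of D] l_0 by simp

lemma L_dependent:
  assumes "D \<in> divisors e" "finite I" "\<And>i. i \<in> I \<Longrightarrow> f i \<in> L D" "l D < card I"
  shows "\<exists>c. (\<exists>i\<in>I. c i \<noteq> 0) \<and> (\<Sum>i\<in>I. e (c i) * f i) = 0"
  using fin_span_dependent[OF fin_span_L[OF assms(1)] subspace_L assms(2,3)] assms(4) by (simp add: l_def)

text \<open>If deg D < 0, Riemann's inequality gives l(-3D) \<ge> 3 - 1 = 2, yet multiplication by
  h^3 embeds L(-3D) into L(0) = k. The multiple 2 would only give l \<ge> 1 and no
  contradiction.\<close>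

lemma L_degree_nonneg:
  assumes D: "D \<in> divisors e" and h: "h \<in> L D" "h \<noteq> 0"
  shows "0 \<le> divisor_degree D"
proof -
  let ?E = "\<lambda>v. - 3 * D v"
  have E: "?E \<in> divisors e" using D by (intro div_mult)
  have "L ?E \<subseteq> vs.span {inverse (h ^ 3)}"
  proof
    fix f assume f: "f \<in> L ?E"
    have "f * h ^ 3 \<in> L (\<lambda>v. - 3 * D v + int 3 * D v)"
      using L_mult[OF f L_power[OF h(1), of 3]] by simp
    also have "(\<lambda>v. - 3 * D v + int 3 * D v) = (\<lambda>v. 0)" by auto
    finally obtain c where "f * h ^ 3 = e c" using L_0 by auto
    then have "f = e c * inverse (h ^ 3)" using h(2) by (simp add: field_simps)
    then show "f \<in> vs.span {inverse (h ^ 3)}" by (auto simp: vs.span_singleton)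
  qed
  then have "l ?E \<le> card {inverse (h ^ 3)}" unfolding l_def by (intro vs.dim_le_card) auto
  then show ?thesis using riemann_inequality[OF E] unfolding degree_mult by simp
qed

text \<open>A zero of h outside the support of D may be subtracted from D without expelling h from
  the space; more than deg D such zeros would make the degree negative.\<close>

lemma finite_zeros:
  assumes D: "D \<in> divisors e" and h: "h \<in> L D" "h \<noteq> 0"
  shows "finite {v\<in>places e. 0 < v h}"
proof (rule ccontr)
  assume "infinite {v\<in>places e. 0 < v h}"
  moreover have "{v\<in>places e. 0 < v h} \<subseteq> {v\<in>places e. 0 < v h \<and> D v = 0} \<union> {v. D v \<noteq> 0}" by auto
  ultimately have "infinite {v\<in>places e. 0 < v h \<and> D v = 0}"
    using finite_support[OF D] infinite_super by blast
  from infinite_arbitrarily_large[OF this, of "nat (divisor_degree D) + 1"]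
  obtain S where S: "S \<subseteq> {v\<in>places e. 0 < v h \<and> D v = 0}" "finite S"
    "card S = nat (divisor_degree D) + 1" by blast
  define E where "E v = (if v \<in> S then 1 else 0::int)" for v :: "'f \<Rightarrow> int"
  have E: "E \<in> divisors e" using S by (auto simp: E_def divisors_def)
  have degE: "divisor_degree E = int (card S)"
    using S(2) by (subst degree_alt[of S]) (auto simp: E_def)
  have "h \<in> L (\<lambda>v. D v - E v)"
    using h S unfolding mem_L by (force simp: E_def ordge_def)
  from L_degree_nonneg[OF div_diff[OF D E] this h(2)] show False
    using degE S(3) D E by (auto split: if_splits)
qed

text \<open>The multiple 3 is the least for which Riemann's inequality yields two
  dimensions.\<close>

lemma nonconstant_single_pole:
  assumes P: "P \<in> places e"
  obtains z where "z \<in> L (\<lambda>v. 3 * pt P v)" "z \<notin> range e"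
proof -
  have D: "(\<lambda>v. 3 * pt P v) \<in> divisors e" by (rule div_mult[OF div_pt[OF P]])
  have "2 \<le> int (l (\<lambda>v. 3 * pt P v))"
    using riemann_inequality[OF D] unfolding degree_mult degree_pt by simp
  then have "\<not> l (\<lambda>v. 3 * pt P v) \<le> l (\<lambda>v. 0)" unfolding l_0 by linarith
  then have "\<not> L (\<lambda>v. 3 * pt P v) \<subseteq> L (\<lambda>v. 0)"
    using dim_mono[OF _ fin_span_L_0 subspace_L] unfolding l_def by blast
  then show ?thesis using that unfolding L_0 by blast
qed

text \<open>No divisor bounding the poles of h is available yet, so h is compared with a function z
  whose only pole is P. In an algebraic relation for h with coefficients in k[z], a pole of h other
  than P forces the top coefficient to vanish there, and \<open>finite_zeros\<close> applies to that
  coefficient.\<close>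

lemma finite_poles: "finite {v\<in>places e. v h < 0}"
proof -
  obtain P where P: "P \<in> places e" using places_nonempty by blast
  obtain z where z: "z \<in> L (\<lambda>v. 3 * pt P v)" "z \<notin> range e" using nonconstant_single_pole[OF P] .
  obtain M c where c: "\<exists>i\<le>M. \<exists>j\<le>M. c i j \<noteq> 0"
    and s: "(\<Sum>i\<le>M::nat. \<Sum>j\<le>M::nat. e (c i j) * h ^ i * z ^ j) = 0"
    using function_field_algebraic_dependence[OF function_field, of h z] by blast
  define A where "A i = (\<Sum>j\<le>M. e (c i j) * z ^ j)" for i
  have s: "(\<Sum>i\<le>M. h ^ i * A i) = 0"
    using s unfolding A_def sum_distrib_left by (simp add: mult_ac)
  define p where "p i = (\<Sum>j\<le>M. Polynomial.monom (c i j) j)" for i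
  have pc: "Polynomial.coeff (p i) j = c i j" if "j \<le> M" for i j using that by (simp add: p_def coeff_sum)
  have Ap: "A i = ev (p i) z" for i by (simp add: p_def A_def ev_sum ev_monom)
  have A0: "A i = 0 \<longleftrightarrow> p i = 0" for i
    unfolding Ap using transcendentalD[OF transcendentalI[OF z(2)]] .
  have AL: "A i \<in> L (\<lambda>v. int M * (3 * pt P v))" for i
    unfolding A_def
  proof (intro vs.subspace_sum[OF subspace_L] vs.subspace_scale[OF subspace_L])
    fix j assume "j \<in> {..M}"
    then have "L (\<lambda>v. int j * (3 * pt P v)) \<subseteq> L (\<lambda>v. int M * (3 * pt P v))" by (intro L_mono) auto
    then show "z ^ j \<in> L (\<lambda>v. int M * (3 * pt P v))" using L_power[OF z(1), of j] by blast
  qed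
  define m where "m = (GREATEST i. i \<le> M \<and> p i \<noteq> 0)"
  have ex: "\<exists>i. i \<le> M \<and> p i \<noteq> 0" using c pc by (metis coeff_0)
  have m: "m \<le> M" "p m \<noteq> 0"
    using GreatestI_ex_nat[OF ex, of M] unfolding m_def by auto
  have gr: "p i = 0" if "m < i" "i \<le> M" for i
    using Greatest_le_nat[of "\<lambda>i. i \<le> M \<and> p i \<noteq> 0" i M] that unfolding m_def by auto
  have "{v\<in>places e. v h < 0} \<subseteq> {P} \<union> {v\<in>places e. 0 < v (A m)}"
  proof
    fix v assume "v \<in> {v\<in>places e. v h < 0}"
    then have v: "v \<in> places e" "v h < 0" by auto
    then have h0: "h \<noteq> 0" using place_0 by force
    show "v \<in> {P} \<union> {v\<in>places e. 0 < v (A m)}"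
    proof (rule ccontr)
      assume "\<not> ?thesis"
      then have v2: "v \<noteq> P" "v (A m) \<le> 0" using v by auto
      have Ai: "ordge v 0 (A i)" for i using AL[of i] v(1) v2(1) unfolding mem_L by force
      have nz: "h ^ m * A m \<noteq> 0" using h0 m(2) A0 by simp
      have vm: "v (h ^ m * A m) \<le> int m * v h"
        using h0 m(2) A0 v2(2) by (simp add: place_mult[OF v(1)] place_power[OF v(1)])
      have "ordge v (int m * v h + 1) (\<Sum>i\<in>{..M} - {m}. h ^ i * A i)"
      proof (rule ordge_sum[OF v(1)])
        fix i assume i: "i \<in> {..M} - {m}"
        show "ordge v (int m * v h + 1) (h ^ i * A i)"
        proof (cases "m < i")
          case True
          then have "A i = 0" using gr A0 i by simp
          then show ?thesis by simp
        next
          case False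
          then have "i < m" using i by auto
          then have "int m * v h + 1 \<le> int i * v h"
            using v(2) by (smt (verit) mult_less_cancel_right of_nat_less_iff)
          moreover have "ordge v (int i * v h + 0) (h ^ i * A i)"
            using h0 by (intro ordge_mult[OF v(1)] Ai) (simp add: ordge_def place_power[OF v(1)])
          ultimately show ?thesis by (auto elim: ordge_mono)
        qed
      qed
      then have "ordge v (v (h ^ m * A m) + 1) (\<Sum>i\<in>{..M} - {m}. h ^ i * A i)"
        using vm by (elim ordge_mono) auto
      from place_add_eq(1)[OF v(1) nz this] show False
        using s m(1) by (simp add: sum.remove)
    qed
  qed
  moreover have "finite {v\<in>places e. 0 < v (A m)}"
  proof (rule finite_zeros[OF _ AL])
    show "A m \<noteq> 0" using m A0 by simp
    show "(\<lambda>v. int M * (3 * pt P v)) \<in> divisors e" by (intro div_mult[of "\<lambda>v. 3 * pt P v"] div_mult[of "pt P"] div_pt[OF P])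
  qed
  ultimately show ?thesis using finite_subset by blast
qed

section \<open>Principal divisors and linear equivalence\<close>

definition principal :: "'f \<Rightarrow> ('f \<Rightarrow> int) \<Rightarrow> int" where
  "principal h v = (if v \<in> places e then v h else 0)"

definition poles :: "'f \<Rightarrow> ('f \<Rightarrow> int) \<Rightarrow> int" where
  "poles h v = (if v \<in> places e then max 0 (- v h) else 0)"

lemma poles_div [simp, intro]: "poles h \<in> divisors e"
proof -
  have "{v. poles h v \<noteq> 0} = {v\<in>places e. v h < 0}" by (auto simp: poles_def)
  then show ?thesis using finite_poles[of h] by (auto simp: divisors_def)
qed

lemma poles_nonneg [simp]: "0 \<le> poles h v"
  by (simp add: poles_def)

lemma mem_L_poles: "h \<in> L (poles h)"
  by (auto simp: mem_L poles_def ordge_def)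

lemma principal_eq: "principal h = (\<lambda>v. poles (inverse h) v - poles h v)"
  by (rule ext) (auto simp: principal_def poles_def place_inverse)

lemma principal_div [simp, intro]: "principal h \<in> divisors e"
  unfolding principal_eq by (intro div_diff poles_div)

text \<open>Both the divisor of h and its negative have nonnegative degree, because 1/h and h are
  nonzero elements of the corresponding spaces.\<close>

lemma degree_principal:
  assumes "h \<noteq> 0"
  shows "divisor_degree (principal h) = 0"
proof -
  have "inverse h \<in> L (principal h)" "h \<in> L (\<lambda>v. - principal h v)"
    by (auto simp: mem_L principal_def ordge_def place_inverse)
  then have "0 \<le> divisor_degree (principal h)" "0 \<le> divisor_degree (\<lambda>v. - principal h v)"
    using assms L_degree_nonneg[OF principal_div] L_degree_nonneg[OF div_minus[OF principal_div]] by auto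
  then show ?thesis by simp
qed

lemma degree_poles_inverse: "h \<noteq> 0 \<Longrightarrow> divisor_degree (poles (inverse h)) = divisor_degree (poles h)"
  using degree_principal[of h] unfolding principal_eq by simp

lemma L_shift: "h \<noteq> 0 \<Longrightarrow> f \<in> L (\<lambda>v. D v + principal h v) \<longleftrightarrow> f * h \<in> L D"
  by (auto simp: mem_L principal_def ordge_def place_mult)

lemma l_shift_le:
  assumes D: "D \<in> divisors e" and h: "h \<noteq> 0"
  shows "l (\<lambda>v. D v + principal h v) \<le> l D"
proof -
  obtain T where T: "finite T" "vs.span T = L D" "card T = vs.dim (L D)"
    using fin_span_basis[OF fin_span_L[OF D] subspace_L] by metis
  have "L (\<lambda>v. D v + principal h v) \<subseteq> vs.span ((\<lambda>t. t / h) ` T)"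
  proof
    fix f assume "f \<in> L (\<lambda>v. D v + principal h v)"
    then have "f * h \<in> vs.span T" using L_shift[OF h] T by simp
    then obtain u where "f * h = (\<Sum>t\<in>T. e (u t) * t)" using vs.span_finite[OF T(1)] by auto
    then have f: "f = (\<Sum>t\<in>T. e (u t) * (t / h))" using h by (simp add: sum_divide_distrib[symmetric] field_simps)
    show "f \<in> vs.span ((\<lambda>t. t / h) ` T)"
      unfolding f by (intro vs.span_sum vs.span_scale vs.span_base) auto
  qed
  then have "l (\<lambda>v. D v + principal h v) \<le> card ((\<lambda>t. t / h) ` T)"
    unfolding l_def using T(1) by (intro vs.dim_le_card) auto
  also have "\<dots> \<le> card T" using T(1) by (rule card_image_le)
  finally show ?thesis using T by (simp add: l_def)
qed

lemma principal_inverse: "principal (inverse h) = (\<lambda>v. - principal h v)"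
  by (auto simp: principal_def place_inverse)

lemma l_shift:
  assumes D: "D \<in> divisors e" and h: "h \<noteq> 0"
  shows "l (\<lambda>v. D v + principal h v) = l D"
proof -
  have "l (\<lambda>v. (D v + principal h v) + principal (inverse h) v) \<le> l (\<lambda>v. D v + principal h v)"
    using D h by (intro l_shift_le) auto
  then show ?thesis using l_shift_le[OF D h] by (simp add: principal_inverse)
qed

text \<open>The divisor D + (h) is equivalent to D and dominates E, and equality in Riemann's
  inequality is inherited by larger divisors.\<close>

lemma nonspecial_if_nonzero:
  assumes D: "D \<in> divisors e" and E: "E \<in> divisors e" and spec: "int (l E) = divisor_degree E - 1"
    and h: "h \<in> L (\<lambda>v. D v - E v)" "h \<noteq> 0"
  shows "int (l D) = divisor_degree D - 1"
proof -
  let ?D = "\<lambda>v. D v + principal h v"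
  have D': "?D \<in> divisors e" using D by auto
  have "E v \<le> ?D v" for v
    using h div_outside[OF D, of v] div_outside[OF E, of v]
    by (auto simp: mem_L principal_def ordge_def)
  from l_chain[OF E D' this] show ?thesis
    using l_shift[OF D h(2)] degree_principal[OF h(2)] D spec riemann_inequality[OF D] by simp
qed

lemma large_multiple_nonspecial:
  assumes D: "D \<in> divisors e" "0 < divisor_degree D"
  obtains N where "\<And>n. N \<le> n \<Longrightarrow> int (l (\<lambda>v. int n * D v)) = int n * divisor_degree D - 1"
proof -
  obtain E where E: "E \<in> divisors e" "int (l E) = divisor_degree E - 1" by (rule nonspecial_divisor)
  show ?thesis
  proof
    \<comment> \<open>With this bound deg(nD - E) \<ge> 2, which is what Riemann's inequality needs
      to produce a nonzero function.\<close>
    fix n assume n: "nat (divisor_degree E + 2) \<le> n"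
    have nD: "(\<lambda>v. int n * D v) \<in> divisors e" using D by auto
    have "int n \<le> int n * divisor_degree D" using D(2) by (simp add: mult_le_cancel_left1)
    then have "1 \<le> divisor_degree (\<lambda>v. int n * D v - E v) - 1"
      using n unfolding degree_diff[OF nD E(1)] degree_mult by linarith
    then have "0 < l (\<lambda>v. int n * D v - E v)"
      using riemann_inequality[OF div_diff[OF nD E(1)]] by linarith
    then have "\<exists>h\<in>L (\<lambda>v. int n * D v - E v). h \<noteq> 0"
      unfolding l_def using vs.dim_le_card[of "L (\<lambda>v. int n * D v - E v)" "{}"] by fastforce
    then show "int (l (\<lambda>v. int n * D v)) = int n * divisor_degree D - 1"
      using nonspecial_if_nonzero[OF nD E] by (metis degree_mult)
  qed
qed

end

section \<open>A function of degree two\<close>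

lemma homogeneous_system:
  fixes a :: "'i \<Rightarrow> 'j \<Rightarrow> 'k::field"
  assumes "finite J" "finite I" "card J < card I"
  shows "\<exists>c. (\<exists>i\<in>I. c i \<noteq> 0) \<and> (\<forall>j\<in>J. (\<Sum>i\<in>I. c i * a i j) = 0)"
  using assms
proof (induction J arbitrary: I a rule: finite_induct)
  case empty
  then have "I \<noteq> {}" by auto
  then show ?case by (intro exI[of _ "\<lambda>_. 1"]) auto
next
  case (insert j J)
  show ?case
  proof (cases "\<forall>i\<in>I. a i j = 0")
    case True
    have "card J < card I" using insert by simp
    from insert.IH[OF insert.prems(1) this, of a] True show ?thesis by auto
  next
    case False
    then obtain m where m: "m \<in> I" "a m j \<noteq> 0" by blast
    \<comment> \<open>Gaussian elimination: equation j is solved for the unknown m and substituted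
      into the others.\<close>
    define b where "b i j' = a i j' - a i j / a m j * a m j'" for i j'
    have "finite (I - {m})" "card J < card (I - {m})" using insert m by auto
    from insert.IH[OF this, of b] obtain c
      where c: "\<exists>i\<in>I - {m}. c i \<noteq> 0" "\<forall>j\<in>J. (\<Sum>i\<in>I - {m}. c i * b i j) = 0" by blast
    define d where "d i = (if i = m then - (\<Sum>i\<in>I - {m}. c i * (a i j / a m j)) else c i)" for i
    have sum_d: "(\<Sum>i\<in>I. d i * a i j') = (\<Sum>i\<in>I - {m}. c i * b i j')" for j'
    proof -
      have "(\<Sum>i\<in>I. d i * a i j') = d m * a m j' + (\<Sum>i\<in>I - {m}. d i * a i j')"
        using m insert.prems by (simp add: sum.remove)
      also have "(\<Sum>i\<in>I - {m}. d i * a i j') = (\<Sum>i\<in>I - {m}. c i * a i j')"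
        by (intro sum.cong) (auto simp: d_def)
      also have "d m * a m j' = - (\<Sum>i\<in>I - {m}. c i * (a i j / a m j) * a m j')"
        by (simp add: d_def sum_distrib_right)
      finally show ?thesis
        by (simp add: b_def sum_subtractf algebra_simps)
    qed
    have "b i j = 0" for i using m by (simp add: b_def)
    then have "\<forall>j'\<in>insert j J. (\<Sum>i\<in>I. d i * a i j') = 0" using sum_d c(2) by simp
    moreover have "\<exists>i\<in>I. d i \<noteq> 0" using c(1) by (auto simp: d_def)
    ultimately show ?thesis by blast
  qed
qed

context field_extension
begin

text \<open>The term of lowest order among those with nonzero coefficient cannot be cancelled by the
  others.\<close>

lemma place_independent:
  assumes v: "v \<in> places e" and I: "finite I" and g: "\<And>i. i \<in> I \<Longrightarrow> g i \<noteq> 0"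
    and inj: "inj_on (\<lambda>i. v (g i)) I" and c: "\<exists>i\<in>I. c i \<noteq> 0"
  shows "(\<Sum>i\<in>I. e (c i) * g i) \<noteq> 0"
proof -
  define K where "K = {i\<in>I. c i \<noteq> 0}"
  have K: "finite K" "K \<noteq> {}" using I c by (auto simp: K_def)
  then obtain m where m: "m \<in> K" "\<And>i. i \<in> K \<Longrightarrow> v (g m) \<le> v (g i)"
    using ex_min_if_finite[of "(\<lambda>i. v (g i)) ` K"] by (metis (no_types, lifting) arg_min_if_finite(1) arg_min_least)
  have mI: "m \<in> I" "c m \<noteq> 0" using m by (auto simp: K_def)
  have vm: "v (e (c m) * g m) = v (g m)" using mI g by (simp add: place_mult[OF v] place_e[OF v])
  have "ordge v (v (g m) + 1) (\<Sum>i\<in>I - {m}. e (c i) * g i)"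
  proof (rule ordge_sum[OF v])
    fix i assume i: "i \<in> I - {m}"
    show "ordge v (v (g m) + 1) (e (c i) * g i)"
    proof (cases "c i = 0")
      case False
      then have "v (g m) \<le> v (g i)" using m i by (auto simp: K_def)
      moreover have "v (g m) \<noteq> v (g i)" using inj i mI unfolding inj_on_def by blast
      ultimately show ?thesis by (intro ordge_scale[OF v]) (simp add: ordge_def)
    qed simp
  qed
  with place_add_eq(1)[OF v, of "e (c m) * g m"] vm mI g
  have "e (c m) * g m + (\<Sum>i\<in>I - {m}. e (c i) * g i) \<noteq> 0" by simp
  then show ?thesis using mI(1) I by (simp add: sum.remove)
qed

end

context genus_two_curve
begin

lemma powers_independent:
  assumes "x \<notin> range e" "D \<in> divisors e" "\<And>i. i \<le> n \<Longrightarrow> x ^ i \<in> L D"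
  shows "n + 1 \<le> l D"
proof (rule ccontr)
  assume "\<not> ?thesis"
  then obtain c where c: "\<exists>i\<le>n. c i \<noteq> 0" "(\<Sum>i\<le>n. e (c i) * x ^ i) = 0"
    using L_dependent[OF assms(2), of "{..n}" "\<lambda>i. x ^ i"] assms(3) by auto
  then show False using relation_imp_const assms(1) by blast
qed

lemma nonconstant_in_L:
  assumes "D \<in> divisors e" "2 \<le> l D"
  obtains x where "x \<in> L D" "x \<notin> range e"
proof -
  have "\<not> L D \<subseteq> L (\<lambda>v. 0)"
    using dim_mono[OF _ fin_span_L_0 subspace_L, of "L D"] assms(2) l_0 unfolding l_def by linarith
  then show ?thesis using that unfolding L_0 by blast
qed

text \<open>A nonconstant function with one simple pole would put 1, x, ..., x^N into L(NP), whose
  dimension is N - 1 for large N. Such a function exists only in genus 0.\<close>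

lemma l_pt: "P \<in> places e \<Longrightarrow> l (pt P) \<le> 1"
proof (rule ccontr)
  assume P: "P \<in> places e" and "\<not> l (pt P) \<le> 1"
  then obtain x where x: "x \<in> L (pt P)" "x \<notin> range e" using nonconstant_in_L[OF div_pt[OF P]] by auto
  have "0 < divisor_degree (pt P)" by simp
  then obtain N where N: "\<And>n. N \<le> n \<Longrightarrow> int (l (\<lambda>v. int n * pt P v)) = int n * divisor_degree (pt P) - 1"
    using large_multiple_nonspecial[OF div_pt[OF P]] by blast
  have "x ^ i \<in> L (\<lambda>v. int N * pt P v)" if "i \<le> N" for i
  proof -
    have "L (\<lambda>v. int i * pt P v) \<subseteq> L (\<lambda>v. int N * pt P v)" using that by (intro L_mono) auto
    then show ?thesis using L_power[OF x(1), of i] by blast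
  qed
  then have "N + 1 \<le> l (\<lambda>v. int N * pt P v)"
    by (intro powers_independent[OF x(2) div_mult[OF div_pt[OF P]]])
  then show False using N[of N] by simp
qed

lemma effective_degree_0:
  assumes "D \<in> divisors e" "\<And>v. 0 \<le> D v" "divisor_degree D = 0"
  shows "D = (\<lambda>v. 0)"
proof -
  have "\<forall>v\<in>{v. D v \<noteq> 0}. D v = 0"
    using assms(3) finite_support[OF assms(1)] assms(2) unfolding divisor_degree_def
    by (subst (asm) sum_nonneg_eq_0_iff) auto
  then show ?thesis by auto
qed

lemma effective_remove_point:
  assumes D: "D \<in> divisors e" "\<And>v. 0 \<le> D v" "0 < divisor_degree D"
  obtains P where "P \<in> places e" "(\<lambda>v. D v - pt P v) \<in> divisors e" "\<And>v. 0 \<le> D v - pt P v"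
    "divisor_degree (\<lambda>v. D v - pt P v) = divisor_degree D - 1"
proof -
  have "D \<noteq> (\<lambda>v. 0)" using D(3) by auto
  then obtain P where "D P \<noteq> 0" by blast
  then have P: "0 < D P" "P \<in> places e" using D(2)[of P] div_outside[OF D(1)] by auto
  have "divisor_degree (\<lambda>v. D v - pt P v) = divisor_degree D - divisor_degree (pt P)"
    by (rule degree_diff[OF D(1) div_pt[OF P(2)]])
  with that[OF P(2) div_diff[OF D(1) div_pt[OF P(2)]]] P(1) D(2) show ?thesis by force
qed

lemma effective_degree_1:
  assumes "D \<in> divisors e" "\<And>v. 0 \<le> D v" "divisor_degree D = 1"
  obtains P where "P \<in> places e" "D = pt P"
proof -
  obtain P where P: "P \<in> places e" "(\<lambda>v. D v - pt P v) \<in> divisors e" "\<And>v. 0 \<le> D v - pt P v"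
    "divisor_degree (\<lambda>v. D v - pt P v) = divisor_degree D - 1"
    by (rule effective_remove_point[OF assms(1,2)]) (use assms(3) in auto)
  then have "(\<lambda>v. D v - pt P v) = (\<lambda>v. 0)" using assms(3) by (intro effective_degree_0) auto
  then have "D = pt P" by (auto simp: fun_eq_iff)
  then show ?thesis using that P by blast
qed

lemma l_effective_degree_2:
  assumes "D \<in> divisors e" "\<And>v. 0 \<le> D v" "divisor_degree D = 2"
  shows "l D \<le> 2"
proof -
  obtain P where P: "P \<in> places e" "(\<lambda>v. D v - pt P v) \<in> divisors e" "\<And>v. 0 \<le> D v - pt P v"
    "divisor_degree (\<lambda>v. D v - pt P v) = divisor_degree D - 1"
    by (rule effective_remove_point[OF assms(1,2)]) (use assms(3) in auto)
  then obtain Q where Q: "Q \<in> places e" "(\<lambda>v. D v - pt P v) = pt Q"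
    using effective_degree_1[of "\<lambda>v. D v - pt P v"] assms(3) by auto
  have "D = (\<lambda>v. pt Q v + pt P v)" using Q(2) by (auto simp: fun_eq_iff algebra_simps)
  then show ?thesis using L_add_point(2)[OF P(1) fin_span_L[OF div_pt[OF Q(1)]]] l_pt[OF Q(1)] by simp
qed

lemma equivalent_effective:
  assumes D: "D \<in> divisors e" and "0 < l D"
  obtains E where "E \<in> divisors e" "\<And>v. 0 \<le> E v" "divisor_degree E = divisor_degree D" "l E = l D"
proof -
  obtain h where h: "h \<in> L D" "h \<noteq> 0"
    using assms(2) vs.dim_le_card[of "L D" "{}"] unfolding l_def by fastforce
  show ?thesis
  proof
    show "(\<lambda>v. D v + principal h v) \<in> divisors e" using D by auto
    show "0 \<le> D v + principal h v" for v
      using h div_outside[OF D, of v] by (auto simp: principal_def mem_L ordge_def)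
    show "divisor_degree (\<lambda>v. D v + principal h v) = divisor_degree D"
      using D h by (simp add: degree_principal)
    show "l (\<lambda>v. D v + principal h v) = l D" using l_shift[OF D h(2)] .
  qed
qed

lemma l_ge_2_degree:
  assumes "D \<in> divisors e" "2 \<le> l D"
  shows "2 \<le> divisor_degree D"
proof (rule ccontr)
  assume neg: "\<not> ?thesis"
  obtain E where E: "E \<in> divisors e" "\<And>v. 0 \<le> E v" "divisor_degree E = divisor_degree D" "l E = l D"
    by (rule equivalent_effective[OF assms(1)]) (use assms(2) in auto)
  have "0 \<le> divisor_degree E" using degree_mono[OF div_0 E(1,2)] by simp
  then consider "divisor_degree E = 0" | "divisor_degree E = 1" using neg E(3) by linarith
  then show False
  proof cases
    case 1
    then show False using effective_degree_0[OF E(1,2)] E(4) assms(2) l_0 by simp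
  next
    case 2
    then obtain P where "P \<in> places e" "E = pt P" using effective_degree_1[OF E(1,2)] by blast
    then show False using l_pt[of P] E(4) assms(2) by simp
  qed
qed

lemma degree_poles_ge:
  assumes "x \<notin> range e"
  shows "2 \<le> divisor_degree (poles x)"
proof -
  have "1 + 1 \<le> l (poles x)"
  proof (rule powers_independent[OF assms poles_div])
    fix i :: nat assume "i \<le> 1"
    then show "x ^ i \<in> L (poles x)"
      using mem_L_poles[of x] e_in_L[of "poles x" 1] by (cases i) auto
  qed
  then show ?thesis by (intro l_ge_2_degree) auto
qed

text \<open>Such an x is a double cover of the projective line; its degree is counted on the fibre
  over infinity.\<close>

definition degree_two :: "'f \<Rightarrow> bool" where
  "degree_two x \<longleftrightarrow> x \<notin> range e \<and> divisor_degree (poles x) = 2"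

text \<open>The poles of a nonconstant x in L(E) are bounded by an effective E of degree 2, and
  degree less than 2 is excluded by \<open>degree_poles_ge\<close>.\<close>

lemma degree_two_from_divisor:
  assumes D: "D \<in> divisors e" "divisor_degree D = 2" "2 \<le> l D"
  shows "\<exists>x. degree_two x"
proof -
  obtain E where E: "E \<in> divisors e" "\<And>v. 0 \<le> E v" "divisor_degree E = divisor_degree D" "l E = l D"
    by (rule equivalent_effective[OF D(1)]) (use D(3) in auto)
  obtain x where x: "x \<in> L E" "x \<notin> range e" using nonconstant_in_L[OF E(1)] E(4) D(3) by auto
  have "poles x v \<le> E v" for v
    using x E(2)[of v] by (cases "v \<in> places e") (auto simp: poles_def mem_L ordge_def)
  then have "divisor_degree (poles x) \<le> 2" using degree_mono[OF poles_div E(1)] E(3) D(2) by metis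
  then show ?thesis using degree_poles_ge[OF x(2)] x(2) by (auto simp: degree_two_def)
qed

text \<open>Weil's argument at a single place \<open>P\<close>: if \<open>l(2P) = 1\<close>, the coefficients \<open>w1\<close>, \<open>w2\<close> of
  \<open>t\<^sup>-\<^sup>1\<close>, \<open>t\<^sup>-\<^sup>2\<close> modulo functions regular at \<open>P\<close> or regular away from \<open>P\<close> play the role of two
  independent differentials. Since \<open>l(5P) = 4\<close>, the space of pairs \<open>(a, b)\<close> in \<open>L(5P)\<close> with
  \<open>w1(a f) + w2(b f) = 0\<close> for all \<open>f\<close> has dimension at least \<open>8 - 6\<close>; the quotient \<open>x = a / b\<close> is
  the same for all such pairs, so \<open>l(5P - (x)\<^sub>\<infinity>) \<ge> 2\<close>.\<close>

lemma degree_two_exists: "\<exists>x. degree_two x"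
proof -
  obtain P where P: "P \<in> places e" using places_nonempty by blast
  have nP: "(\<lambda>v. n * pt P v) \<in> divisors e" "divisor_degree (\<lambda>v. n * pt P v) = n" for n
    using div_mult[OF div_pt[OF P], of n] degree_mult[of n "pt P"] by simp_all
  show ?thesis
  proof (cases "2 \<le> l (\<lambda>v. 2 * pt P v)")
    case True
    then show ?thesis using degree_two_from_divisor[OF nP] by simp
  next
    case False
    have L2: "L (\<lambda>v. 2 * pt P v) = range e"
    proof -
      have "L (\<lambda>v. 0) = L (\<lambda>v. 2 * pt P v)"
        using False l_0 by (intro dim_eq_subset subspace_L fin_span_L nP L_mono) (auto simp: l_def)
      then show ?thesis using L_0 by simp
    qed
    \<comment> \<open>Comparing l((n-1)P) \<le> n - 2, which comes from l(2P) = 1, with l(nP) \<ge>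
      n - 1 shows that 1 and 2 are the only gaps at P.\<close>
    have ex_f: "\<exists>f. f \<in> L (\<lambda>v. int n * pt P v) \<and> f \<noteq> 0 \<and> P f = - int n" if n: "3 \<le> n" for n
    proof -
      have "int (l (\<lambda>v. (int n - 1) * pt P v)) - (int n - 1) \<le> int (l (\<lambda>v. 2 * pt P v)) - 2"
        using l_chain[OF nP(1)[of 2] nP(1)[of "int n - 1"]] n unfolding nP(2) by auto
      then have "int (l (\<lambda>v. (int n - 1) * pt P v)) < int n - 1" using False by linarith
      also have "\<dots> \<le> int (l (\<lambda>v. int n * pt P v))" using riemann_inequality[OF nP(1)[of "int n"]] nP(2) by simp
      finally have "\<not> l (\<lambda>v. int n * pt P v) \<le> l (\<lambda>v. (int n - 1) * pt P v)" by linarith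
      then have "\<not> L (\<lambda>v. int n * pt P v) \<subseteq> L (\<lambda>v. (int n - 1) * pt P v)"
        using dim_mono[OF _ fin_span_L[OF nP(1)] subspace_L] unfolding l_def by blast
      then obtain f where f: "f \<in> L (\<lambda>v. int n * pt P v)" "f \<notin> L (\<lambda>v. (int n - 1) * pt P v)" by blast
      then obtain v where v: "v \<in> places e" "\<not> ordge v (- ((int n - 1) * pt P v)) f" by (auto simp: mem_L)
      have "ordge v (- (int n * pt P v)) f" using f(1) v(1) unfolding mem_L by blast
      then show ?thesis using v f by (cases "v = P") (auto simp: ordge_def)
    qed
    obtain f where f: "\<And>n. 3 \<le> n \<Longrightarrow> f n \<in> L (\<lambda>v. int n * pt P v)" "\<And>n. 3 \<le> n \<Longrightarrow> f n \<noteq> 0"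
      "\<And>n. 3 \<le> n \<Longrightarrow> P (f n) = - int n"
      using ex_f by metis
    define R where "R = {h. \<forall>v\<in>places e. v \<noteq> P \<longrightarrow> ordge v 0 h}"
    have R_add: "a + b \<in> R" if "a \<in> R" "b \<in> R" for a b using that by (auto simp: R_def intro: ordge_add)
    have R_mult: "a * b \<in> R" if "a \<in> R" "b \<in> R" for a b
      using that ordge_mult[of _ 0 a 0 b] by (auto simp: R_def)
    have R_e: "e c \<in> R" for c by (auto simp: R_def intro: ordge_e)
    have R_0: "0 \<in> R" by (simp add: R_def)
    have R_sum: "sum g A \<in> R" if "\<And>i. i \<in> A \<Longrightarrow> g i \<in> R" for g and A :: "nat set"
      using that by (induction A rule: infinite_finite_induct) (auto intro: R_add R_0)
    have f_R: "f n \<in> R" if "3 \<le> n" for n using f(1)[OF that] by (auto simp: R_def mem_L)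
    obtain t where t: "P t = 1" using P by (auto simp: places_def)
    then have t0: "t \<noteq> 0" using place_0[OF P] by auto
    define u where "u j = (if 0 \<le> j then t ^ nat j else inverse t ^ nat (- j))" for j :: int
    have u0: "u j \<noteq> 0" for j using t0 by (simp add: u_def)
    have Pu: "P (u j) = j" for j using t t0 by (simp add: u_def place_power[OF P] place_inverse[OF P])
    define J where "J = {-2, -1, 1, 2, 3, 4 :: int}"
    have finJ: "finite J" by (simp add: J_def)
    have approx: "\<exists>r\<in>R. \<exists>c. ordge P 5 (h - r - (\<Sum>j\<in>J. e (c j) * u j))" if "ordge P k h" for k h
      using that
    proof (induction "nat (5 - k)" arbitrary: k h rule: less_induct)
      case less
      show ?case
      proof (cases "5 \<le> k")
        case True
        then have "ordge P 5 (h - 0 - (\<Sum>j\<in>J. e ((\<lambda>j. 0) j) * u j))"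
          using less.prems by (auto elim: ordge_mono)
        then show ?thesis by (intro bexI[OF _ R_0] exI)
      next
        case k: False
        have step: "\<exists>c. ordge P (k + 1) (h - e c * g)" if g: "g \<noteq> 0" "P g = k" for g
        proof -
          have "ordge P 0 (h / g)"
            using less.prems g by (cases "h = 0") (auto simp: ordge_def place_divide[OF P])
          then obtain c where "ordge P 1 (h / g - e c)" using residue_exists[OF P] by blast
          then have "ordge P (1 + k) ((h / g - e c) * g)"
            using g by (intro ordge_mult[OF P]) (auto simp: ordge_def)
          then show ?thesis using g by (intro exI[of _ c]) (simp add: algebra_simps)
        qed
        show ?thesis
        proof (cases "k \<in> J")
          case True
          obtain c where "ordge P (k + 1) (h - e c * u k)" using step[OF u0 Pu] by blast
          then obtain r d where rd: "r \<in> R" "ordge P 5 (h - e c * u k - r - (\<Sum>j\<in>J. e (d j) * u j))"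
            using less.hyps[of "k + 1"] k by force
          have "(\<Sum>j\<in>J. e ((d(k := d k + c)) j) * u j) = (\<Sum>j\<in>J. e (d j) * u j) + e c * u k"
            using True finJ by (simp add: sum.remove[of J k] e_add algebra_simps)
          then have "ordge P 5 (h - r - (\<Sum>j\<in>J. e ((d(k := d k + c)) j) * u j))"
            using rd(2) by (simp add: algebra_simps)
          then show ?thesis using rd(1) by blast
        next
          case False
          have "\<exists>g\<in>R. g \<noteq> 0 \<and> P g = k"
          proof (cases "k = 0")
            case True
            then show ?thesis using R_e[of 1] place_1[OF P] by (intro bexI[of _ 1]) auto
          next
            case False
            then have "3 \<le> nat (- k)" "k = - int (nat (- k))" using \<open>k \<notin> J\<close> k by (auto simp: J_def)
            then show ?thesis using f[of "nat (- k)"] f_R[of "nat (- k)"] by metis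
          qed
          then obtain g where g: "g \<in> R" "g \<noteq> 0" "P g = k" by blast
          obtain c where "ordge P (k + 1) (h - e c * g)" using step[OF g(2,3)] by blast
          then obtain r d where rd: "r \<in> R" "ordge P 5 (h - e c * g - r - (\<Sum>j\<in>J. e (d j) * u j))"
            using less.hyps[of "k + 1"] k by force
          have "r + e c * g \<in> R" using rd g R_e R_add R_mult by blast
          moreover have "ordge P 5 (h - (r + e c * g) - (\<Sum>j\<in>J. e (d j) * u j))"
            using rd(2) by (simp add: algebra_simps)
          ultimately show ?thesis by blast
        qed
      qed
    qed
    define W where "W h a b \<longleftrightarrow> (\<exists>r\<in>R. ordge P 0 (h - r - e a * u (- 1) - e b * u (- 2)))" for h a b
    have W_ex: "\<exists>a b. W h a b" for h
    proof -
      have "ordge P (P h) h" by (simp add: ordge_def)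
      then obtain r c where rc: "r \<in> R" "ordge P 5 (h - r - (\<Sum>j\<in>J. e (c j) * u j))" using approx by blast
      define s where "s = (\<Sum>j\<in>{1,2,3,4}. e (c j) * u j)"
      have "(\<Sum>j\<in>J. e (c j) * u j) = e (c (- 1)) * u (- 1) + e (c (- 2)) * u (- 2) + s"
        by (simp add: J_def s_def)
      moreover have "ordge P 0 s"
        unfolding s_def using Pu by (intro ordge_sum[OF P] ordge_scale[OF P]) (auto simp: ordge_def)
      then have "ordge P 0 (h - r - (\<Sum>j\<in>J. e (c j) * u j) + s)"
        using rc(2) by (intro ordge_add[OF P]) (auto elim: ordge_mono)
      ultimately have "ordge P 0 (h - r - e (c (- 1)) * u (- 1) - e (c (- 2)) * u (- 2))"
        by (simp add: algebra_simps)
      then show ?thesis using rc(1) unfolding W_def by blast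
    qed
    have W_add: "W (h + h') (a + a') (b + b')" if W: "W h a b" "W h' a' b'" for h h' a a' b b'
    proof -
      obtain r r' where r: "r \<in> R" "ordge P 0 (h - r - e a * u (- 1) - e b * u (- 2))"
        "r' \<in> R" "ordge P 0 (h' - r' - e a' * u (- 1) - e b' * u (- 2))"
        using W unfolding W_def by blast
      have "ordge P 0 ((h + h') - (r + r') - e (a + a') * u (- 1) - e (b + b') * u (- 2))"
        using ordge_add[OF P r(2,4)] by (simp add: e_add algebra_simps)
      then show ?thesis using R_add[OF r(1,3)] unfolding W_def by blast
    qed
    have W_scale: "W (e k * h) (k * a) (k * b)" if W: "W h a b" for h k a b
    proof -
      obtain r where r: "r \<in> R" "ordge P 0 (h - r - e a * u (- 1) - e b * u (- 2))"
        using W unfolding W_def by blast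
      have "ordge P 0 (e k * h - e k * r - e (k * a) * u (- 1) - e (k * b) * u (- 2))"
        using ordge_scale[OF P r(2), of k] by (simp only: e_mult right_diff_distrib mult.assoc)
      then show ?thesis using R_mult[OF R_e r(1)] unfolding W_def by blast
    qed
    \<comment> \<open>Well-definedness of the two coefficients: an element of \<open>R\<close> that
      cancels terms in t^-1 and t^-2 would lie in L(2P) = k, hence be regular at P and cancel
      nothing.\<close>
    have W_zero: "a = 0 \<and> b = 0" if W: "W 0 a b" for a b
    proof -
      obtain r where r: "r \<in> R" "ordge P 0 (0 - r - e a * u (- 1) - e b * u (- 2))"
        using W unfolding W_def by blast
      have s: "ordge P (- 2) (e a * u (- 1))" "ordge P (- 2) (e b * u (- 2))"
        using Pu by (intro ordge_scale[OF P], simp add: ordge_def)+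
      define q where "q = 0 - r - e a * u (- 1) - e b * u (- 2)"
      have "ordge P (- 2) (q + e a * u (- 1) + e b * u (- 2))"
        using ordge_mono[OF r(2), of "- 2"] s unfolding q_def by (intro ordge_add[OF P]) auto
      then have "ordge P (- 2) (- r)" by (simp add: q_def)
      then have "ordge P (- 2) r" using ordge_minus[OF P] by blast
      then have "r \<in> L (\<lambda>v. 2 * pt P v)" using r(1) by (auto simp: mem_L R_def)
      then have "ordge P 0 r" using L2 ordge_e[OF P] by auto
      then have s0: "ordge P 0 (e a * u (- 1) + e b * u (- 2))"
        using ordge_add[OF P r(2), of r] ordge_minus[OF P, of 0 "e a * u (- 1) + e b * u (- 2)"]
        by (simp add: algebra_simps)
      have b0: "b = 0"
      proof (rule ccontr)
        assume "b \<noteq> 0"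
        then have nz: "e b * u (- 2) \<noteq> 0" "P (e b * u (- 2)) = - 2"
          using u0 Pu by (auto simp: place_mult[OF P] place_e[OF P])
        moreover have "ordge P (P (e b * u (- 2)) + 1) (e a * u (- 1))"
          unfolding nz(2) by (intro ordge_scale[OF P]) (simp add: ordge_def Pu)
        ultimately have "e b * u (- 2) + e a * u (- 1) \<noteq> 0" "P (e b * u (- 2) + e a * u (- 1)) = - 2"
          using place_add_eq[OF P, of "e b * u (- 2)" "e a * u (- 1)"] by simp_all
        then show False using s0 unfolding add.commute[of "e a * u (- 1)"] ordge_def by simp
      qed
      moreover have "a = 0"
      proof (rule ccontr)
        assume "a \<noteq> 0"
        then have "e a * u (- 1) \<noteq> 0" "P (e a * u (- 1)) = - 1"
          using u0 Pu by (auto simp: place_mult[OF P] place_e[OF P])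
        then show False using s0 b0 by (simp add: ordge_def)
      qed
      ultimately show ?thesis by simp
    qed
    have W_unique: "a = a' \<and> b = b'" if "W h a b" "W h a' b'" for h a b a' b'
    proof -
      have "W (h + e (- 1) * h) (a + (- 1) * a') (b + (- 1) * b')" using that by (intro W_add W_scale)
      then have "W 0 (a - a') (b - b')" by (simp add: e_minus)
      then show ?thesis using W_zero by fastforce
    qed
    obtain w1 w2 where w: "\<And>h. W h (w1 h) (w2 h)" using W_ex by metis
    have w_eq: "w1 h = a" "w2 h = b" if "W h a b" for h a b using W_unique[OF w that] by auto
    have w_add: "w1 (h + h') = w1 h + w1 h'" "w2 (h + h') = w2 h + w2 h'" for h h'
      using w_eq[OF W_add[OF w w]] by auto
    have w_scale: "w1 (e k * h) = k * w1 h" "w2 (e k * h) = k * w2 h" for h k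
      using w_eq[OF W_scale[OF w]] by auto
    have w_0: "w1 0 = 0" "w2 0 = 0" using w_scale[of 0 0] by auto
    have w_sum_int: "w1 (sum g A) = (\<Sum>i\<in>A. w1 (g i))" "w2 (sum g A) = (\<Sum>i\<in>A. w2 (g i))" 
      for g and A :: "int set"
      by (induction A rule: infinite_finite_induct) (auto simp: w_add w_0)
    have w_sum_nat: "w1 (sum g A) = (\<Sum>i\<in>A. w1 (g i))" "w2 (sum g A) = (\<Sum>i\<in>A. w2 (g i))" 
      for g and A :: "nat set"
      by (induction A rule: infinite_finite_induct) (auto simp: w_add w_0)
    have w_R: "w1 r = 0" "w2 r = 0" if "r \<in> R" for r
    proof -
      have "W r 0 0" using that unfolding W_def by (intro bexI[of _ r]) auto
      then show "w1 r = 0" "w2 r = 0" using w_eq by auto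
    qed
    have w_reg: "w1 h = 0" "w2 h = 0" if "ordge P 0 h" for h
    proof -
      have "W h 0 0" using that R_0 unfolding W_def by (intro bexI[of _ 0]) auto
      then show "w1 h = 0" "w2 h = 0" using w_eq by auto
    qed
    have w_u1: "w1 (u (- 1)) = 1"
    proof -
      have "W (u (- 1)) 1 0" using R_0 unfolding W_def by (intro bexI[of _ 0]) auto
      then show ?thesis using w_eq by blast
    qed
    have w_u2: "w1 (u (- 2)) = 0" "w2 (u (- 2)) = 1"
    proof -
      have "W (u (- 2)) 0 1" using R_0 unfolding W_def by (intro bexI[of _ 0]) auto
      then show "w1 (u (- 2)) = 0" "w2 (u (- 2)) = 1" using w_eq by blast+
    qed
    have w1_nondeg: "a = 0" if "\<And>h. w1 (a * h) = 0" for a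
    proof (rule ccontr)
      assume "a \<noteq> 0"
      then have "a * (u (- 1) / a) = u (- 1)" by simp
      then show False using that[of "u (- 1) / a"] w_u1 by simp
    qed
    \<comment> \<open>The functions 1, \<open>f 3\<close>, \<open>f 4\<close>, \<open>f 5\<close> of
      L(5P), independent by their orders at P.\<close>
    define G where "G i = (if i = 0 then 1 else f (i + 2))" for i :: nat
    define I where "I = {..<4::nat}"
    have G0: "G i \<noteq> 0" for i using f(2)[of "i + 2"] by (auto simp: G_def)
    have PG: "P (G i) = (if i = 0 then 0 else - int (i + 2))" for i
      using f(3)[of "i + 2"] by (auto simp: G_def place_1[OF P])
    have G_R: "G i \<in> R" for i using R_e[of 1] f_R[of "i + 2"] by (auto simp: G_def)
    have G_L: "G i \<in> L (\<lambda>v. 5 * pt P v)" if "i \<in> I" for i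
    proof -
      have "ordge P (- 5) (G i)" using PG[of i] that by (auto simp: ordge_def I_def)
      then show ?thesis using G_R[of i] by (auto simp: mem_L R_def)
    qed
    have inj: "inj_on (\<lambda>i. P (G i)) I" by (auto simp: inj_on_def PG)
    have G_ind: "\<forall>i\<in>I. c i = 0" if "(\<Sum>i\<in>I. e (c i) * G i) = 0" for c
      using place_independent[OF P _ G0 inj, of c] that by (auto simp: I_def)
    define Y where "Y c = (\<Sum>i\<in>I. e (c i) * G i)" for c
    have Y_L: "Y c \<in> L (\<lambda>v. 5 * pt P v)" for c
      unfolding Y_def using G_L by (intro vs.subspace_sum[OF subspace_L] vs.subspace_scale[OF subspace_L])
    have Y_R: "Y c \<in> R" for c unfolding Y_def using G_R R_e R_mult by (intro R_sum) blast
    have Y_w1: "w1 (Y c * h) = (\<Sum>i\<in>I. c i * w1 (G i * h))" for c h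
      unfolding Y_def by (simp add: sum_distrib_right w_sum_nat mult.assoc w_scale)
    have Y_w2: "w2 (Y c * h) = (\<Sum>i\<in>I. c i * w2 (G i * h))" for c h
      unfolding Y_def by (simp add: sum_distrib_right w_sum_nat mult.assoc w_scale)
    have Y_zero: "\<forall>i\<in>I. c i = 0" if "Y c = 0" for c using G_ind that by (simp add: Y_def)
    \<comment> \<open>The linear system for (a, b) in terms of eight coefficients. Row j in
      \<open>J\<close> tests the form on \<open>u j\<close>; the index 0, absent from
      \<open>J\<close>, is reused for a row that reads off the coefficient at (k, False).\<close>
    define M where "M k p j = (if j = 0 then if p = (k, False) then 1 else 0
      else if snd p then w1 (G (fst p) * u j) else w2 (G (fst p) * u j))" for k :: nat and p j
    have sum_M: "(\<Sum>p\<in>I \<times> UNIV. c p * M k p j) = w1 (Y (\<lambda>i. c (i, True)) * u j) + w2 (Y (\<lambda>i. c (i, False)) * u j)"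
      if "j \<noteq> 0" for c k j
    proof -
      have "(\<Sum>p\<in>I \<times> UNIV. c p * M k p j) = (\<Sum>i\<in>I. \<Sum>s\<in>UNIV. c (i, s) * M k (i, s) j)"
        by (simp add: sum.cartesian_product case_prod_beta)
      also have "\<dots> = (\<Sum>i\<in>I. c (i, True) * w1 (G i * u j) + c (i, False) * w2 (G i * u j))"
        using that by (intro sum.cong) (auto simp: M_def UNIV_bool)
      finally show ?thesis by (simp add: sum.distrib Y_w1 Y_w2)
    qed
    \<comment> \<open>The form \<open>\<psi>\<close> vanishes automatically on \<open>R\<close> and
      on functions of order \<ge> 5, so six test functions decide whether it vanishes
      everywhere.\<close>
    have solution: "Y (\<lambda>i. c (i, False)) \<noteq> 0 \<and> (\<forall>h. w1 (Y (\<lambda>i. c (i, True)) * h) + w2 (Y (\<lambda>i. c (i, False)) * h) = 0)"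
      if c: "\<exists>p\<in>I \<times> UNIV. c p \<noteq> 0" "\<forall>j\<in>J. (\<Sum>p\<in>I \<times> UNIV. c p * M k p j) = 0" for c k
    proof -
      let ?a = "Y (\<lambda>i. c (i, True))" and ?b = "Y (\<lambda>i. c (i, False))"
      define \<psi> where "\<psi> h = w1 (?a * h) + w2 (?b * h)" for h
      have \<psi>_add: "\<psi> (h + h') = \<psi> h + \<psi> h'" for h h' by (simp add: \<psi>_def w_add distrib_left)
      have \<psi>_u: "\<psi> (e q * u j) = 0" if "j \<in> J" for q j
      proof -
        have "j \<noteq> 0" using that by (auto simp: J_def)
        then have "\<psi> (u j) = 0" using c(2) that sum_M[of j c k] unfolding \<psi>_def by simp
        moreover have "\<psi> (e q * u j) = q * \<psi> (u j)"
          unfolding \<psi>_def mult.left_commute[of _ "e q"] w_scale by (rule distrib_left[symmetric])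
        ultimately show ?thesis by simp
      qed
      have \<psi>_sum: "\<psi> (sum g A) = (\<Sum>i\<in>A. \<psi> (g i))" for g and A :: "int set"
        by (simp add: \<psi>_def sum_distrib_left w_sum_int sum.distrib)
      have \<psi>_R: "\<psi> r = 0" if "r \<in> R" for r using w_R R_mult[OF Y_R that] by (simp add: \<psi>_def)
      have \<psi>_5: "\<psi> h = 0" if "ordge P 5 h" for h
      proof -
        have "ordge P 0 (Y c * h)" for c
          using ordge_mult[OF P _ that, of "- 5" "Y c"] Y_L[of c] P unfolding mem_L by auto
        then show ?thesis by (simp add: \<psi>_def w_reg)
      qed
      have \<psi>_0: "\<psi> h = 0" for h
      proof -
        have "ordge P (P h) h" by (simp add: ordge_def)
        then obtain r d where rd: "r \<in> R" "ordge P 5 (h - r - (\<Sum>j\<in>J. e (d j) * u j))" using approx by blast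
        have "h = (h - r - (\<Sum>j\<in>J. e (d j) * u j)) + (r + (\<Sum>j\<in>J. e (d j) * u j))" by simp
        then have "\<psi> h = \<psi> (h - r - (\<Sum>j\<in>J. e (d j) * u j)) + (\<psi> r + \<psi> (\<Sum>j\<in>J. e (d j) * u j))"
          by (metis \<psi>_add)
        also have "\<dots> = 0" using \<psi>_5[OF rd(2)] \<psi>_R[OF rd(1)] \<psi>_u by (simp add: \<psi>_sum)
        finally show ?thesis .
      qed
      have "?b \<noteq> 0"
      proof
        assume b: "?b = 0"
        then have "?a = 0" using \<psi>_0 w1_nondeg by (simp add: \<psi>_def w_0)
        then have "\<forall>i\<in>I. c (i, s) = 0" for s
          using Y_zero[of "\<lambda>i. c (i, True)"] Y_zero[of "\<lambda>i. c (i, False)"] b by (cases s) auto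
        then show False using c(1) by auto
      qed
      then show ?thesis using \<psi>_0 by (simp add: \<psi>_def)
    qed
    have finI: "finite (I \<times> (UNIV :: bool set))" "card (I \<times> (UNIV :: bool set)) = 8"
      by (auto simp: I_def card_cartesian_product)
    obtain c where c: "\<exists>p\<in>I \<times> UNIV. c p \<noteq> 0" "\<forall>j\<in>J. (\<Sum>p\<in>I \<times> UNIV. c p * M 0 p j) = 0"
      using homogeneous_system[OF finJ finI(1), of "M 0"] finI(2) by (auto simp: J_def)
    define a where "a = Y (\<lambda>i. c (i, True))"
    define b where "b = Y (\<lambda>i. c (i, False))"
    have ab: "b \<noteq> 0" "\<And>h. w1 (a * h) + w2 (b * h) = 0" using solution[OF c] by (auto simp: a_def b_def)
    then obtain k where k: "k \<in> I" "c (k, False) \<noteq> 0"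
      unfolding b_def Y_def by (metis (no_types, lifting) e_0 mult_zero_left sum.neutral)
    \<comment> \<open>Seven equations in eight unknowns still leave a nonzero solution. Its part
      \<open>b'\<close> has coefficient 0 at k, where the first solution has a nonzero one; this
      makes \<open>b\<close> and \<open>b'\<close> independent.\<close>
    have "card (insert 0 J) < card (I \<times> (UNIV :: bool set))" unfolding finI(2) by (simp add: J_def)
    then obtain d where d: "\<exists>p\<in>I \<times> UNIV. d p \<noteq> 0" "\<forall>j\<in>insert 0 J. (\<Sum>p\<in>I \<times> UNIV. d p * M k p j) = 0"
      using homogeneous_system[of "insert 0 J" "I \<times> (UNIV :: bool set)" "M k"] finJ finI(1) by auto
    have dk: "d (k, False) = 0"
    proof -
      have "(\<Sum>p\<in>I \<times> UNIV. d p * M k p 0) = (\<Sum>p\<in>{(k, False)}. d p * M k p 0)"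
        using k(1) finI(1) by (intro sum.mono_neutral_right) (auto simp: M_def)
      then show ?thesis using d(2) by (simp add: M_def)
    qed
    define a' where "a' = Y (\<lambda>i. d (i, True))"
    define b' where "b' = Y (\<lambda>i. d (i, False))"
    have "\<forall>j\<in>J. (\<Sum>p\<in>I \<times> UNIV. d p * M k p j) = 0" using d(2) by blast
    then have ab': "b' \<noteq> 0" "\<And>h. w1 (a' * h) + w2 (b' * h) = 0"
      using solution[OF d(1)] by (auto simp: a'_def b'_def)
    define x where "x = a / b"
    \<comment> \<open>Substituting h / b shows that w2 is, up to sign, w1 composed with
      multiplication by x: as with differentials, the ratio of the two forms is a function.\<close>
    have wx: "w1 (x * h) = - w2 h" for h
      using ab(2)[of "h / b"] ab(1) by (simp add: x_def eq_neg_iff_add_eq_0)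
    have wx': "w1 (a' / b' * h) = - w2 h" for h
      using ab'(2)[of "h / b'"] ab'(1) by (simp add: eq_neg_iff_add_eq_0)
    have "w1 ((x - a' / b') * h) = 0" for h
    proof -
      have "w1 (x * h) = w1 ((x - a' / b') * h) + w1 (a' / b' * h)"
        unfolding w_add(1)[symmetric] by (simp add: algebra_simps)
      then show ?thesis using wx wx' by simp
    qed
    then have "x = a' / b'" using w1_nondeg[of "x - a' / b'"] by simp
    then have bx': "b' * x = a'" using ab'(1) by simp
    have bx: "b * x = a" using ab(1) by (simp add: x_def)
    have x_nc: "x \<notin> range e"
    proof
      assume "x \<in> range e"
      then obtain q where "x = e q" by blast
      then show False using wx[of "u (- 2)"] w_u2 by (simp add: w_scale)
    qed
    let ?E = "\<lambda>v. 5 * pt P v - poles x v"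
    have E: "?E \<in> divisors e" by (intro div_diff nP poles_div)
    have L_E: "h \<in> L ?E" if "h \<in> L (\<lambda>v. 5 * pt P v)" "h * x \<in> L (\<lambda>v. 5 * pt P v)" for h
    proof -
      have "x \<noteq> 0" using x_nc by (metis e_0 rangeI)
      show ?thesis
        unfolding mem_L
      proof
        fix v assume v: "v \<in> places e"
        then have "ordge v (- (5 * pt P v)) h" "ordge v (- (5 * pt P v)) (h * x)"
          using that unfolding mem_L by blast+
        then show "ordge v (- (5 * pt P v - poles x v)) h"
          using v \<open>x \<noteq> 0\<close> by (cases "h = 0") (auto simp: ordge_def poles_def place_mult)
      qed
    qed
    have "b \<in> L ?E" "b' \<in> L ?E"
      using L_E bx bx' Y_L unfolding a_def b_def a'_def b'_def by auto
    have l_E: "2 \<le> l ?E"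
    proof (rule ccontr)
      assume "\<not> ?thesis"
      moreover have "(if i then b else b') \<in> L ?E" for i
        using \<open>b \<in> L ?E\<close> \<open>b' \<in> L ?E\<close> by simp
      ultimately obtain q where q: "\<exists>i\<in>UNIV. q i \<noteq> 0" "(\<Sum>i\<in>UNIV. e (q i) * (if i then b else b')) = 0"
        using L_dependent[OF E, of "UNIV :: bool set" "\<lambda>i. if i then b else b'"] by auto
      have "Y (\<lambda>i. q True * c (i, False) + q False * d (i, False)) = e (q True) * b + e (q False) * b'"
        by (simp add: Y_def b_def b'_def e_add e_mult sum_distrib_left sum.distrib algebra_simps)
      also have "\<dots> = 0" using q(2) by (simp add: UNIV_bool add.commute)
      finally have "q True * c (k, False) + q False * d (k, False) = 0" using Y_zero k(1) by blast
      then have "q True = 0" using k(2) dk by simp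
      moreover then have "q False = 0" using q(2) ab'(1) by (simp add: UNIV_bool)
      ultimately show False using q(1) by (metis (full_types))
    qed
    have degE: "divisor_degree ?E = 5 - divisor_degree (poles x)"
      using degree_diff[OF nP(1) poles_div] nP(2) by simp
    show ?thesis
    \<comment> \<open>As l \<ge> 2 forces degree \<ge> 2, the pole divisor of x has degree 2 or 3;
      in the latter case 5P minus the poles is the required divisor of degree 2.\<close>
    proof (cases "divisor_degree (poles x) = 2")
      case True
      then show ?thesis using x_nc by (auto simp: degree_two_def)
    next
      case False
      then have "divisor_degree ?E = 2"
        using l_ge_2_degree[OF E l_E] degE degree_poles_ge[OF x_nc] by linarith
      then show ?thesis using degree_two_from_divisor[OF E _ l_E] by simp
    qed
  qed
qed

end

section \<open>The hyperelliptic equation\<close>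

context field_extension
begin

text \<open>Lowest terms only in the sense of having no common root in k, which is what evaluation
  at a place sees.\<close>

lemma ratl_reduced:
  assumes x: "transcendental_over e x" and w: "w \<in> ratl x"
  obtains p q where "q \<noteq> 0" "w = ev p x / ev q x" "\<forall>c. \<not> (poly p c = 0 \<and> poly q c = 0)"
proof -
  have "\<exists>p q. q \<noteq> 0 \<and> ev P x / ev Q x = ev p x / ev q x \<and> (\<forall>c. \<not> (poly p c = 0 \<and> poly q c = 0))"
    if "Q \<noteq> 0" for P Q
    using that
  proof (induction "Polynomial.degree Q" arbitrary: P Q rule: less_induct)
    case less
    show ?case
    proof (cases "\<exists>c. poly P c = 0 \<and> poly Q c = 0")
      case False
      then show ?thesis using less.prems by (intro exI[of _ P] exI[of _ Q]) auto
    next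
      case True
      then obtain c where "poly P c = 0" "poly Q c = 0" by blast
      then obtain P' Q' where PQ: "P = [:- c, 1:] * P'" "Q = [:- c, 1:] * Q'"
        by (auto simp: poly_eq_0_iff_dvd elim!: dvdE)
      have Q': "Q' \<noteq> 0" using less.prems PQ by auto
      have "ev [:- c, 1:] x \<noteq> 0" unfolding transcendentalD[OF x] by simp
      then have eq: "ev P x / ev Q x = ev P' x / ev Q' x"
        unfolding PQ ev_mult by simp
      have "Polynomial.degree Q' < Polynomial.degree Q"
        unfolding PQ using Q' by (subst degree_mult_eq) auto
      from less.hyps[OF this Q', of P'] show ?thesis unfolding eq .
    qed
  qed
  moreover obtain P Q where "w = ev P x / ev Q x" "Q \<noteq> 0" using w unfolding ratl_def by blast
  ultimately obtain p q where "q \<noteq> 0" "w = ev p x / ev q x" "\<forall>c. \<not> (poly p c = 0 \<and> poly q c = 0)"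
    by metis
  then show ?thesis by (rule that)
qed

end

section \<open>Function spaces on the double cover defined by x\<close>

locale curve_degree_two = genus_two_curve e for e :: "'k::alg_closed_field \<Rightarrow> 'f::field" +
  fixes x :: 'f
  assumes x: "degree_two x" and two: "(2 :: 'k) \<noteq> 0"
begin

lemma x_trans: "transcendental_over e x"
  using x transcendentalI by (auto simp: degree_two_def)

lemmas ev_eq_0 = transcendentalD[OF x_trans]

abbreviation nD :: "nat \<Rightarrow> ('f \<Rightarrow> int) \<Rightarrow> int" where
  "nD n \<equiv> \<lambda>v. int n * poles x v"

lemma nD_div: "nD n \<in> divisors e" and nD_degree: "divisor_degree (nD n) = 2 * int n"
  using div_mult[OF poles_div, of "int n" x] degree_mult[of "int n" "poles x"] x by (auto simp: degree_two_def)

lemma x_not_const: "x \<notin> range e"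
  using x by (simp add: degree_two_def)

lemma nD_mono: "m \<le> n \<Longrightarrow> L (nD m) \<subseteq> L (nD n)"
  by (rule L_mono) (simp add: mult_right_mono)

lemma nD_mult: "f \<in> L (nD m) \<Longrightarrow> g \<in> L (nD n) \<Longrightarrow> f * g \<in> L (nD (m + n))"
  using L_mult[of f "nD m" g "nD n"] by (simp add: distrib_right)

lemma ev_in_nD:
  assumes "Polynomial.degree p \<le> n"
  shows "ev p x \<in> L (nD n)"
  unfolding ev_altdef[OF assms]
proof (intro vs.subspace_sum[OF subspace_L] vs.subspace_scale[OF subspace_L])
  fix i assume "i \<in> {..n}"
  then show "x ^ i \<in> L (nD n)" using L_power[OF mem_L_poles[of x], of i] nD_mono[of i n] by auto
qed

lemma zero_exists: obtains v where "v \<in> places e" "ordge v 1 (x - e c)"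
proof -
  have "inverse (x - e c) \<notin> range e"
  proof
    assume "inverse (x - e c) \<in> range e"
    then obtain d where "inverse (x - e c) = e d" by blast
    then have "x - e c = e (inverse d)" by (metis e_inverse inverse_inverse_eq)
    then have "x = e (inverse d + c)" by (simp add: e_add diff_eq_eq)
    then show False using x_not_const by blast
  qed
  then obtain v where "v \<in> places e" "v (inverse (x - e c)) < 0" by (rule pole_exists)
  then show ?thesis using that by (auto simp: place_inverse ordge_def)
qed

text \<open>A root c of the denominator would make w infinite at a zero of x - c, where multiples of
  the pole divisor of x allow no pole. The degree bound is read off at a pole of x.\<close>

lemma ratl_in_nD:
  assumes w: "w \<in> ratl x" "w \<in> L (nD n)"
  obtains p where "Polynomial.degree p \<le> n" "w = ev p x"
proof -
  obtain p q where pq: "q \<noteq> 0" "w = ev p x / ev q x" "\<forall>c. \<not> (poly p c = 0 \<and> poly q c = 0)"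
    using ratl_reduced[OF x_trans w(1)] by metis
  have "Polynomial.degree q = 0"
  proof (rule ccontr)
    assume "Polynomial.degree q \<noteq> 0"
    then obtain c where c: "poly q c = 0" using alg_closed_imp_poly_has_root[of q] by blast
    obtain v where v: "v \<in> places e" "ordge v 1 (x - e c)" by (rule zero_exists)
    have p: "ev p x \<noteq> 0" "v (ev p x) = 0" using place_ev_residue(1)[OF v, of p] pq(3) c by blast+
    have q: "ev q x \<noteq> 0" "1 \<le> v (ev q x)"
      using place_ev_residue(2)[OF v c] pq(1) ev_eq_0 by (auto simp: ordge_def)
    have "ordge v 0 x" using ordge_add[OF v(1) ordge_mono[OF v(2)] ordge_e[OF v(1)], of 0 c] by simp
    then have "poles x v = 0" using x_not_const by (auto simp: ordge_def poles_def place_0[OF v(1)])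
    then have "ordge v 0 w" using w(2) v(1) unfolding mem_L by fastforce
    then show False using p q pq(2) by (simp add: ordge_def place_divide[OF v(1)])
  qed
  then obtain a where a: "q = [:a:]" by (rule degree_eq_zeroE)
  then have wp: "w = ev (Polynomial.smult (inverse a) p) x"
    using pq by (simp add: ev_smult e_inverse divide_inverse mult.commute)
  have "Polynomial.degree (Polynomial.smult (inverse a) p) \<le> n"
  proof (cases "p = 0")
    case False
    define r where "r = Polynomial.smult (inverse a) p"
    have r: "r \<noteq> 0" using False pq(1) a by (simp add: r_def)
    obtain v where v: "v \<in> places e" "v x < 0" using pole_exists[OF x_not_const] .
    have "ordge v (- (int n * poles x v)) w" using w(2) v(1) unfolding mem_L by blast
    then have "ordge v (int n * v x) (ev r x)" using v wp by (simp add: poles_def r_def)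
    then have "int n * v x \<le> int (Polynomial.degree r) * v x"
      using place_ev_neg[OF v r] by (simp add: ordge_def)
    then show ?thesis using v(2) unfolding r_def by (simp add: mult_le_cancel_right)
  qed simp
  then show ?thesis using that wp by blast
qed

text \<open>If L(E) is too small for all the products x^i w_k with i \<le> d_k, a relation over k
  between them is a relation with polynomial coefficients between the w_k.\<close>

lemma poly_relation:
  assumes K: "finite K" and E: "E \<in> divisors e"
    and mem: "\<And>k p. k \<in> K \<Longrightarrow> Polynomial.degree p \<le> d k \<Longrightarrow> ev p x * w k \<in> L E"
    and card: "l E < (\<Sum>k\<in>K. d k + 1)"
  shows "\<exists>p. (\<exists>k\<in>K. p k \<noteq> 0) \<and> (\<forall>k\<in>K. Polynomial.degree (p k) \<le> d k) \<and> (\<Sum>k\<in>K. ev (p k) x * w k) = 0"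
proof -
  let ?I = "Sigma K (\<lambda>k. {..d k})"
  have "x ^ i * w k \<in> L E" if "k \<in> K" "i \<le> d k" for k i
    using mem[OF that(1), of "Polynomial.monom 1 i"] that(2) by (simp add: ev_monom degree_monom_eq)
  then have mem': "(\<lambda>(k, i). x ^ i * w k) j \<in> L E" if "j \<in> ?I" for j using that by auto
  have "l E < card ?I" using card K by simp
  then have "\<exists>c. (\<exists>i\<in>?I. c i \<noteq> 0) \<and> (\<Sum>i\<in>?I. e (c i) * (\<lambda>(k, i). x ^ i * w k) i) = 0"
    using mem' K by (intro L_dependent[OF E]) auto
  then obtain c where c: "\<exists>i\<in>?I. c i \<noteq> 0" "(\<Sum>i\<in>?I. e (c i) * (\<lambda>(k, i). x ^ i * w k) i) = 0"
    by (elim exE conjE) (rule that)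
  define p where "p k = (\<Sum>i\<le>d k. Polynomial.monom (c (k, i)) i)" for k
  have pc: "Polynomial.coeff (p k) i = c (k, i)" if "i \<le> d k" for k i using that by (simp add: p_def coeff_sum)
  obtain k i where ki: "k \<in> K" "i \<le> d k" "c (k, i) \<noteq> 0" using c(1) by auto
  then have "p k \<noteq> 0" using pc[of i k] by auto
  then have "\<exists>k\<in>K. p k \<noteq> 0" using ki(1) by blast
  moreover have "\<forall>k\<in>K. Polynomial.degree (p k) \<le> d k"
    unfolding p_def by (intro ballI degree_sum_le) (auto intro: order_trans[OF degree_monom_le])
  moreover have "(\<Sum>k\<in>K. ev (p k) x * w k) = 0"
  proof -
    have "(\<Sum>k\<in>K. ev (p k) x * w k) = (\<Sum>k\<in>K. \<Sum>i\<le>d k. e (c (k, i)) * (x ^ i * w k))"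
      by (simp add: p_def ev_sum ev_monom sum_distrib_right mult.assoc)
    also have "\<dots> = (\<Sum>i\<in>?I. e (c i) * (\<lambda>(k, i). x ^ i * w k) i)"
      using K by (subst sum.Sigma) (auto intro!: sum.cong)
    finally show ?thesis using c(2) by simp
  qed
  ultimately show ?thesis by blast
qed

lemma relation1:
  assumes "w \<noteq> 0" "E \<in> divisors e" "\<And>p. Polynomial.degree p \<le> n \<Longrightarrow> ev p x * w \<in> L E"
  shows "n + 1 \<le> l E"
proof (rule ccontr)
  assume "\<not> ?thesis"
  then obtain p where "\<exists>k\<in>{0::nat}. p k \<noteq> 0" "(\<Sum>k\<in>{0::nat}. ev (p k) x * w) = 0"
    using poly_relation[of "{0::nat}" E "\<lambda>_. n" "\<lambda>_. w"] assms by auto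
  then show False using assms(1) ev_eq_0 by simp
qed

lemma ratl_subfield_x: "is_subfield (ratl x)"
  by (rule ratl_subfield[OF x_trans])

lemma not_ratl_independent:
  assumes "w \<notin> ratl x" "ev a x + ev b x * w = 0"
  shows "a = 0" "b = 0"
proof -
  show b: "b = 0"
  proof (rule ccontr)
    assume "b \<noteq> 0"
    then have "w = ev (- a) x / ev b x"
      using assms(2) ev_eq_0 by (simp add: ev_minus field_simps eq_neg_iff_add_eq_0 add.commute)
    then show False using ratlI[OF \<open>b \<noteq> 0\<close>] assms(1) by blast
  qed
  show "a = 0" using assms(2) ev_eq_0 unfolding b by simp
qed

lemma relation2:
  assumes "w \<notin> ratl x" "E \<in> divisors e" "\<And>p. Polynomial.degree p \<le> n \<Longrightarrow> ev p x \<in> L E"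
    "\<And>p. Polynomial.degree p \<le> m \<Longrightarrow> ev p x * w \<in> L E"
  shows "n + m + 2 \<le> l E"
proof (rule ccontr)
  assume "\<not> ?thesis"
  then have card: "l E < (\<Sum>k\<in>UNIV. (if k then n else m) + 1)" by (simp add: UNIV_bool)
  have mem: "ev p x * (if k then 1 else w) \<in> L E" if "Polynomial.degree p \<le> (if k then n else m)" for k p
    using that assms(3,4)[of p] by (cases k) auto
  have "\<exists>p. (\<exists>k\<in>UNIV. p k \<noteq> 0) \<and> (\<forall>k\<in>UNIV. Polynomial.degree (p k) \<le> (if k then n else m)) \<and>
    (\<Sum>k\<in>UNIV. ev (p k) x * (if k then 1 else w)) = 0"
    using mem card by (intro poly_relation[OF _ assms(2)]) auto
  then obtain p where p: "\<exists>k\<in>UNIV. p k \<noteq> 0" "(\<Sum>k\<in>UNIV. ev (p k) x * (if k then 1 else w)) = 0"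
    by (elim exE conjE) (rule that)
  then have "ev (p True) x + ev (p False) x * w = 0" by (simp add: UNIV_bool add.commute)
  from not_ratl_independent[OF assms(1) this] p(1) show False by (metis (full_types))
qed

lemma relation3:
  assumes E: "E \<in> divisors e" "\<And>p. Polynomial.degree p \<le> n \<Longrightarrow> ev p x \<in> L E"
    "\<And>p. Polynomial.degree p \<le> m \<Longrightarrow> ev p x * y \<in> L E"
    "\<And>p. Polynomial.degree p \<le> r \<Longrightarrow> ev p x * w \<in> L E"
    "l E < n + m + r + 3"
    and y: "y \<notin> ratl x"
  shows "\<exists>a b c. Polynomial.degree a \<le> n \<and> Polynomial.degree b \<le> m \<and> Polynomial.degree c \<le> r \<and>
    c \<noteq> 0 \<and> ev a x + ev b x * y + ev c x * w = 0"
proof -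
  define d where "d k = (if k = 0 then n else if k = 1 then m else r)" for k :: nat
  define f where "f k = (if k = 0 then 1 else if k = 1 then y else w)" for k :: nat
  have "ev p x * f k \<in> L E" if "k \<in> {0, 1, 2}" "Polynomial.degree p \<le> d k" for k p
    using that E by (auto simp: d_def f_def)
  moreover have "l E < (\<Sum>k\<in>{0, 1, 2}. d k + 1)" using E(5) by (simp add: d_def)
  ultimately obtain p where p: "\<exists>k\<in>{0,1,2}. p k \<noteq> 0" "\<forall>k\<in>{0,1,2}. Polynomial.degree (p k) \<le> d k"
    "(\<Sum>k\<in>{0,1,2}. ev (p k) x * f k) = 0"
    using poly_relation[of "{0,1,2::nat}" E d f] E(1) by auto
  have rel: "ev (p 0) x + ev (p 1) x * y + ev (p 2) x * w = 0"
    using p(3) by (simp add: f_def add.assoc)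
  have "p 2 \<noteq> 0"
  proof
    assume "p 2 = 0"
    then have "p 0 = 0" "p 1 = 0" using not_ratl_independent[OF y, of "p 0" "p 1"] rel by auto
    then show False using p(1) \<open>p 2 = 0\<close> by auto
  qed
  then show ?thesis
    using p(2) rel by (intro exI[of _ "p 0"] exI[of _ "p 1"] exI[of _ "p 2"]) (auto simp: d_def)
qed

text \<open>Otherwise x^i for i \<le> n + 2 and x^i w for i \<le> n would be 2n + 4 independent
  elements of L((n + 2)D), which has dimension 2(n + 2) - 1 for large n.\<close>

lemma nD_2_ratl:
  assumes "w \<in> L (nD 2)"
  shows "w \<in> ratl x"
proof (rule ccontr)
  assume w: "w \<notin> ratl x"
  obtain N where N: "\<And>n. N \<le> n \<Longrightarrow> int (l (nD n)) = int n * divisor_degree (poles x) - 1"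
    using large_multiple_nonspecial[OF poles_div, of x] x by (auto simp: degree_two_def)
  define r where "r = l (nD (N + 2))"
  have "N + 2 + N + 2 \<le> r" unfolding r_def
    using nD_mult[of _ N w 2] assms by (intro relation2[OF w nD_div] ev_in_nD) (auto intro: ev_in_nD)
  moreover have "int r = int (N + 2) * 2 - 1"
    unfolding r_def using N[of "N + 2"] x by (simp add: degree_two_def)
  ultimately show False by simp
qed

lemma l_nD_ratl:
  assumes "L (nD n) \<subseteq> ratl x"
  shows "l (nD n) \<le> n + 1"
proof -
  have "L (nD n) \<subseteq> vs.span ((\<lambda>i. x ^ i) ` {..n})"
  proof
    fix w assume w: "w \<in> L (nD n)"
    then have "w \<in> ratl x" using assms by blast
    then obtain p where p: "Polynomial.degree p \<le> n" "w = ev p x" using ratl_in_nD w by blast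
    show "w \<in> vs.span ((\<lambda>i. x ^ i) ` {..n})"
      unfolding p(2) ev_altdef[OF p(1)] by (intro vs.span_sum vs.span_scale vs.span_base) auto
  qed
  then have "l (nD n) \<le> card ((\<lambda>i. x ^ i) ` {..n})" unfolding l_def by (intro vs.dim_le_card) auto
  also have "\<dots> \<le> n + 1" using card_image_le[of "{..n}" "\<lambda>i. x ^ i"] by simp
  finally show ?thesis .
qed

text \<open>By \<open>nD_2_ratl\<close> the space L(2D) contains only polynomials of degree \<le> 2
  in x, so l(2D) \<le> 3 = deg(2D) - 1. Every divisor above 2D inherits this bound.\<close>

lemma nonspecial:
  assumes "E \<in> divisors e" "\<And>v. 2 * poles x v \<le> E v"
  shows "int (l E) = divisor_degree E - 1"
proof -
  have "int (l E) - divisor_degree E \<le> int (l (nD 2)) - divisor_degree (nD 2)"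
    using assms by (intro l_chain nD_div) auto
  also have "\<dots> \<le> - 1" using l_nD_ratl[of 2] nD_2_ratl nD_degree[of 2] by force
  finally show ?thesis using riemann_inequality[OF assms(1)] by linarith
qed

lemma l_nD: "2 \<le> n \<Longrightarrow> l (nD n) = 2 * n - 1"
  using nonspecial[OF nD_div, of n] nD_degree[of n] by (simp add: mult_right_mono)

text \<open>Halving the orders of h(x) places w in L(2D). This is how genus 2 excludes equations of
  small degree and equations with repeated roots.\<close>

lemma small_square_ratl:
  assumes w: "w ^ 2 = ev h x" and h: "Polynomial.degree h \<le> 4"
  shows "w \<in> ratl x"
proof (cases "w = 0")
  case True
  then show ?thesis using e_in_ratl[of 0] by simp
next
  case False
  have h0: "h \<noteq> 0" using w False by auto
  have "w \<in> L (nD 2)"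
    unfolding mem_L
  proof
    fix v assume v: "v \<in> places e"
    have v2: "2 * v w = v (ev h x)" using place_power[OF v False, of 2] w by simp
    show "ordge v (- (int 2 * poles x v)) w"
    proof (cases "v x < 0")
      case True
      have "int (Polynomial.degree h) * v x \<ge> 4 * v x"
        using h True by (intro mult_right_mono_neg) auto
      moreover have "v (ev h x) = int (Polynomial.degree h) * v x" using place_ev_neg[OF v True h0] by blast
      ultimately have "2 * v x \<le> v w" using v2 by linarith
      then show ?thesis using True v by (simp add: ordge_def poles_def)
    next
      case F: False
      then have "ordge v 0 (ev h x)" by (intro ordge_ev[OF v]) (simp add: ordge_def)
      then show ?thesis using v2 False v F w by (auto simp: ordge_def poles_def)
    qed
  qed
  then show ?thesis by (rule nD_2_ratl)
qed

lemma hyperelliptic_equation: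
  obtains y g where "y \<notin> ratl x" "y \<in> L (nD 3)" "y ^ 2 = ev g x"
    "5 \<le> Polynomial.degree g" "Polynomial.degree g \<le> 6" "\<forall>c. \<not> [:- c, 1:] ^ 2 dvd g"
proof -
  have "\<not> L (nD 3) \<subseteq> ratl x" using l_nD_ratl[of 3] l_nD[of 3] by auto
  then obtain y0 where y0: "y0 \<in> L (nD 3)" "y0 \<notin> ratl x" by blast
  have mem: "ev p x * y0 \<in> L (nD 6)" if "Polynomial.degree p \<le> 3" for p
    using nD_mult[OF ev_in_nD[OF that] y0(1)] by simp
  have "y0 ^ 2 \<in> L (nD 6)" using nD_mult[OF y0(1) y0(1)] by (simp add: power2_eq_square)
  then have mem2: "ev p x * y0 ^ 2 \<in> L (nD 6)" if "Polynomial.degree p \<le> 0" for p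
    using nD_mult[OF ev_in_nD[OF that], of "y0 ^ 2" 6] by simp
  \<comment> \<open>Twelve elements of L(6D), which has dimension 11: x^i for i \<le> 6, x^i y0 for
    i \<le> 3, and y0^2.\<close>
  have card: "l (nD 6) < 6 + 3 + 0 + 3" using l_nD[of 6] by simp
  obtain a b c where abc: "Polynomial.degree a \<le> 6" "Polynomial.degree b \<le> 3" "Polynomial.degree c \<le> 0"
    "c \<noteq> 0" "ev a x + ev b x * y0 + ev c x * y0 ^ 2 = 0"
    using relation3[OF nD_div ev_in_nD mem mem2 card y0(2)] by blast
  obtain \<gamma> where \<gamma>: "c = [:\<gamma>:]" using abc(3) by (auto elim: degree_eq_zeroE)
  \<comment> \<open>Completing the square in \<gamma> y0^2 + b y0 + a = 0; \<open>g\<close> is the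
    discriminant.\<close>
  define y where "y = e (2 * \<gamma>) * y0 + ev b x"
  define g where "g = b ^ 2 - Polynomial.smult (4 * \<gamma>) a"
  have e2: "e 2 = 2" using e_add[of 1 1] by simp
  have e4: "e 4 = 4" using e_add[of 2 2] e2 by simp
  have y_nr: "y \<notin> ratl x"
  proof
    assume "y \<in> ratl x"
    then have "(y - ev b x) / e (2 * \<gamma>) \<in> ratl x"
      by (intro subfieldD[OF ratl_subfield_x] ev_in_ratl e_in_ratl)
    moreover have "(y - ev b x) / e (2 * \<gamma>) = y0" using two abc(4) \<gamma> by (simp add: y_def)
    ultimately show False using y0(2) by simp
  qed
  have y_L: "y \<in> L (nD 3)"
    unfolding y_def using y0 abc(2) by (intro vs.subspace_add vs.subspace_scale subspace_L ev_in_nD) auto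
  have y_sq: "y ^ 2 = ev g x"
  proof -
    have r: "ev a x = - (ev b x * y0) - e \<gamma> * y0 ^ 2"
      using abc(5) by (simp add: \<gamma> algebra_simps eq_neg_iff_add_eq_0)
    have "ev g x = ev b x ^ 2 - 4 * e \<gamma> * ev a x"
      by (simp add: g_def ev_diff ev_smult ev_power e_mult e4)
    moreover have "y = 2 * e \<gamma> * y0 + ev b x" by (simp add: y_def e_mult e2)
    moreover have "(2 * s * t + u) ^ 2 = u ^ 2 - 4 * s * (- (u * t) - s * t ^ 2)" for s t u :: 'f
      by (simp add: power2_eq_square algebra_simps)
    ultimately show ?thesis using r by simp
  qed
  have g6: "Polynomial.degree g \<le> 6"
  proof -
    have "Polynomial.degree (b ^ 2) \<le> 6" using degree_power_le[of b 2] abc(2) by linarith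
    then show ?thesis unfolding g_def
      using abc(1) by (intro degree_diff_le) (auto intro: order_trans[OF degree_smult_le])
  qed
  have g5: "5 \<le> Polynomial.degree g" using small_square_ratl[OF y_sq] y_nr by linarith
  \<comment> \<open>A double root c could be divided out: y / (x - c) would be a square root of a
    polynomial of degree \<le> 4.\<close>
  have "\<forall>c. \<not> [:- c, 1:] ^ 2 dvd g"
  proof (intro allI notI)
    fix c assume "[:- c, 1:] ^ 2 dvd g"
    then obtain h where h: "g = [:- c, 1:] ^ 2 * h" by (elim dvdE)
    have h0: "h \<noteq> 0" using g5 h by auto
    have nz: "ev [:- c, 1:] x \<noteq> 0" unfolding ev_eq_0 by simp
    have "(y / ev [:- c, 1:] x) ^ 2 = ev h x"
      using nz unfolding power_divide y_sq h ev_mult ev_power by simp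
    moreover have "Polynomial.degree g = 2 + Polynomial.degree h"
      unfolding h using h0 by (subst degree_mult_eq) (auto simp: degree_power_eq)
    ultimately have "y / ev [:- c, 1:] x \<in> ratl x" using g6 by (intro small_square_ratl) auto
    then have "y / ev [:- c, 1:] x * ev [:- c, 1:] x \<in> ratl x"
      by (intro subfieldD(2)[OF ratl_subfield_x] ev_in_ratl)
    moreover have "y / ev [:- c, 1:] x * ev [:- c, 1:] x = y" using nz by (rule nonzero_eq_divide_eq[THEN iffD1, OF _ refl])
    ultimately show False using y_nr by metis
  qed
  then show ?thesis by (rule that[OF y_nr y_L y_sq g5 g6])
qed

text \<open>The products x^i, x^i y and x^i w with i \<le> n number 3n + 3, while the dimension of
  the space containing them grows only like 2n. Hence 1, y, w are dependent over k(x).\<close>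

lemma generated_by_xy:
  assumes y: "y \<notin> ratl x" "y \<in> L (nD 3)"
  obtains a b where "a \<in> ratl x" "b \<in> ratl x" "w = a + b * y"
proof -
  define d where "d = divisor_degree (poles w)"
  have d0: "0 \<le> d" unfolding d_def using degree_mono[OF div_0 poles_div, of w] by simp
  \<comment> \<open>The bound l(E) \<le> 2(n + 3) + d + 1 lies below 3n + 3 exactly when n > d +
    4.\<close>
  define n where "n = nat d + 5"
  let ?E = "\<lambda>v. nD (n + 3) v + poles w v"
  have E: "?E \<in> divisors e" by (intro div_add nD_div poles_div)
  have sub: "L (nD (n + 3)) \<subseteq> L ?E" by (intro L_mono) simp
  have 1: "ev p x \<in> L ?E" if "Polynomial.degree p \<le> n" for p
    using ev_in_nD[of p "n + 3"] that sub by auto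
  have 2: "ev p x * y \<in> L ?E" if "Polynomial.degree p \<le> n" for p
    using nD_mult[OF ev_in_nD[OF that] y(2)] sub by blast
  have 3: "ev p x * w \<in> L ?E" if "Polynomial.degree p \<le> n" for p
    using L_mult[OF ev_in_nD[of p "n + 3"] mem_L_poles[of w]] that by simp
  have "int (l ?E) \<le> divisor_degree ?E + 1" using E by (intro l_effective_le) auto
  also have "divisor_degree ?E = 2 * int (n + 3) + d"
    using degree_add[OF nD_div[of "n + 3"] poles_div[of w]] nD_degree[of "n + 3"] unfolding d_def by linarith
  finally have card: "l ?E < n + n + n + 3" using d0 by (simp add: n_def)
  obtain a b c where abc: "Polynomial.degree a \<le> n" "Polynomial.degree b \<le> n" "Polynomial.degree c \<le> n"
    "c \<noteq> 0" "ev a x + ev b x * y + ev c x * w = 0"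
    using relation3[OF E 1 2 3 card y(1)] by blast
  have "w = ev (- a) x / ev c x + ev (- b) x / ev c x * y"
    using abc(4,5) ev_eq_0 by (simp add: ev_minus field_simps eq_neg_iff_add_eq_0)
  then show ?thesis using that ratlI[OF abc(4)] by blast
qed

text \<open>The six elements 1, x, x^2, x^3, y, w lie in the five-dimensional space L(3D).\<close>

lemma L_3_decomposition:
  assumes y: "y \<notin> ratl x" "y \<in> L (nD 3)" and w: "w \<in> L (nD 3)"
  obtains p c where "w = ev p x + e c * y"
proof -
  have 2: "ev p x * y \<in> L (nD 3)" if "Polynomial.degree p \<le> 0" for p
    using nD_mult[OF ev_in_nD[OF that] y(2)] by simp
  have 3: "ev p x * w \<in> L (nD 3)" if "Polynomial.degree p \<le> 0" for p
    using nD_mult[OF ev_in_nD[OF that] w] by simp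
  have card: "l (nD 3) < 3 + 0 + 0 + 3" using l_nD[of 3] by simp
  obtain a b c where abc: "Polynomial.degree a \<le> 3" "Polynomial.degree b \<le> 0" "Polynomial.degree c \<le> 0"
    "c \<noteq> 0" "ev a x + ev b x * y + ev c x * w = 0"
    using relation3[OF nD_div ev_in_nD 2 3 card y(1)] by blast
  obtain \<beta> \<gamma> where bg: "b = [:\<beta>:]" "c = [:\<gamma>:]" using abc(2,3) by (auto elim!: degree_eq_zeroE)
  then have "\<gamma> \<noteq> 0" using abc(4) by simp
  have "w * e \<gamma> = - ev a x - e \<beta> * y"
    using abc(5) by (simp add: bg eq_diff_eq eq_neg_iff_add_eq_0 algebra_simps)
  then have "w = (- ev a x - e \<beta> * y) / e \<gamma>" using \<open>\<gamma> \<noteq> 0\<close> by (simp add: nonzero_eq_divide_eq)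
  also have "\<dots> = ev (Polynomial.smult (- inverse \<gamma>) a) x + e (- \<beta> / \<gamma>) * y"
    unfolding ev_smult e_minus e_inverse e_divide using \<open>\<gamma> \<noteq> 0\<close> by (simp add: divide_inverse algebra_simps)
  finally show ?thesis using that by blast
qed

text \<open>Uniqueness of the double cover. For z outside k(x), the six products x^i and x^i z with
  i \<le> 2 would be independent elements of a space of dimension 5, since 2D plus the poles of z is
  nonspecial of degree 6.\<close>

lemma degree_two_ratl:
  assumes z: "degree_two z"
  shows "z \<in> ratl x"
proof (rule ccontr)
  assume "z \<notin> ratl x"
  let ?E = "\<lambda>v. nD 2 v + poles z v"
  have E: "?E \<in> divisors e" by (intro div_add nD_div poles_div)
  have "2 + 2 + 2 \<le> l ?E"
  proof (rule relation2[OF \<open>z \<notin> ratl x\<close> E])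
    have sub: "L (nD 2) \<subseteq> L ?E" by (intro L_mono) simp
    fix p :: "'k poly" assume p: "Polynomial.degree p \<le> 2"
    show "ev p x \<in> L ?E" using ev_in_nD[OF p] sub by blast
    show "ev p x * z \<in> L ?E" using L_mult[OF ev_in_nD[OF p] mem_L_poles[of z]] by simp
  qed
  moreover have "int (l ?E) = divisor_degree ?E - 1" by (intro nonspecial E) simp
  moreover have "divisor_degree ?E = 6"
    using degree_add[OF nD_div poles_div, of 2 z] nD_degree[of 2] z by (simp add: degree_two_def)
  ultimately show False by simp
qed

text \<open>Let N be the larger of the two degrees in lowest terms p/q. Every r/q with deg r \<le> N
  has no worse poles than z, so N + 1 \<le> l(poles of z) \<le> 2.\<close>

lemma degree_two_moebius:
  assumes z: "degree_two z"
  obtains p q where "q \<noteq> 0" "z = ev p x / ev q x" "\<forall>c. \<not> (poly p c = 0 \<and> poly q c = 0)"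
    "Polynomial.degree p \<le> 1" "Polynomial.degree q \<le> 1"
proof -
  obtain p q where pq: "q \<noteq> 0" "z = ev p x / ev q x" "\<forall>c. \<not> (poly p c = 0 \<and> poly q c = 0)"
    using ratl_reduced[OF x_trans degree_two_ratl[OF z]] by metis
  define N where "N = max (Polynomial.degree p) (Polynomial.degree q)"
  have z0: "z \<noteq> 0" using z by (metis degree_two_def e_0 rangeI)
  have p0: "p \<noteq> 0" using z0 pq(2) by auto
  have nz: "ev p x \<noteq> 0" "ev q x \<noteq> 0" using p0 pq(1) ev_eq_0 by auto
  have "N + 1 \<le> l (poles z)"
  proof (rule relation1[of "inverse (ev q x)"])
    fix r :: "'k poly" assume r: "Polynomial.degree r \<le> N"
    show "ev r x * inverse (ev q x) \<in> L (poles z)"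
    proof (cases "r = 0")
      case False
      then have r0: "ev r x \<noteq> 0" using ev_eq_0 by simp
      show ?thesis
        unfolding mem_L
      proof
        fix v assume v: "v \<in> places e"
        have vr: "v (ev r x * inverse (ev q x)) = v (ev r x) - v (ev q x)"
          using r0 nz by (simp add: place_mult[OF v] place_inverse[OF v])
        have vz: "v z = v (ev p x) - v (ev q x)" unfolding pq(2) using nz by (simp add: place_divide[OF v])
        have "v (ev r x) - v (ev q x) \<ge> - max 0 (- v z)"
        proof (cases "v x < 0")
          case True
          define n where "n = - v x"
          have n: "n > 0" using True by (simp add: n_def)
          have vs: "v (ev r x) = - (int (Polynomial.degree r) * n)" "v (ev q x) = - (int (Polynomial.degree q) * n)"
            "v (ev p x) = - (int (Polynomial.degree p) * n)"
            using place_ev_neg[OF v True] False pq(1) p0 by (auto simp: n_def)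
          have "int (Polynomial.degree r) * n \<le> int N * n" using r n by simp
          then show ?thesis unfolding vz vs by (auto simp: N_def max_def split: if_splits)
        next
          case F: False
          then have ox: "ordge v 0 x" by (simp add: ordge_def)
          have vr0: "0 \<le> v (ev r x)" using ordge_ev[OF v ox, of r] r0 by (simp add: ordge_def)
          obtain c where c: "ordge v 1 (x - e c)" using residue_exists[OF v ox] by blast
          show ?thesis
          proof (cases "poly q c = 0")
            case True
            then have "v (ev p x) = 0" using place_ev_residue(1)[OF v c, of p] pq(3) by blast
            then show ?thesis using vr0 unfolding vz by simp
          next
            case False
            then have "v (ev q x) = 0" using place_ev_residue(1)[OF v c] by blast
            then show ?thesis using vr0 by simp
          qed
        qed
        then show "ordge v (- poles z v) (ev r x * inverse (ev q x))"
          using v vr by (simp add: ordge_def poles_def)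
      qed
    qed (simp add: mem_L)
  qed (use nz in auto)
  moreover have "l (poles z) \<le> 2" using z by (intro l_effective_degree_2) (auto simp: degree_two_def)
  ultimately have "N \<le> 1" by linarith
  then show ?thesis using that[OF pq] by (simp add: N_def)
qed

end

section \<open>Automorphisms\<close>

context field_extension
begin

definition involution :: "('f \<Rightarrow> 'f) \<Rightarrow> bool" where
  "involution \<sigma> \<longleftrightarrow> field_automorphism \<sigma> \<and> (\<forall>c. \<sigma> (e c) = e c) \<and> (\<forall>h. \<sigma> (\<sigma> h) = h)"

lemma automorphism_simps:
  assumes "field_automorphism \<sigma>"
  shows "\<sigma> 1 = 1" "\<sigma> 0 = 0" "\<sigma> (a + b) = \<sigma> a + \<sigma> b" "\<sigma> (a * b) = \<sigma> a * \<sigma> b" "\<sigma> (- a) = - \<sigma> a"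
    "\<sigma> (a - b) = \<sigma> a - \<sigma> b" "\<sigma> (inverse a) = inverse (\<sigma> a)" "\<sigma> (a / b) = \<sigma> a / \<sigma> b"
    "\<sigma> (a ^ n) = \<sigma> a ^ n" "\<sigma> a = 0 \<longleftrightarrow> a = 0" "\<sigma> a = \<sigma> b \<longleftrightarrow> a = b"
proof -
  interpret s: field_extension \<sigma>
    using assms by unfold_locales (simp add: field_automorphism_def)
  show "\<sigma> 1 = 1" "\<sigma> 0 = 0" "\<sigma> (a + b) = \<sigma> a + \<sigma> b" "\<sigma> (a * b) = \<sigma> a * \<sigma> b" "\<sigma> (- a) = - \<sigma> a"
    "\<sigma> (a - b) = \<sigma> a - \<sigma> b" "\<sigma> (inverse a) = inverse (\<sigma> a)" "\<sigma> (a / b) = \<sigma> a / \<sigma> b"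
    "\<sigma> (a ^ n) = \<sigma> a ^ n" "\<sigma> a = 0 \<longleftrightarrow> a = 0" "\<sigma> a = \<sigma> b \<longleftrightarrow> a = b"
    by (rule s.e_1 s.e_0 s.e_add s.e_mult s.e_minus s.e_diff s.e_inverse s.e_divide s.e_power
        s.e_eq_0_iff s.e_eq_iff)+
qed

lemma automorphism_ev:
  assumes "field_automorphism \<sigma>" "\<And>c. \<sigma> (e c) = e c"
  shows "\<sigma> (ev p h) = ev p (\<sigma> h)"
  by (induction p) (simp_all add: automorphism_simps[OF assms(1)] assms(2))

lemma involution_place:
  assumes s: "involution \<sigma>" and v: "v \<in> places e"
  shows "v \<circ> \<sigma> \<in> places e"
proof -
  note [simp] = automorphism_simps[OF s[unfolded involution_def, THEN conjunct1]]
  have s2: "\<sigma> (\<sigma> h) = h" "\<sigma> (e c) = e c" for h c using s by (auto simp: involution_def)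
  obtain t where "v t = 1" using v by (auto simp: places_def)
  then have "(v \<circ> \<sigma>) (\<sigma> t) = 1" by (simp add: s2)
  then have "\<exists>a. (v \<circ> \<sigma>) a = 1" by blast
  moreover have "min (v (\<sigma> a)) (v (\<sigma> b)) \<le> v (\<sigma> a + \<sigma> b)" if "a \<noteq> 0" "b \<noteq> 0" "a + b \<noteq> 0" for a b
  proof -
    have "\<sigma> (a + b) \<noteq> 0" using that(3) automorphism_simps(10)[OF s[unfolded involution_def, THEN conjunct1]] by blast
    then show ?thesis using v that by (simp add: places_def)
  qed
  ultimately show ?thesis
    using v by (auto simp: places_def s2)
qed

lemma involution_place_iff: "involution \<sigma> \<Longrightarrow> v \<circ> \<sigma> \<in> places e \<longleftrightarrow> v \<in> places e"
  using involution_place[of \<sigma> v] involution_place[of \<sigma> "v \<circ> \<sigma>"]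
  by (auto simp: involution_def comp_def)

end

context genus_two_curve
begin

lemma poles_involution:
  "involution \<sigma> \<Longrightarrow> poles (\<sigma> h) = (\<lambda>v. poles h (v \<circ> \<sigma>))"
  by (rule ext) (simp add: poles_def involution_place_iff)

lemma degree_two_involution:
  assumes s: "involution \<sigma>" and h: "degree_two h"
  shows "degree_two (\<sigma> h)"
proof -
  have s2: "\<sigma> (\<sigma> g) = g" "\<sigma> (e c) = e c" for g c using s by (auto simp: involution_def)
  have "divisor_degree (poles (\<sigma> h)) = divisor_degree (poles h)"
    unfolding divisor_degree_def poles_involution[OF s]
    by (rule sum.reindex_bij_witness[of _ "\<lambda>v. v \<circ> \<sigma>" "\<lambda>v. v \<circ> \<sigma>"]) (auto simp: comp_def s2)
  moreover have "\<sigma> h \<notin> range e"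
  proof
    assume "\<sigma> h \<in> range e"
    then obtain c where "\<sigma> h = e c" by blast
    then have "h = e c" using s2 by metis
    then show False using h by (auto simp: degree_two_def)
  qed
  ultimately show ?thesis using h by (simp add: degree_two_def)
qed

lemma poles_add_const: "poles (h + e c) = poles h"
proof
  fix v
  show "poles (h + e c) v = poles h v"
  proof (cases "v \<in> places e")
    case v: True
    show ?thesis
    proof (cases "v h < 0")
      case True
      then have "h \<noteq> 0" "ordge v (v h + 1) (e c)" using place_0[OF v] ordge_e[OF v] by auto
      then show ?thesis using place_add_eq[OF v] by (simp add: poles_def)
    next
      case False
      then have "ordge v 0 h" by (simp add: ordge_def)
      then have "ordge v 0 (h + e c)" using ordge_e[OF v] by (intro ordge_add[OF v]) auto
      then have "0 \<le> v (h + e c)" using place_0[OF v] by (auto simp: ordge_def)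
      then show ?thesis using False by (simp add: poles_def)
    qed
  qed (simp add: poles_def)
qed

lemma poles_scale: "c \<noteq> 0 \<Longrightarrow> poles (e c * h) = poles h"
  by (rule ext) (cases "h = 0"; simp add: poles_def place_mult place_e)

lemma const_diff: "h + e c \<in> range e \<longleftrightarrow> h \<in> range e"
proof
  assume "h + e c \<in> range e"
  then obtain d where "h + e c = e d" by blast
  then have "h = e (d - c)" by (simp add: e_diff eq_diff_eq)
  then show "h \<in> range e" by blast
next
  assume "h \<in> range e"
  then show "h + e c \<in> range e" by (auto simp flip: e_add)
qed

lemma const_scale: "c \<noteq> 0 \<Longrightarrow> e c * h \<in> range e \<longleftrightarrow> h \<in> range e"
proof
  assume c: "c \<noteq> 0" and "e c * h \<in> range e"
  then obtain d where "e c * h = e d" by blast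
  then have "h = e (d / c)" using c by (simp add: e_divide eq_divide_eq mult.commute)
  then show "h \<in> range e" by blast
next
  assume "h \<in> range e"
  then show "e c * h \<in> range e" by (auto simp flip: e_mult)
qed

lemma const_inverse: "inverse h \<in> range e \<longleftrightarrow> h \<in> range e"
  by (metis (mono_tags, lifting) e_inverse imageE inverse_inverse_eq rangeI)

lemma degree_two_add_const: "degree_two (h + e c) \<longleftrightarrow> degree_two h"
  by (simp add: degree_two_def poles_add_const const_diff)

lemma degree_two_scale: "c \<noteq> 0 \<Longrightarrow> degree_two (e c * h) \<longleftrightarrow> degree_two h"
  by (simp add: degree_two_def poles_scale const_scale)

lemma degree_two_inverse: "degree_two h \<Longrightarrow> degree_two (inverse h)"
  using degree_poles_inverse[of h] by (cases "h = 0") (auto simp: degree_two_def const_inverse)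

end

section \<open>Involutions acting on x\<close>

context curve_degree_two
begin

text \<open>An involution acts on \<open>x\<close> as a Moebius transformation of order 2, given by a symmetric bilinear
  relation between \<open>x\<close> and its image; the two fixed points are moved to \<open>0\<close> and \<open>\<infinity>\<close>.\<close>

lemma anti_invariant_degree_two:
  assumes s: "involution \<sigma>" and moves: "\<sigma> x \<noteq> x"
  shows "\<exists>x'. degree_two x' \<and> \<sigma> x' = - x'"
proof -
  have aut: "field_automorphism \<sigma>" and s2: "\<And>h. \<sigma> (\<sigma> h) = h" "\<And>c. \<sigma> (e c) = e c"
    using s by (auto simp: involution_def)
  note aut_simps = automorphism_simps[OF aut]
  define z where "z = \<sigma> x"
  have sz: "\<sigma> z = x" by (simp add: z_def s2)
  have z2: "degree_two z" unfolding z_def using degree_two_involution[OF s x] .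
  obtain p q where pq: "q \<noteq> 0" "z = ev p x / ev q x" "\<forall>c. \<not> (poly p c = 0 \<and> poly q c = 0)"
    "Polynomial.degree p \<le> 1" "Polynomial.degree q \<le> 1"
    using degree_two_moebius[OF z2] by metis
  define \<alpha> where "\<alpha> = Polynomial.coeff p 1"
  define \<beta> where "\<beta> = Polynomial.coeff p 0"
  define \<gamma> where "\<gamma> = Polynomial.coeff q 1"
  define \<delta> where "\<delta> = Polynomial.coeff q 0"
  have lin: "r = [:Polynomial.coeff r 0, Polynomial.coeff r 1:]" if "Polynomial.degree r \<le> 1" for r :: "'k poly"
    using that by (intro poly_eqI) (auto simp: coeff_pCons coeff_eq_0 split: nat.splits)
  have p: "p = [:\<beta>, \<alpha>:]" and q: "q = [:\<delta>, \<gamma>:]"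
    unfolding \<alpha>_def \<beta>_def \<gamma>_def \<delta>_def using lin pq(4,5) by auto
  have "ev q x \<noteq> 0" using pq(1) ev_eq_0 by simp
  then have I: "z * (e \<delta> + x * e \<gamma>) = e \<beta> + x * e \<alpha>"
    using pq(2) by (simp add: p q)
  have II: "x * (e \<delta> + z * e \<gamma>) = e \<beta> + z * e \<alpha>"
    using arg_cong[OF I, of \<sigma>] by (simp add: aut_simps s2 sz flip: z_def)
  \<comment> \<open>Comparing the relation I with its image II, in which x and z are exchanged,
    leaves (\<alpha> + \<delta>)(z - x) = 0: a Moebius transformation of order 2 has trace
    0.\<close>
  have "e (\<delta> + \<alpha>) * (z - x) = z * (e \<delta> + x * e \<gamma>) - x * (e \<delta> + z * e \<gamma>) - (e \<beta> + x * e \<alpha>) + (e \<beta> + z * e \<alpha>)"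
    by (simp add: e_add algebra_simps)
  then have "e (\<delta> + \<alpha>) * (z - x) = 0" unfolding I II by simp
  then have "\<delta> + \<alpha> = 0" using moves by (simp add: z_def)
  then have \<delta>: "\<delta> = - \<alpha>" by (simp add: eq_neg_iff_add_eq_0)
  have III: "e \<gamma> * (x * z) - e \<alpha> * (x + z) - e \<beta> = 0"
    using I by (simp add: \<delta> e_minus algebra_simps)
  show ?thesis
  proof (cases "\<gamma> = 0")
    case True
    then have "\<alpha> \<noteq> 0" using pq(1) q \<delta> by auto
    \<comment> \<open>Here infinity is fixed and x + z = 2c, so the other fixed point c is moved to
      0.\<close>
    define c where "c = - \<beta> / (2 * \<alpha>)"
    have c: "\<alpha> * (c + c) = - \<beta>" using \<open>\<alpha> \<noteq> 0\<close> two by (simp add: c_def mult_2[symmetric])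
    have "e \<alpha> * (x + z) = - (e \<gamma> * (x * z) - e \<alpha> * (x + z) - e \<beta>) - e \<beta>" using True by simp
    then have "e \<alpha> * (x + z) = e \<alpha> * (e c + e c)"
      unfolding III e_add[symmetric] e_mult[symmetric] c by (simp add: e_minus)
    then have xz: "x + z = e c + e c" using \<open>\<alpha> \<noteq> 0\<close> by simp
    have "\<sigma> (x + e (- c)) = - (x + e (- c))"
      using xz by (simp add: aut_simps s2 flip: z_def) (simp add: e_minus algebra_simps eq_neg_iff_add_eq_0)
    then show ?thesis using x degree_two_add_const by blast
  next
    case False
    \<comment> \<open>The fixed points \<open>r1\<close>, \<open>r2\<close> are the roots of
      \<gamma> X^2 - 2 \<alpha> X - \<beta>, and s is the square root in their formula.\<close>
    obtain s where s: "s ^ 2 = \<alpha> ^ 2 + \<beta> * \<gamma>" using nth_root_exists[of 2 "\<alpha> ^ 2 + \<beta> * \<gamma>"] by auto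
    define r1 where "r1 = (\<alpha> + s) / \<gamma>"
    define r2 where "r2 = (\<alpha> - s) / \<gamma>"
    have r: "\<gamma> * (r1 + r2) = \<alpha> + \<alpha>" "\<gamma> * (r1 * r2) = - \<beta>"
    proof -
      show "\<gamma> * (r1 + r2) = \<alpha> + \<alpha>" using False by (simp add: r1_def r2_def flip: add_divide_distrib)
      have "\<gamma> * (\<gamma> * (r1 * r2)) = (\<gamma> * r1) * (\<gamma> * r2)" by (simp add: mult_ac)
      also have "\<dots> = (\<alpha> + s) * (\<alpha> - s)" using False by (simp add: r1_def r2_def)
      also have "\<dots> = \<gamma> * (- \<beta>)" using s by (simp add: power2_eq_square algebra_simps)
      finally show "\<gamma> * (r1 * r2) = - \<beta>" using False by (metis mult_left_cancel)
    qed
    have "e \<gamma> * (x * z + x * z - e (r1 + r2) * (x + z) + e (r1 * r2) + e (r1 * r2))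
      = e \<gamma> * (x * z) + e \<gamma> * (x * z) - e (\<gamma> * (r1 + r2)) * (x + z) + e (\<gamma> * (r1 * r2)) + e (\<gamma> * (r1 * r2))"
    proof -
      have "a * (b + b - c * d + h + h) = a * b + a * b - (a * c) * d + a * h + a * h" for a b c d h :: 'f
        by (simp add: algebra_simps)
      then show ?thesis unfolding e_mult[of \<gamma>] .
    qed
    also have "\<dots> = (e \<gamma> * (x * z) - e \<alpha> * (x + z) - e \<beta>) + (e \<gamma> * (x * z) - e \<alpha> * (x + z) - e \<beta>)"
      unfolding r e_minus e_add by (simp add: algebra_simps)
    finally have IV: "x * z + x * z - e (r1 + r2) * (x + z) + e (r1 * r2) + e (r1 * r2) = 0"
      using False III by simp
    have "x * z + x * z - (a + b) * (x + z) + a * b + a * b = (z - a) * (x - b) + (x - a) * (z - b)" for a b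
      by (simp add: algebra_simps)
    with IV have V: "(z - e r1) * (x - e r2) + (x - e r1) * (z - e r2) = 0"
      unfolding e_add e_mult by simp
    have xn: "x - e c \<noteq> 0" for c using x_not_const by auto
    have zn: "z - e c \<noteq> 0" for c using z2 by (auto simp: degree_two_def)
    have r12: "r1 \<noteq> r2"
    proof
      assume eq: "r1 = r2"
      have "(x - e r1) * (z - e r1) + (x - e r1) * (z - e r1) = 0"
        using V unfolding eq by (simp only: mult.commute[of "z - _"])
      then have "e (1 + 1) * ((x - e r1) * (z - e r1)) = 0"
        unfolding e_add e_1 distrib_right mult_1_left .
      then show False using xn zn two by simp
    qed
    \<comment> \<open>This is (x - r1) / (x - r2), written with translations, one inversion and one
      scaling so that it visibly keeps degree two.\<close>
    define x' where "x' = e (r2 - r1) * inverse (x + e (- r2)) + e 1"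
    have x': "x' = (x - e r1) / (x - e r2)"
      using xn[of r2] by (simp add: x'_def e_diff e_minus field_simps)
    have "degree_two x'"
      using x r12 unfolding x'_def
      by (subst degree_two_add_const, subst degree_two_scale) (auto intro!: degree_two_inverse simp: degree_two_add_const)
    moreover have "\<sigma> x' = - x'"
    proof -
      have "(z - e r1) * (x - e r2) = - (x - e r1) * (z - e r2)"
        using V by (simp only: eq_neg_iff_add_eq_0 mult_minus_left)
      then have "(z - e r1) / (z - e r2) = - (x - e r1) / (x - e r2)"
        using xn zn by (subst frac_eq_eq) auto
      then show ?thesis unfolding x' aut_simps s2 z_def[symmetric] by (simp only: minus_divide_left)
    qed
    ultimately show ?thesis by blast
  qed
qed

text \<open>An automorphism fixing x fixes k(x) and sends y to a square root of g(x), that is, to y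
  or -y; this sign determines it. A group of order four must therefore move x.\<close>

lemma automorphisms_fixing_x:
  assumes "\<And>\<sigma>. field_automorphism \<sigma> \<Longrightarrow> (\<And>c. \<sigma> (e c) = e c) \<Longrightarrow> \<sigma> x = x"
  shows "card {\<sigma>. field_automorphism \<sigma> \<and> (\<forall>c. \<sigma> (e c) = e c)} \<le> 2"
proof -
  obtain y g where y: "y \<notin> ratl x" "y \<in> L (nD 3)" "y ^ 2 = ev g x"
    using hyperelliptic_equation by metis
  let ?A = "{\<sigma>. field_automorphism \<sigma> \<and> (\<forall>c. \<sigma> (e c) = e c)}"
  have ratl_fix: "\<sigma> a = a" if s: "\<sigma> \<in> ?A" and a: "a \<in> ratl x" for \<sigma> a
  proof -
    obtain p q where "a = ev p x / ev q x" using a unfolding ratl_def by blast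
    moreover have "\<sigma> x = x" using s assms by blast
    ultimately show ?thesis using s by (simp add: automorphism_simps automorphism_ev)
  qed
  have "\<sigma> y \<in> {y, - y}" if s: "\<sigma> \<in> ?A" for \<sigma>
  proof -
    have "\<sigma> y ^ 2 = \<sigma> (y ^ 2)" using s by (simp add: automorphism_simps)
    also have "\<dots> = y ^ 2" unfolding y(3) by (rule ratl_fix[OF s ev_in_ratl])
    finally show ?thesis by (simp add: power2_eq_iff)
  qed
  moreover have "inj_on (\<lambda>\<sigma>. \<sigma> y) ?A"
  proof (rule inj_onI, rule ext)
    fix \<sigma> \<tau> w assume st: "\<sigma> \<in> ?A" "\<tau> \<in> ?A" "\<sigma> y = \<tau> y"
    obtain a b where ab: "a \<in> ratl x" "b \<in> ratl x" "w = a + b * y"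
      using generated_by_xy[OF y(1,2)] by metis
    have *: "\<rho> w = a + b * \<rho> y" if "\<rho> \<in> ?A" for \<rho>
      using that ratl_fix[OF that] ab by (simp add: automorphism_simps)
    show "\<sigma> w = \<tau> w" unfolding *[OF st(1)] *[OF st(2)] st(3) ..
  qed
  ultimately have "card ?A \<le> card {y, - y}" by (intro card_inj_on_le[of "\<lambda>\<sigma>. \<sigma> y"]) auto
  also have "\<dots> \<le> 2" by (simp add: card_insert_if)
  finally show ?thesis .
qed

end

lemma card_roots_squarefree:
  fixes p :: "'k::alg_closed_field poly"
  assumes "p \<noteq> 0" "\<And>c. \<not> [:- c, 1:] ^ 2 dvd p"
  shows "card {a. poly p a = 0} = Polynomial.degree p"
proof -
  obtain A where A: "size A = Polynomial.degree p"
    "p = Polynomial.smult (Polynomial.lead_coeff p) (\<Prod>x\<in>#A. [:- x, 1:])"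
    using alg_closed_imp_factorization[OF assms(1)] by blast
  have le: "count A c \<le> 1" for c
  proof (rule ccontr)
    assume "\<not> count A c \<le> 1"
    then have "{#c, c#} \<subseteq># A" by (intro mset_subset_eqI) auto
    then obtain B where "A = {#c, c#} + B" by (metis subset_mset.add_diff_inverse)
    then have "p = [:- c, 1:] ^ 2 * Polynomial.smult (Polynomial.lead_coeff p) (\<Prod>x\<in>#B. [:- x, 1:])"
      using A(2) by (simp add: power2_eq_square mult.assoc del: mult_pCons_left mult_pCons_right)
    then show False using assms(2)[of c] by (metis dvd_triv_left)
  qed
  have "count A c = 1" if "c \<in># A" for c
    using that le[of c] count_greater_zero_iff[of A c] by linarith
  then have "size A = card (set_mset A)" by (simp add: size_multiset_overloaded_eq)
  moreover have "{a. poly p a = 0} = set_mset A"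
    using assms(1) by (subst A(2)) (auto simp: poly_prod_mset prod_mset_zero_iff)
  ultimately show ?thesis using A(1) by simp
qed

section \<open>The normal form of the equation\<close>

context curve_degree_two
begin

lemma even_equation:
  assumes s: "involution \<sigma>" and sx: "\<sigma> x = - x"
  obtains y g0 g2 g4 g6 where "y \<notin> ratl x" "y \<in> L (nD 3)" "y ^ 2 = ev [:g0, 0, g2, 0, g4, 0, g6:] x"
    "g0 \<noteq> 0" "g6 \<noteq> 0" "\<forall>c. \<not> [:- c, 1:] ^ 2 dvd [:g0, 0, g2, 0, g4, 0, g6:]"
proof -
  have aut: "field_automorphism \<sigma>" and s2: "\<And>h. \<sigma> (\<sigma> h) = h" "\<And>c. \<sigma> (e c) = e c"
    using s by (auto simp: involution_def)
  note aut_simps = automorphism_simps[OF aut]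
  obtain y g where y: "y \<notin> ratl x" "y \<in> L (nD 3)" "y ^ 2 = ev g x"
    "5 \<le> Polynomial.degree g" "Polynomial.degree g \<le> 6" "\<forall>c. \<not> [:- c, 1:] ^ 2 dvd g"
    using hyperelliptic_equation by metis
  define \<mu> :: "'k poly" where "\<mu> = Polynomial.monom (- 1) (Suc 0)"
  have ev\<mu>: "ev p (- x) = ev (pcompose p \<mu>) x" for p
    by (simp add: ev_pcompose \<mu>_def ev_monom e_minus)
  have ev_s: "\<sigma> (ev p x) = ev (pcompose p \<mu>) x" for p
    using automorphism_ev[OF aut s2(2), of p x] sx ev\<mu> by simp
  have "\<sigma> y \<in> L (nD 3)"
    unfolding mem_L
  proof
    fix v assume v: "v \<in> places e"
    have "poles (- x) = poles x" using poles_scale[of "- 1" x] by (simp add: e_minus)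
    then have "poles x (v \<circ> \<sigma>) = poles x v" using poles_involution[OF s, of x] sx by metis
    moreover have "ordge (v \<circ> \<sigma>) (- (int 3 * poles x (v \<circ> \<sigma>))) y"
      using y(2) involution_place[OF s v] unfolding mem_L by blast
    ultimately show "ordge v (- (int 3 * poles x v)) (\<sigma> y)" by (auto simp: ordge_def aut_simps)
  qed
  \<comment> \<open>As \<sigma> preserves the pole divisor of x, the image of y stays in L(3D) and
    has this shape; the following steps give p = 0 and c^2 = 1.\<close>
  then obtain p c where pc: "\<sigma> y = ev p x + e c * y" using L_3_decomposition[OF y(1,2)] by metis
  have "c \<noteq> 0"
  proof
    assume "c = 0"
    then have "y = ev (pcompose p \<mu>) x" using pc s2(1)[of y] ev_s by simp
    then show False using y(1) ev_in_ratl by metis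
  qed
  have "ev (pcompose g \<mu>) x = \<sigma> (y ^ 2)" by (simp add: y(3) ev_s)
  also have "\<dots> = ev p x * ev p x + ev p x * e c * y + ev p x * e c * y + e c * e c * y ^ 2"
    by (simp add: aut_simps pc power2_eq_square algebra_simps)
  finally have sq: "ev (pcompose g \<mu>) x = \<dots>" .
  \<comment> \<open>The coefficients of 1 and y in \<sigma>(y^2) = (\<sigma> y)^2 may be compared
    because y is not in k(x).\<close>
  have "ev (p * p + Polynomial.smult (c * c) g - pcompose g \<mu>) x + ev (Polynomial.smult (c + c) p) x * y = 0"
    unfolding ev_add ev_diff ev_mult ev_smult e_mult e_add sq y(3) by (simp add: algebra_simps)
  note rel = not_ratl_independent[OF y(1) this]
  have "c + c \<noteq> 0" using \<open>c \<noteq> 0\<close> two by (metis mult_2 mult_eq_0_iff)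
  then have p0: "p = 0" using rel(2) by simp
  then have sy: "\<sigma> y = e c * y" using pc by simp
  have "y = \<sigma> (\<sigma> y)" by (simp only: s2)
  also have "\<dots> = e c * (e c * y)" by (simp only: sy aut_simps s2)
  finally have "y = e (c * c) * y" unfolding e_mult mult.assoc .
  moreover have "y \<noteq> 0" using y(1) e_in_ratl[of 0] by auto
  ultimately have "e (c * c) = e 1" by simp
  then have "c * c = 1" unfolding e_eq_iff .
  then have g: "pcompose g \<mu> = g" using rel(1) p0 by simp
  have odd: "Polynomial.coeff g i = 0" if "odd i" for i
  proof -
    have "Polynomial.coeff g i = - Polynomial.coeff g i"
      using arg_cong[OF g, of "\<lambda>p. Polynomial.coeff p i"] that by (simp add: \<mu>_def coeff_pcompose_monom_linear)
    then have "2 * Polynomial.coeff g i = 0" by (metis mult_2 add.right_inverse)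
    then show ?thesis using two by simp
  qed
  have o35: "Polynomial.coeff g 3 = 0" "Polynomial.coeff g 5 = 0" by (rule odd, simp)+
  have deg: "Polynomial.degree g = 6"
  proof (rule ccontr)
    assume "Polynomial.degree g \<noteq> 6"
    then have "Polynomial.degree g = 5" using y(4,5) by linarith
    moreover then have "Polynomial.coeff g 5 = 0" by (intro odd) simp
    ultimately show False using leading_coeff_0_iff[of g] by auto
  qed
  define g0 where "g0 = Polynomial.coeff g 0"
  define g2 where "g2 = Polynomial.coeff g 2"
  define g4 where "g4 = Polynomial.coeff g 4"
  define g6 where "g6 = Polynomial.coeff g 6"
  have geq: "g = [:g0, 0, g2, 0, g4, 0, g6:]"
  proof (rule poly_eqI)
    fix i :: nat
    consider "i = 0" | "i = 1" | "i = 2" | "i = 3" | "i = 4" | "i = 5" | "i = 6" | "6 < i" by linarith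
    then show "Polynomial.coeff g i = Polynomial.coeff [:g0, 0, g2, 0, g4, 0, g6:] i"
      by cases (use o35 in
        \<open>auto simp: g0_def g2_def g4_def g6_def odd coeff_pCons coeff_eq_0 deg numeral_eq_Suc split: nat.splits\<close>)
  qed
  have "g6 \<noteq> 0" unfolding g6_def using deg leading_coeff_0_iff[of g] by auto
  \<comment> \<open>An even polynomial without constant term is divisible by x^2.\<close>
  moreover have "g0 \<noteq> 0"
  proof
    assume "g0 = 0"
    then have "g = [:- 0, 1:] ^ 2 * [:g2, 0, g4, 0, g6:]" by (simp add: geq power2_eq_square)
    then show False using y(6) by (metis dvd_triv_left)
  qed
  ultimately show ?thesis using that[OF y(1,2)] y(3,6) unfolding geq by blast
qed

lemma has_even_equation:
  assumes s: "involution \<sigma>" and sx: "\<sigma> x = - x"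
  shows "\<exists>s1 s2. has_equation e (even_sextic s1 s2)"
proof -
  obtain y g0 g2 g4 g6 where y: "y \<notin> ratl x" "y \<in> L (nD 3)" "y ^ 2 = ev [:g0, 0, g2, 0, g4, 0, g6:] x"
    and g: "g0 \<noteq> 0" "g6 \<noteq> 0" "\<forall>c. \<not> [:- c, 1:] ^ 2 dvd [:g0, 0, g2, 0, g4, 0, g6:]"
    using even_equation[OF s sx] by metis
  let ?g = "[:g0, 0, g2, 0, g4, 0, g6:]"
  \<comment> \<open>Substituting x = r x1 and y = m y1 divides g(r x1) by m^2 = - g0, which makes
    the constant term -1; the choice of r makes the leading coefficient 1.\<close>
  obtain r where r: "r ^ 6 = - g0 / g6" using nth_root_exists[of 6 "- g0 / g6"] by auto
  obtain m where m: "m ^ 2 = - g0" using nth_root_exists[of 2 "- g0"] by auto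
  have r0: "r \<noteq> 0" using r g(1,2) by auto
  have m0: "m \<noteq> 0" using m g(1) by auto
  define s1 where "s1 = g4 * r ^ 4 / g0"
  define s2 where "s2 = - g2 * r ^ 2 / g0"
  define P where "P = [:- 1, 0, s2, 0, - s1, 0, 1:]"
  have degP: "Polynomial.degree P = 6" by (simp add: P_def)
  have bf: "even_sextic s1 s2 = binary_form P"
    by (intro ext) (simp add: even_sextic_def binary_form_def degP, simp add: P_def numeral_eq_Suc atMost_Suc algebra_simps)
  have g6r: "r ^ 6 * g6 = - g0" using r g(2) by simp
  have P_pc: "P = Polynomial.smult (- 1 / g0) (pcompose ?g (Polynomial.monom r (Suc 0)))"
  proof (rule poly_eqI)
    fix i :: nat
    consider "i = 0" | "i = 1" | "i = 2" | "i = 3" | "i = 4" | "i = 5" | "i = 6" | "6 < i" by linarith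
    then show "Polynomial.coeff P i = Polynomial.coeff (Polynomial.smult (- 1 / g0) (pcompose ?g (Polynomial.monom r (Suc 0)))) i"
      unfolding coeff_smult coeff_pcompose_monom_linear
      by cases (use g g6r in \<open>auto simp: P_def s1_def s2_def coeff_pCons numeral_eq_Suc split: nat.splits\<close>)
  qed
  have polyP: "poly P a = - 1 / g0 * poly ?g (r * a)" for a
    unfolding P_pc by (simp only: poly_smult poly_pcompose poly_monom power_Suc0_right)
  have "{a. poly P a = 0} = (\<lambda>a. a / r) ` {a. poly ?g a = 0}"
  proof (intro equalityI subsetI)
    fix a assume "a \<in> {a. poly P a = 0}"
    then have "poly ?g (r * a) = 0" unfolding polyP using g(1) by simp
    then show "a \<in> (\<lambda>a. a / r) ` {a. poly ?g a = 0}" using r0 by (intro image_eqI[of _ _ "r * a"]) auto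
  qed (use r0 polyP in auto)
  moreover have "card {a. poly ?g a = 0} = 6"
  proof -
    have "?g \<noteq> 0" using g(2) by simp
    from card_roots_squarefree[OF this] g show ?thesis by simp
  qed
  ultimately have card: "card {a. poly P a = 0} = 6"
    using r0 by (simp add: card_image inj_on_def)
  define x1 where "x1 = x / e r"
  define y1 where "y1 = y / e m"
  have xy: "x = e r * x1" "y = e m * y1" using r0 m0 by (auto simp: x1_def y1_def)
  have "x1 \<notin> range e"
    using const_scale[of "inverse r" x] r0 x_not_const by (simp add: x1_def e_inverse divide_inverse mult.commute)
  then have t: "transcendental_over e x1" by (rule transcendentalI)
  have eq: "y1 ^ 2 = ev P x1"
  proof -
    have "ev P x1 = e (- 1 / g0) * ev ?g (e r * x1)"
      unfolding P_pc by (simp only: ev_smult ev_pcompose ev_monom power_Suc0_right)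
    also have "\<dots> = e (inverse (m ^ 2)) * y ^ 2" unfolding y(3) xy(1)[symmetric] m by (simp add: divide_inverse)
    also have "\<dots> = y1 ^ 2" by (simp add: y1_def e_inverse e_power power_divide divide_inverse mult.commute power_mult_distrib power_inverse)
    finally show ?thesis ..
  qed
  have gen: "adjoin e {x1, y1} = UNIV"
  proof -
    have "w \<in> E" if E: "is_subfield E" "range e \<union> {x1, y1} \<subseteq> E" for w E
    proof -
      have sub: "e c \<in> E" "x1 \<in> E" "y1 \<in> E" for c using E(2) by auto
      have xyE: "x \<in> E" "y \<in> E" unfolding xy using sub by (auto intro: subfieldD(2)[OF E(1)])
      have evE: "ev p x \<in> E" for p
        by (induction p) (use sub xyE in \<open>auto intro: subfieldD(2,3)[OF E(1)] simp: sub(1)[of 0, simplified]\<close>)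
      have "ratl x \<subseteq> E" using evE by (auto simp: ratl_def intro: subfieldD(5)[OF E(1)])
      moreover obtain a b where "a \<in> ratl x" "b \<in> ratl x" "w = a + b * y"
        using generated_by_xy[OF y(1,2)] by metis
      ultimately show ?thesis using xyE subfieldD(2,3)[OF E(1)] by (metis subsetD)
    qed
    then show ?thesis unfolding adjoin_def hull_def by blast
  qed
  show ?thesis
    unfolding has_equation_def using bf degP card t eq gen by blast
qed

end

lemma klein_four_group_facts:
  fixes e :: "'k::field \<Rightarrow> 'f::field"
  assumes "Aut_group e \<cong> klein_four_group"
  shows "card {\<sigma>. field_automorphism \<sigma> \<and> (\<forall>c. \<sigma> (e c) = e c)} = 4"
    and "field_automorphism \<sigma> \<Longrightarrow> (\<And>c. \<sigma> (e c) = e c) \<Longrightarrow> \<sigma> (\<sigma> h) = h"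
proof -
  let ?A = "{\<sigma>. field_automorphism \<sigma> \<and> (\<forall>c. \<sigma> (e c) = e c)}"
  let ?G = "Aut_group e" and ?V = klein_four_group
  obtain f where f: "f \<in> hom ?G ?V" "bij_betw f (carrier ?G) (carrier ?V)"
    using assms by (auto simp: is_iso_def iso_def)
  have A: "carrier ?G = ?A" by (simp add: Aut_group_def)
  have V: "carrier ?V = {0..<2} \<times> {0..<2}"
    by (simp add: klein_four_group_def DirProd_def carrier_integer_mod_group)
  show "card ?A = 4" using bij_betw_same_card[OF f(2)] unfolding A V by simp
  have mult: "f (\<sigma> \<circ> \<tau>) = f \<sigma> \<otimes>\<^bsub>?V\<^esub> f \<tau>" if "\<sigma> \<in> ?A" "\<tau> \<in> ?A" for \<sigma> \<tau>
    using hom_mult[OF f(1)] that by (simp add: Aut_group_def)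
  have sq: "a \<otimes>\<^bsub>?V\<^esub> a = (0, 0)" for a
    by (cases a) (simp add: klein_four_group_def DirProd_def flip: mult_2)
  have idA: "id \<in> ?A" by (simp add: field_automorphism_def field_embedding_def)
  assume "field_automorphism \<sigma>" "\<And>c. \<sigma> (e c) = e c"
  then have s: "\<sigma> \<in> ?A" by simp
  then have ss: "\<sigma> \<circ> \<sigma> \<in> ?A"
    by (auto simp: field_automorphism_def field_embedding_def intro: bij_comp)
  \<comment> \<open>Squares are trivial in the Klein group, so \<sigma>\<sigma> and the square of
    the identity have the same image; injectivity of \<open>f\<close> then identifies them without
    computing the image of the identity.\<close>
  have "f (\<sigma> \<circ> \<sigma>) = f (id \<circ> id)" using mult[OF s s] mult[OF idA idA] sq by simp
  then have "\<sigma> \<circ> \<sigma> = id"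
    using f(2) ss idA unfolding A bij_betw_def inj_on_def by simp
  then show "\<sigma> (\<sigma> h) = h" by (metis comp_apply id_apply)
qed

text \<open>Two functions of degree two occur: the first only serves to find an automorphism that
  moves it, and the equation is derived for the Moebius transform that this automorphism
  negates.\<close>

theorem V4_even_equation:
  fixes e :: "'k::alg_closed_field \<Rightarrow> 'f::field"
  assumes "(2 :: 'k) \<noteq> 0" "function_field e" "has_genus e 2" "Aut_group e \<cong> klein_four_group"
  shows "\<exists>s1 s2. has_equation e (even_sextic s1 s2)"
proof -
  interpret genus_two_curve e
    using assms(2,3) by unfold_locales (auto simp: function_field_def)
  obtain x where x: "degree_two x" using degree_two_exists by blast
  interpret X: curve_degree_two e x
    using x assms(1) by unfold_locales
  have "\<exists>\<sigma>. field_automorphism \<sigma> \<and> (\<forall>c. \<sigma> (e c) = e c) \<and> \<sigma> x \<noteq> x"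
    using X.automorphisms_fixing_x klein_four_group_facts(1)[OF assms(4)] by fastforce
  then obtain \<sigma> where \<sigma>: "involution \<sigma>" "\<sigma> x \<noteq> x"
    using klein_four_group_facts(2)[OF assms(4)] by (auto simp: involution_def)
  obtain x' where x': "degree_two x'" "\<sigma> x' = - x'"
    using X.anti_invariant_degree_two[OF \<sigma>] by blast
  interpret Y: curve_degree_two e x'
    using x' assms(1) by unfold_locales
  show ?thesis using Y.has_even_equation[OF \<sigma>(1) x'(2)] .
qed

section \<open>The Julia quadratic of an even sextic\<close>

text \<open>Entries indexed by \<open>U\<close> count twice because a conjugate pair of roots shares
  one parameter. With c the mean, the bounds a / c \<le> exp (a / c - 1) are multiplied; their
  exponents add up to 0.\<close>

lemma weighted_am_gm:
  fixes x :: "'a \<Rightarrow> real" and y :: "'b \<Rightarrow> real"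
  assumes "finite R" "finite U" "card R + 2 * card U = n" "0 < n"
    and x: "\<And>i. i \<in> R \<Longrightarrow> 0 < x i" and y: "\<And>j. j \<in> U \<Longrightarrow> 0 < y j"
  shows "prod x R * (prod y U)\<^sup>2 * real n ^ n \<le> (sum x R + 2 * sum y U) ^ n"
proof -
  define c where "c = (sum x R + 2 * sum y U) / real n"
  have S0: "0 \<le> sum x R" "0 \<le> sum y U" using x y by (simp_all add: sum_nonneg less_imp_le)
  have S: "0 < sum x R + 2 * sum y U"
  proof (cases "R = {}")
    case True
    then have "U \<noteq> {}" using assms(3,4) by auto
    then show ?thesis using sum_pos[OF assms(2) _ y] S0 by fastforce
  next
    case False
    then show ?thesis using sum_pos[OF assms(1) _ x] S0 by fastforce
  qed
  then have c: "0 < c" using assms(4) by (simp add: c_def)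
  have le: "a / c \<le> exp (a / c - 1)" for a using exp_ge_add_one_self[of "a / c - 1"] by simp
  have "prod x R / c ^ card R * (prod y U / c ^ card U)\<^sup>2 = (\<Prod>i\<in>R. x i / c) * (\<Prod>j\<in>U. y j / c)\<^sup>2"
    by (simp add: prod_dividef)
  also have "\<dots> \<le> (\<Prod>i\<in>R. exp (x i / c - 1)) * (\<Prod>j\<in>U. exp (y j / c - 1))\<^sup>2"
    using x y c le by (intro mult_mono power_mono prod_mono) (auto intro!: prod_nonneg simp: less_imp_le)
  also have "\<dots> = exp ((\<Sum>i\<in>R. x i / c - 1) + 2 * (\<Sum>j\<in>U. y j / c - 1))"
    unfolding exp_sum[OF assms(1), symmetric] exp_sum[OF assms(2), symmetric]
    by (simp only: exp_add mult_2 power2_eq_square)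
  also have "(\<Sum>i\<in>R. x i / c - 1) + 2 * (\<Sum>j\<in>U. y j / c - 1) = (sum x R + 2 * sum y U) / c - real (card R + 2 * card U)"
    by (simp add: sum_subtractf add_divide_distrib algebra_simps flip: sum_divide_distrib)
  also have "\<dots> = 0" using S assms(3,4) by (simp add: c_def)
  finally have "prod x R / c ^ card R * (prod y U / c ^ card U)\<^sup>2 \<le> 1" by simp
  then have "prod x R * (prod y U)\<^sup>2 \<le> c ^ card R * (c ^ card U)\<^sup>2"
    using c by (simp add: power_divide divide_le_eq)
  also have "c ^ card R * (c ^ card U)\<^sup>2 = c ^ n"
    using assms(3) by (metis power_add power_mult mult.commute)
  also have "\<dots> = (sum x R + 2 * sum y U) ^ n / real n ^ n" by (simp add: c_def power_divide)
  finally show ?thesis using assms(4) by (simp add: pos_le_divide_eq)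
qed

lemma sum_quadratic:
  fixes w b c :: "'a \<Rightarrow> real"
  shows "(\<Sum>z\<in>S. w z * (a + b z * s + c z)) =
    (\<Sum>z\<in>S. w z) * a + (\<Sum>z\<in>S. w z * b z) * s + (\<Sum>z\<in>S. w z * c z)"
  by (simp add: distrib_left sum.distrib sum_distrib_right mult.assoc)

section \<open>The function theta0 of a real sextic and its minimum\<close>

locale real_sextic =
  fixes p :: "real poly"
  assumes degree: "Polynomial.degree p = 6"
    and distinct_roots: "card {z. poly (map_poly complex_of_real p) z = 0} = 6"
begin

definition Z :: "complex set" where "Z = {z. poly (map_poly complex_of_real p) z = 0}"

abbreviation "R \<equiv> real_roots p"
abbreviation "U \<equiv> upper_roots p"

lemma card_Z: "card Z = 6" and finite_Z: "finite Z"
  using distinct_roots by (auto simp: Z_def intro: card_ge_0_finite)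

lemma poly_complex_of_real: "poly (map_poly complex_of_real q) (complex_of_real a) = complex_of_real (poly q a)"
  by (induction q) (auto simp: map_poly_pCons)

lemma cnj_Z: "cnj z \<in> Z \<longleftrightarrow> z \<in> Z"
proof -
  have "poly (map_poly complex_of_real q) (cnj z) = cnj (poly (map_poly complex_of_real q) z)" for q z
    by (induction q) (auto simp: map_poly_pCons)
  then show ?thesis by (simp add: Z_def)
qed

lemma Z_split: "Z = complex_of_real ` R \<union> U \<union> cnj ` U"
proof (intro equalityI subsetI)
  fix z assume z: "z \<in> Z"
  consider "Im z = 0" | "0 < Im z" | "0 < Im (cnj z)" by fastforce
  then show "z \<in> complex_of_real ` R \<union> U \<union> cnj ` U"
  proof cases
    case 1
    then have "z = complex_of_real (Re z)" by (simp add: complex_eq_iff)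
    then show ?thesis using z poly_complex_of_real by (metis (mono_tags, lifting) UnI1 Z_def image_eqI mem_Collect_eq of_real_eq_0_iff real_roots_def)
  next
    case 2
    then show ?thesis using z by (auto simp: upper_roots_def Z_def)
  next
    case 3
    then have "cnj z \<in> U" using z cnj_Z[of z] by (auto simp: upper_roots_def Z_def)
    then show ?thesis by (metis UnI2 complex_cnj_cnj imageI)
  qed
next
  fix z assume "z \<in> complex_of_real ` R \<union> U \<union> cnj ` U"
  moreover have "U \<subseteq> Z" "complex_of_real ` R \<subseteq> Z"
    by (auto simp: upper_roots_def real_roots_def Z_def poly_complex_of_real)
  ultimately show "z \<in> Z" using cnj_Z by auto
qed

lemma finite_R: "finite R" and finite_U: "finite U"
  using finite_Z unfolding Z_split by (auto dest!: finite_imageD simp: inj_on_def)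

lemma disjoint: "complex_of_real ` R \<inter> U = {}" "(complex_of_real ` R \<union> U) \<inter> cnj ` U = {}"
  by (auto simp: upper_roots_def complex_eq_iff)

lemma prod_Z:
  fixes f :: "complex \<Rightarrow> real"
  assumes "\<And>z. f (cnj z) = f z"
  shows "prod f Z = (\<Prod>\<alpha>\<in>R. f (complex_of_real \<alpha>)) * (\<Prod>\<beta>\<in>U. f \<beta>)\<^sup>2"
proof -
  have "prod f Z = prod f (complex_of_real ` R) * prod f U * prod f (cnj ` U)"
    unfolding Z_split using finite_R finite_U disjoint by (simp add: prod.union_disjoint)
  moreover have "prod f (complex_of_real ` R) = (\<Prod>\<alpha>\<in>R. f (complex_of_real \<alpha>))"
    by (subst prod.reindex) (auto simp: inj_on_def)
  moreover have "prod f (cnj ` U) = (\<Prod>\<beta>\<in>U. f \<beta>)"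
    using assms by (subst prod.reindex) (auto simp: inj_on_def)
  ultimately show ?thesis by (simp add: power2_eq_square mult.assoc)
qed

lemma card_RU: "card R + 2 * card U = 6"
proof -
  have "card Z = card (complex_of_real ` R) + card U + card (cnj ` U)"
    unfolding Z_split using finite_R finite_U disjoint by (subst card_Un_disjoint; simp add: card_Un_disjoint)
  then show ?thesis using card_Z by (simp add: card_image inj_on_def)
qed

text \<open>For real z this is |s + i h - z|^2; in general it is the mean of the squared distances
  of s + i h from z and from its conjugate.\<close>

definition G :: "real \<Rightarrow> real \<Rightarrow> complex \<Rightarrow> real" where
  "G s h z = (s - Re z)\<^sup>2 + (Im z)\<^sup>2 + h\<^sup>2"

definition \<Phi> :: "real \<Rightarrow> real \<Rightarrow> real" where
  "\<Phi> s h = prod (G s h) Z / h ^ 6"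

definition qA where "qA t u = (\<Sum>\<alpha>\<in>R. (t \<alpha>)\<^sup>2) + (\<Sum>\<beta>\<in>U. 2 * (u \<beta>)\<^sup>2)"
definition qB where "qB t u = (\<Sum>\<alpha>\<in>R. (t \<alpha>)\<^sup>2 * (- 2 * \<alpha>)) + (\<Sum>\<beta>\<in>U. 2 * (u \<beta>)\<^sup>2 * (- 2 * Re \<beta>))"
definition qC where "qC t u = (\<Sum>\<alpha>\<in>R. (t \<alpha>)\<^sup>2 * \<alpha>\<^sup>2) + (\<Sum>\<beta>\<in>U. 2 * (u \<beta>)\<^sup>2 * (cmod \<beta>)\<^sup>2)"
definition \<Delta> where "\<Delta> t u = 4 * qA t u * qC t u - (qB t u)\<^sup>2"
text \<open>The sum to which the arithmetic-geometric mean inequality is applied. By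
  \<open>E_eq\<close> it is the Hermitian form belonging to Q, evaluated at s + i h.\<close>

definition E where "E t u s h = (\<Sum>\<alpha>\<in>R. (t \<alpha>)\<^sup>2 * G s h (complex_of_real \<alpha>)) + 2 * (\<Sum>\<beta>\<in>U. (u \<beta>)\<^sup>2 * G s h \<beta>)"

lemma G_pos: "0 < h \<Longrightarrow> 0 < G s h z"
  unfolding G_def by (intro add_nonneg_pos) auto

lemma G_cnj: "G s h (cnj z) = G s h z"
  by (simp add: G_def)

lemma \<Phi>_split: "\<Phi> s h * h ^ 6 = (\<Prod>\<alpha>\<in>R. G s h (complex_of_real \<alpha>)) * (\<Prod>\<beta>\<in>U. G s h \<beta>)\<^sup>2" if "0 < h"
  using that prod_Z[of "G s h"] by (simp add: \<Phi>_def G_cnj)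

lemma Q_form_eq: "Q_form p t u = [:qC t u, qB t u, qA t u:]"
proof (rule poly_eqI)
  fix i :: nat
  have sq: "[:- \<alpha>, 1:] ^ 2 = [:\<alpha>\<^sup>2, - 2 * \<alpha>, 1:]" for \<alpha> :: real
    by (simp add: power2_eq_square)
  consider "i = 0" | "i = 1" | "i = 2" | "2 < i" by linarith
  then show "Polynomial.coeff (Q_form p t u) i = Polynomial.coeff [:qC t u, qB t u, qA t u:] i"
    by cases (auto simp: Q_form_def sq coeff_sum qA_def qB_def qC_def coeff_pCons numeral_eq_Suc split: nat.splits)
qed

lemma E_eq: "E t u s h = qA t u * (s\<^sup>2 + h\<^sup>2) + qB t u * s + qC t u"
proof -
  have G: "G s h z = (s\<^sup>2 + h\<^sup>2) + (- 2 * Re z) * s + (cmod z)\<^sup>2" for z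
    unfolding G_def cmod_power2 by (simp add: power2_eq_square algebra_simps)
  have "2 * (\<Sum>\<beta>\<in>U. (u \<beta>)\<^sup>2 * G s h \<beta>) = (\<Sum>\<beta>\<in>U. 2 * (u \<beta>)\<^sup>2 * G s h \<beta>)"
    by (simp add: sum_distrib_left mult.assoc)
  then show ?thesis
    unfolding E_def qA_def qB_def qC_def G sum_quadratic by (simp add: algebra_simps)
qed

text \<open>For h = 0 the sum \<open>E\<close> is Q(s, 1), positive for every real s because a
  non-real root, or a real root other than s, contributes a positive term. Evaluated at the vertex
  of the parabola it gives the sign of the discriminant.\<close>

lemma discriminant_positive:
  assumes adm: "admissible p t u"
  shows "0 < qA t u" "0 < \<Delta> t u"
proof -
  have t0: "0 < (t \<alpha>)\<^sup>2" if "\<alpha> \<in> R" for \<alpha> using adm that by (simp add: admissible_def)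
  have u0: "0 < (u \<beta>)\<^sup>2" if "\<beta> \<in> U" for \<beta> using adm that by (simp add: admissible_def)
  have pos: "0 < E t u s 0" for s
  proof (cases "U = {}")
    case True
    then have "card R = 6" using card_RU by simp
    moreover have "card R \<le> 1" if "R \<subseteq> {s}" using card_mono[OF _ that] by simp
    ultimately obtain \<alpha> where \<alpha>: "\<alpha> \<in> R" "\<alpha> \<noteq> s" by fastforce
    have "0 < (\<Sum>\<alpha>\<in>R. (t \<alpha>)\<^sup>2 * G s 0 (complex_of_real \<alpha>))"
      using \<alpha> t0[OF \<alpha>(1)] by (intro sum_pos2[OF finite_R \<alpha>(1)]) (auto simp: G_def)
    then show ?thesis using True by (simp add: E_def)
  next
    case False
    have "0 < (u \<beta>)\<^sup>2 * G s 0 \<beta>" if "\<beta> \<in> U" for \<beta>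
      using u0[OF that] that by (intro mult_pos_pos) (auto simp: G_def upper_roots_def intro!: add_nonneg_pos)
    then have "0 < (\<Sum>\<beta>\<in>U. (u \<beta>)\<^sup>2 * G s 0 \<beta>)"
      using False finite_U by (intro sum_pos) auto
    moreover have "0 \<le> (\<Sum>\<alpha>\<in>R. (t \<alpha>)\<^sup>2 * G s 0 (complex_of_real \<alpha>))"
      by (intro sum_nonneg) (auto simp: G_def)
    ultimately show ?thesis by (simp add: E_def)
  qed
  show A: "0 < qA t u"
  proof (cases "R = {}")
    case True
    then have "U \<noteq> {}" using card_RU by auto
    then have "0 < (\<Sum>\<beta>\<in>U. 2 * (u \<beta>)\<^sup>2)" using u0 finite_U by (intro sum_pos) auto
    then show ?thesis using True by (simp add: qA_def)
  next
    case False
    then have "0 < (\<Sum>\<alpha>\<in>R. (t \<alpha>)\<^sup>2)" using t0 finite_R by (intro sum_pos) auto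
    moreover have "0 \<le> (\<Sum>\<beta>\<in>U. 2 * (u \<beta>)\<^sup>2)" by (intro sum_nonneg) auto
    ultimately show ?thesis by (simp add: qA_def)
  qed
  define s where "s = - qB t u / (2 * qA t u)"
  have s: "2 * qA t u * s = - qB t u" using A by (simp add: s_def)
  have "0 < 4 * qA t u * E t u s 0" using A pos by simp
  also have "4 * qA t u * E t u s 0 = (2 * qA t u * s) ^ 2 + 2 * qB t u * (2 * qA t u * s) + 4 * qA t u * qC t u"
    by (simp add: E_eq power2_eq_square algebra_simps)
  also have "\<dots> = \<Delta> t u" unfolding s \<Delta>_def by (simp add: power2_eq_square)
  finally show "0 < \<Delta> t u" .
qed

lemma theta0_eq:
  assumes adm: "admissible p t u"
  shows "theta0 p t u = (Polynomial.lead_coeff p)\<^sup>2 * \<Delta> t u ^ 3 / ((\<Prod>\<alpha>\<in>R. (t \<alpha>)\<^sup>2) * (\<Prod>\<beta>\<in>U. (u \<beta>)\<^sup>2)\<^sup>2)"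
proof -
  have "\<bar>quadratic_discriminant (Q_form p t u)\<bar> = \<Delta> t u"
    using discriminant_positive(2)[OF adm]
    by (simp add: quadratic_discriminant_def Q_form_eq \<Delta>_def numeral_eq_Suc algebra_simps)
  moreover have "\<Delta> t u powr (real (Polynomial.degree p) / 2) = \<Delta> t u ^ 3"
    using discriminant_positive(2)[OF adm] by (simp add: degree powr_numeral)
  moreover have "(\<Prod>\<beta>\<in>U. u \<beta> ^ 4) = (\<Prod>\<beta>\<in>U. (u \<beta>)\<^sup>2)\<^sup>2"
    by (simp add: prod_power_distrib flip: power_mult)
  ultimately show ?thesis by (simp add: theta0_def)
qed

text \<open>The last two terms are the squared real and imaginary parts of Q(s + i h, 1), so this
  reads E^2 = h^2 \<Delta> + |Q|^2.\<close>

lemma E_square: "(E t u s h)\<^sup>2 = h\<^sup>2 * \<Delta> t u + (qA t u * s\<^sup>2 + qB t u * s + qC t u - qA t u * h\<^sup>2)\<^sup>2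
    + h\<^sup>2 * (2 * qA t u * s + qB t u)\<^sup>2"
  unfolding E_eq \<Delta>_def by (simp add: power2_eq_square algebra_simps)

lemma root_iff:
  assumes "0 < Im \<tau>"
  shows "poly (map_poly complex_of_real (Q_form p t u)) \<tau> = 0 \<longleftrightarrow>
    qA t u * (Re \<tau>)\<^sup>2 + qB t u * Re \<tau> + qC t u - qA t u * (Im \<tau>)\<^sup>2 = 0 \<and> 2 * qA t u * Re \<tau> + qB t u = 0"
proof -
  have "poly (map_poly complex_of_real (Q_form p t u)) \<tau> =
      Complex (qA t u * (Re \<tau>)\<^sup>2 + qB t u * Re \<tau> + qC t u - qA t u * (Im \<tau>)\<^sup>2) (Im \<tau> * (2 * qA t u * Re \<tau> + qB t u))"
    by (simp add: Q_form_eq map_poly_pCons complex_eq_iff power2_eq_square algebra_simps)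
  then show ?thesis using assms by (simp add: complex_eq_iff)
qed

lemma root_exists:
  assumes "admissible p t u"
  obtains \<tau> where "0 < Im \<tau>" "poly (map_poly complex_of_real (Q_form p t u)) \<tau> = 0"
proof -
  note pos = discriminant_positive[OF assms]
  define \<tau> where "\<tau> = Complex (- qB t u / (2 * qA t u)) (sqrt (\<Delta> t u) / (2 * qA t u))"
  have im: "0 < Im \<tau>" using pos by (simp add: \<tau>_def)
  have s: "2 * qA t u * Re \<tau> = - qB t u" using pos by (simp add: \<tau>_def)
  have h: "(2 * qA t u * Im \<tau>)\<^sup>2 = \<Delta> t u" using pos by (simp add: \<tau>_def)
  have "4 * qA t u * (qA t u * (Re \<tau>)\<^sup>2 + qB t u * Re \<tau> + qC t u - qA t u * (Im \<tau>)\<^sup>2)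
    = (2 * qA t u * Re \<tau>)\<^sup>2 + 2 * qB t u * (2 * qA t u * Re \<tau>) + 4 * qA t u * qC t u - (2 * qA t u * Im \<tau>)\<^sup>2"
    by (simp add: power2_eq_square algebra_simps)
  also have "\<dots> = 0" unfolding s h \<Delta>_def by (simp add: power2_eq_square)
  finally have "poly (map_poly complex_of_real (Q_form p t u)) \<tau> = 0"
    unfolding root_iff[OF im] using pos s by simp
  then show ?thesis using that im by blast
qed

text \<open>At the root of Q in the upper half-plane E^2 = h^2 \<Delta>, so \<Delta>^3 = E^6 / h^6,
  and the mean inequality bounds E^6 below by 6^6 times the product of its terms. The parameters
  cancel against the denominator of theta0.\<close>

lemma theta0_ge:
  assumes adm: "admissible p t u" and im: "0 < Im \<tau>"
    and root: "poly (map_poly complex_of_real (Q_form p t u)) \<tau> = 0"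
  shows "(Polynomial.lead_coeff p)\<^sup>2 * 6 ^ 6 * \<Phi> (Re \<tau>) (Im \<tau>) \<le> theta0 p t u"
proof -
  define s h where "s = Re \<tau>" and "h = Im \<tau>"
  have h: "0 < h" using im by (simp add: h_def)
  define T where "T = (\<Prod>\<alpha>\<in>R. (t \<alpha>)\<^sup>2) * (\<Prod>\<beta>\<in>U. (u \<beta>)\<^sup>2)\<^sup>2"
  have "0 < (\<Prod>\<alpha>\<in>R. (t \<alpha>)\<^sup>2)" "0 < (\<Prod>\<beta>\<in>U. (u \<beta>)\<^sup>2)"
    using adm by (auto simp: admissible_def intro: prod_pos)
  then have T: "0 < T" unfolding T_def by simp
  have "(E t u s h)\<^sup>2 = h\<^sup>2 * \<Delta> t u"
    using root unfolding root_iff[OF im] E_square s_def h_def by simp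
  then have "((E t u s h)\<^sup>2) ^ 3 = (h\<^sup>2 * \<Delta> t u) ^ 3" by simp
  then have E6: "E t u s h ^ 6 = h ^ 6 * \<Delta> t u ^ 3"
    by (simp add: power_mult_distrib flip: power_mult)
  have "(\<Prod>\<alpha>\<in>R. (t \<alpha>)\<^sup>2 * G s h (complex_of_real \<alpha>)) * (\<Prod>\<beta>\<in>U. (u \<beta>)\<^sup>2 * G s h \<beta>)\<^sup>2 * real 6 ^ 6 \<le> E t u s h ^ 6"
    unfolding E_def using adm card_RU G_pos[OF h]
    by (intro weighted_am_gm finite_R finite_U) (auto simp: admissible_def)
  also have "(\<Prod>\<alpha>\<in>R. (t \<alpha>)\<^sup>2 * G s h (complex_of_real \<alpha>)) * (\<Prod>\<beta>\<in>U. (u \<beta>)\<^sup>2 * G s h \<beta>)\<^sup>2 = T * (\<Phi> s h * h ^ 6)"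
    unfolding \<Phi>_split[OF h] T_def by (simp add: prod.distrib power_mult_distrib mult_ac)
  finally have "(\<Phi> s h * 6 ^ 6 * T) * h ^ 6 \<le> \<Delta> t u ^ 3 * h ^ 6" by (simp add: E6 mult_ac)
  then have "\<Phi> s h * 6 ^ 6 * T \<le> \<Delta> t u ^ 3" by (rule mult_right_le_imp_le) (use h in simp)
  then have "\<Phi> s h * 6 ^ 6 \<le> \<Delta> t u ^ 3 / T" using T by (simp add: pos_le_divide_eq)
  then have "(Polynomial.lead_coeff p)\<^sup>2 * (\<Phi> s h * 6 ^ 6) \<le> (Polynomial.lead_coeff p)\<^sup>2 * (\<Delta> t u ^ 3 / T)"
    by (rule mult_left_mono) simp
  then show ?thesis unfolding theta0_eq[OF adm] T_def s_def h_def by (simp add: mult_ac)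
qed

text \<open>The weights 1 / G make all six terms of \<open>E\<close> equal to 1. The point s + i h
  need not be the root of the resulting form: \<open>E_square\<close> gives h^2 \<Delta> \<le> E^2 =
  36, which is the direction wanted.\<close>

lemma theta0_le:
  assumes h: "0 < h"
  obtains t u where "admissible p t u" "theta0 p t u \<le> (Polynomial.lead_coeff p)\<^sup>2 * 6 ^ 6 * \<Phi> s h"
proof -
  define t where "t \<alpha> = 1 / sqrt (G s h (complex_of_real \<alpha>))" for \<alpha>
  define u where "u \<beta> = 1 / sqrt (G s h \<beta>)" for \<beta>
  have G0: "G s h z \<noteq> 0" "0 \<le> G s h z" for z using G_pos[OF h, of s z] by auto
  have adm: "admissible p t u" using G0 by (simp add: admissible_def t_def u_def)
  have t2: "(t \<alpha>)\<^sup>2 = 1 / G s h (complex_of_real \<alpha>)" and u2: "(u \<beta>)\<^sup>2 = 1 / G s h \<beta>" for \<alpha> \<beta>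
    using G0 by (auto simp: t_def u_def power_divide)
  have "E t u s h = real (card R + 2 * card U)"
    using G0 by (simp add: E_def t2 u2)
  also have "\<dots> = 6" unfolding card_RU by simp
  finally have "(E t u s h)\<^sup>2 = 36" by simp
  moreover have "0 \<le> h\<^sup>2 * (2 * qA t u * s + qB t u)\<^sup>2" by simp
  ultimately have "h\<^sup>2 * \<Delta> t u \<le> 36"
    using E_square[of t u s h] zero_le_power2[of "qA t u * s\<^sup>2 + qB t u * s + qC t u - qA t u * h\<^sup>2"] by linarith
  then have "(h\<^sup>2 * \<Delta> t u) ^ 3 \<le> 36 ^ 3"
    using discriminant_positive(2)[OF adm] by (intro power_mono) auto
  then have D: "\<Delta> t u ^ 3 \<le> 6 ^ 6 / h ^ 6"
    using h by (simp add: power_mult_distrib pos_le_divide_eq mult.commute flip: power_mult)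
  have T: "(\<Prod>\<alpha>\<in>R. (t \<alpha>)\<^sup>2) * (\<Prod>\<beta>\<in>U. (u \<beta>)\<^sup>2)\<^sup>2 = 1 / (\<Phi> s h * h ^ 6)"
    unfolding \<Phi>_split[OF h] t2 u2 by (simp add: prod_dividef power_divide)
  have \<Phi>: "0 < \<Phi> s h * h ^ 6"
    unfolding \<Phi>_split[OF h] using G_pos[OF h] by (intro mult_pos_pos zero_less_power prod_pos) auto
  have "theta0 p t u = (Polynomial.lead_coeff p)\<^sup>2 * \<Delta> t u ^ 3 * (\<Phi> s h * h ^ 6)"
    unfolding theta0_eq[OF adm] T by simp
  also have "\<dots> \<le> (Polynomial.lead_coeff p)\<^sup>2 * (6 ^ 6 / h ^ 6) * (\<Phi> s h * h ^ 6)"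
    using D \<Phi> by (intro mult_right_mono mult_left_mono) auto
  also have "\<dots> = (Polynomial.lead_coeff p)\<^sup>2 * 6 ^ 6 * \<Phi> s h" using h by simp
  finally show ?thesis using that[OF adm] by blast
qed

text \<open>The quadratic form with weights \<open>1 / G\<close> attains the bound of the arithmetic-geometric mean
  inequality, so the roots of Julia quadratics are the minima of \<open>\<Phi>\<close>.\<close>

lemma julia_zeta_eq:
  assumes im: "0 < Im \<tau>"
    and min: "\<And>s h. 0 < h \<Longrightarrow> \<Phi> (Re \<tau>) (Im \<tau>) \<le> \<Phi> s h"
    and unique: "\<And>s h. 0 < h \<Longrightarrow> \<Phi> s h \<le> \<Phi> (Re \<tau>) (Im \<tau>) \<Longrightarrow> s = Re \<tau> \<and> h = Im \<tau>"
  shows "julia_zeta p = \<tau>"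
proof -
  define c where "c = (Polynomial.lead_coeff p)\<^sup>2 * 6 ^ 6"
  have "Polynomial.lead_coeff p \<noteq> 0"
    using degree by (metis degree_0 leading_coeff_0_iff zero_neq_numeral)
  then have c: "0 < c" by (simp add: c_def)
  have ge: "c * \<Phi> (Re \<tau>) (Im \<tau>) \<le> theta0 p t u" if adm: "admissible p t u" for t u
  proof -
    obtain \<rho> where \<rho>: "0 < Im \<rho>" "poly (map_poly complex_of_real (Q_form p t u)) \<rho> = 0"
      using root_exists[OF adm] .
    have "c * \<Phi> (Re \<tau>) (Im \<tau>) \<le> c * \<Phi> (Re \<rho>) (Im \<rho>)" using min[OF \<rho>(1)] c by simp
    also have "\<dots> \<le> theta0 p t u" unfolding c_def by (rule theta0_ge[OF adm \<rho>])
    finally show ?thesis .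
  qed
  obtain t u where tu: "admissible p t u" "theta0 p t u \<le> c * \<Phi> (Re \<tau>) (Im \<tau>)"
    using theta0_le[OF im, of "Re \<tau>"] unfolding c_def by metis
  have root_eq: "\<rho> = \<tau>"
    if "admissible p t' u'" "theta0 p t' u' \<le> c * \<Phi> (Re \<tau>) (Im \<tau>)" "0 < Im \<rho>"
      "poly (map_poly complex_of_real (Q_form p t' u')) \<rho> = 0" for t' u' \<rho>
  proof -
    have "c * \<Phi> (Re \<rho>) (Im \<rho>) \<le> c * \<Phi> (Re \<tau>) (Im \<tau>)"
      using theta0_ge[OF that(1,3,4)] that(2) unfolding c_def by linarith
    then have "\<Phi> (Re \<rho>) (Im \<rho>) \<le> \<Phi> (Re \<tau>) (Im \<tau>)" using c by simp
    then show ?thesis using unique[OF that(3)] by (simp add: complex_eq_iff)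
  qed
  have julia: "is_julia_quadratic p (Q_form p t u)"
    unfolding is_julia_quadratic_def using tu ge
    by (intro exI[of _ t] exI[of _ u]) (auto intro: order_trans)
  show ?thesis
    unfolding julia_zeta_def
  proof (rule the_equality)
    obtain \<rho> where "0 < Im \<rho>" "poly (map_poly complex_of_real (Q_form p t u)) \<rho> = 0"
      using root_exists[OF tu(1)] .
    then show "0 < Im \<tau> \<and> (\<exists>J. is_julia_quadratic p J \<and> poly (map_poly complex_of_real J) \<tau> = 0)"
      using root_eq[OF tu] julia by blast
  next
    fix \<rho> assume "0 < Im \<rho> \<and> (\<exists>J. is_julia_quadratic p J \<and> poly (map_poly complex_of_real J) \<rho> = 0)"
    then obtain t' u' where r: "0 < Im \<rho>" "admissible p t' u'" "theta0 p t' u' \<le> theta0 p t u"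
      "poly (map_poly complex_of_real (Q_form p t' u')) \<rho> = 0"
      using tu(1) unfolding is_julia_quadratic_def by blast
    then show "\<rho> = \<tau>" using root_eq[OF r(2) _ r(1,4)] tu(2) by linarith
  qed
qed

end


text \<open>The restriction of \<Phi> to the imaginary axis, where only the absolute values of the
  roots matter.\<close>

definition axis_prod :: "complex set \<Rightarrow> real \<Rightarrow> real" where
  "axis_prod S r = (\<Prod>z\<in>S. r + (cmod z)\<^sup>2 / r)"

lemma axis_prod_pos: "0 < r \<Longrightarrow> 0 < axis_prod S r"
  unfolding axis_prod_def by (intro prod_pos) (auto intro: add_pos_nonneg)

text \<open>Strict convexity in \<open>ln r\<close>.\<close>

lemma axis_prod_sqrt_less:
  assumes S: "finite S" "S \<noteq> {}" "0 \<notin> S" and r: "0 < r" "0 < r'" "r \<noteq> r'"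
  shows "(axis_prod S (sqrt (r * r')))\<^sup>2 < axis_prod S r * axis_prod S r'"
proof -
  define m where "m = sqrt (r * r')"
  have m: "0 < m" "m\<^sup>2 = r * r'" using r by (auto simp: m_def)
  have "(m + k / m)\<^sup>2 < (r + k / r) * (r' + k / r')" if k: "0 < k" for k
  proof -
    have eq: "a + k / a = (a * a + k) / a" if "0 < a" for a
      using that by (simp add: add_divide_distrib)
    \<comment> \<open>This is the defect in the Cauchy-Schwarz inequality for (r, sqrt k) and (r',
      sqrt k), so strictness comes from r \<noteq> r'.\<close>
    have "0 < k * (r - r')\<^sup>2" using k r by simp
    also have "\<dots> = (r * r + k) * (r' * r' + k) - (r * r' + k)\<^sup>2"
      by (simp add: power2_eq_square algebra_simps)
    finally have "(r * r' + k)\<^sup>2 / (r * r') < (r * r + k) * (r' * r' + k) / (r * r')"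
      using r by (intro divide_strict_right_mono) auto
    moreover have "(m + k / m)\<^sup>2 = (r * r' + k)\<^sup>2 / (r * r')"
      unfolding eq[OF m(1)] power_divide m(2) power2_eq_square[of m, symmetric] ..
    ultimately show ?thesis unfolding eq[OF r(1)] eq[OF r(2)] by simp
  qed
  then have less: "(m + (cmod z)\<^sup>2 / m)\<^sup>2 < (r + (cmod z)\<^sup>2 / r) * (r' + (cmod z)\<^sup>2 / r')" if "z \<in> S" for z
    using that S(3) by (metis zero_less_norm_iff zero_less_power)
  obtain w where "w \<in> S" using S(2) by blast
  then have "(\<Prod>z\<in>S. (m + (cmod z)\<^sup>2 / m)\<^sup>2) < (\<Prod>z\<in>S. (r + (cmod z)\<^sup>2 / r) * (r' + (cmod z)\<^sup>2 / r'))"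
    using S(1) less r by (intro prod_mono_strict[of w]) (auto intro: less_imp_le intro!: mult_pos_pos add_pos_nonneg)
  then show ?thesis by (simp add: axis_prod_def m_def prod.distrib prod_power_distrib)
qed

text \<open>The geometric mean of two distinct minimisers would give a smaller value.\<close>

lemma axis_prod_min_unique:
  assumes S: "finite S" "S \<noteq> {}" "0 \<notin> S" and r: "0 < r" "0 < r'"
    and min: "\<And>q. 0 < q \<Longrightarrow> axis_prod S r \<le> axis_prod S q"
    and le: "axis_prod S r' \<le> axis_prod S r"
  shows "r = r'"
proof (rule ccontr)
  assume "r \<noteq> r'"
  define m where "m = sqrt (r * r')"
  have "0 < m" using r by (simp add: m_def)
  then have "axis_prod S r * axis_prod S r \<le> axis_prod S m * axis_prod S m"
    using min axis_prod_pos[OF r(1), of S] axis_prod_pos[OF \<open>0 < m\<close>, of S] by (intro mult_mono) auto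
  also have "\<dots> < axis_prod S r * axis_prod S r'"
    using axis_prod_sqrt_less[OF S r \<open>r \<noteq> r'\<close>] by (simp add: m_def power2_eq_square)
  also have "\<dots> \<le> axis_prod S r * axis_prod S r"
    using le axis_prod_pos[OF r(1), of S] by (intro mult_left_mono) auto
  finally show False by simp
qed

text \<open>One factor r + k / r tends to infinity at both ends of the half-line, while every other
  factor is at least 2 |w|; so the minimum may be sought on a compact interval.\<close>

lemma axis_prod_min_exists:
  assumes S: "finite S" "S \<noteq> {}" "0 \<notin> S"
  obtains r where "0 < r" "\<And>q. 0 < q \<Longrightarrow> axis_prod S r \<le> axis_prod S q"
proof -
  obtain z where z: "z \<in> S" using S by auto
  define k where "k = (cmod z)\<^sup>2"
  define c where "c = (\<Prod>w\<in>S - {z}. 2 * cmod w)"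
  have k: "0 < k" using z S by (auto simp: k_def)
  have c: "0 < c" unfolding c_def using S by (intro prod_pos) auto
  have lower: "(r + k / r) * c \<le> axis_prod S r" if r: "0 < r" for r
  proof -
    have "2 * a \<le> r + a\<^sup>2 / r" for a
    proof -
      have "0 \<le> (r - a)\<^sup>2 / r" using r by simp
      also have "(r - a)\<^sup>2 = r * r + a\<^sup>2 - 2 * a * r" by (simp add: power2_eq_square algebra_simps)
      also have "\<dots> / r = r + a\<^sup>2 / r - 2 * a"
        using r by (simp add: add_divide_distrib diff_divide_distrib)
      finally show ?thesis by simp
    qed
    then have "c \<le> (\<Prod>w\<in>S - {z}. r + (cmod w)\<^sup>2 / r)"
      unfolding c_def by (intro prod_mono) auto
    then have "(r + k / r) * c \<le> (r + k / r) * (\<Prod>w\<in>S - {z}. r + (cmod w)\<^sup>2 / r)"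
      using r k by (intro mult_left_mono) auto
    also have "\<dots> = axis_prod S r" using S z by (simp add: axis_prod_def k_def prod.remove)
    finally show ?thesis .
  qed
  define V where "V = axis_prod S 1"
  have V: "0 < V" unfolding V_def by (rule axis_prod_pos) simp
  \<comment> \<open>Outside the interval from \<open>\<epsilon>\<close> to \<open>M\<close> the
    bound (q + k / q) c already reaches V, the value at 1; the truncations by 1 keep the point 1
    inside the interval.\<close>
  define M where "M = max 1 (V / c)"
  define \<epsilon> where "\<epsilon> = min 1 (k * c / V)"
  have \<epsilon>: "0 < \<epsilon>" using k c V by (simp add: \<epsilon>_def)
  have "continuous_on {\<epsilon>..M} (axis_prod S)"
    unfolding axis_prod_def[abs_def] using \<epsilon> by (intro continuous_intros) auto
  moreover have "1 \<in> {\<epsilon>..M}" by (simp add: \<epsilon>_def M_def)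
  ultimately obtain r where r: "r \<in> {\<epsilon>..M}" "\<And>q. q \<in> {\<epsilon>..M} \<Longrightarrow> axis_prod S r \<le> axis_prod S q"
    using continuous_attains_inf[of "{\<epsilon>..M}" "axis_prod S"] by (metis compact_Icc empty_iff)
  have "axis_prod S r \<le> axis_prod S q" if q: "0 < q" for q
  proof (cases "q \<in> {\<epsilon>..M}")
    case True
    then show ?thesis using r by blast
  next
    case False
    have "V \<le> (q + k / q) * c"
    proof (cases "M < q")
      case True
      then have "V \<le> q * c" using c by (simp add: M_def pos_divide_less_eq less_imp_le)
      also have "\<dots> \<le> (q + k / q) * c" using k q c by (intro mult_right_mono) auto
      finally show ?thesis .
    next
      case F: False
      then have "q < k * c / V" using False by (simp add: \<epsilon>_def)
      then have "V \<le> k / q * c" using V q by (simp add: pos_less_divide_eq pos_le_divide_eq mult.commute less_imp_le)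
      also have "\<dots> \<le> (q + k / q) * c" using k q c by (intro mult_right_mono) auto
      finally show ?thesis .
    qed
    also have "\<dots> \<le> axis_prod S q" by (rule lower[OF q])
    finally have "V \<le> axis_prod S q" .
    moreover have "axis_prod S r \<le> V" unfolding V_def using r(2) \<open>1 \<in> {\<epsilon>..M}\<close> by blast
    ultimately show ?thesis by linarith
  qed
  then show ?thesis using that[of r] r(1) \<epsilon> by auto
qed

section \<open>Roots symmetric about zero\<close>

locale even_real_sextic = real_sextic +
  assumes even: "\<And>z. poly (map_poly complex_of_real p) (- z) = poly (map_poly complex_of_real p) z"
    and nonzero: "poly (map_poly complex_of_real p) 0 \<noteq> 0"
begin

lemma Z_ne: "Z \<noteq> {}" "0 \<notin> Z"
proof -
  show "Z \<noteq> {}" using card_Z by auto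
  show "0 \<notin> Z" using nonzero by (simp add: Z_def)
qed

lemma minus_Z: "- z \<in> Z \<longleftrightarrow> z \<in> Z"
  using even by (simp add: Z_def)

lemma \<Phi>_axis: "0 < r \<Longrightarrow> \<Phi> 0 r = axis_prod Z r"
proof -
  assume r: "0 < r"
  have "G 0 r z = r * r + (cmod z)\<^sup>2" for z
    unfolding G_def cmod_power2 by (simp add: power2_eq_square)
  then have "G 0 r z / r = r + (cmod z)\<^sup>2 / r" for z
    using r by (simp add: add_divide_distrib)
  then have "axis_prod Z r = (\<Prod>z\<in>Z. G 0 r z / r)" by (simp add: axis_prod_def)
  then show ?thesis by (simp add: \<Phi>_def prod_dividef card_Z)
qed

text \<open>This is |q - z^2|^2; hence it is nonnegative and, for q > 0, vanishes only at the two
  real square roots of q.\<close>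

definition N :: "real \<Rightarrow> complex \<Rightarrow> real" where
  "N q z = (q + (cmod z)\<^sup>2)\<^sup>2 - 4 * (Re z)\<^sup>2 * q"

lemma N_alt: "N q z = (q - (cmod z)\<^sup>2)\<^sup>2 + 4 * (Im z)\<^sup>2 * q"
  unfolding N_def cmod_power2 by (simp add: power2_eq_square algebra_simps)

lemma G_pair: "G s h z * G s h (- z) = N (s\<^sup>2 + h\<^sup>2) z + 4 * (Re z)\<^sup>2 * h\<^sup>2"
  unfolding G_def N_def cmod_power2 by (simp add: power2_eq_square algebra_simps)

text \<open>Squaring lets every root be paired with its negative without choosing representatives of
  the pairs.\<close>

lemma \<Phi>_square:
  assumes "0 < h"
  shows "(\<Phi> s h)\<^sup>2 = (\<Prod>z\<in>Z. N (s\<^sup>2 + h\<^sup>2) z / h\<^sup>2 + 4 * (Re z)\<^sup>2)"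
proof -
  have "prod (G s h) Z = (\<Prod>z\<in>Z. G s h (- z))"
    by (rule prod.reindex_bij_witness[of _ uminus uminus]) (auto simp: minus_Z)
  then have "(\<Phi> s h)\<^sup>2 = (\<Prod>z\<in>Z. G s h z) * (\<Prod>z\<in>Z. G s h (- z)) / (h\<^sup>2) ^ 6"
    by (simp add: \<Phi>_def power2_eq_square power_mult_distrib)
  also have "\<dots> = (\<Prod>z\<in>Z. G s h z * G s h (- z) / h\<^sup>2)"
    by (simp add: prod.distrib prod_dividef card_Z)
  also have "\<dots> = (\<Prod>z\<in>Z. N (s\<^sup>2 + h\<^sup>2) z / h\<^sup>2 + 4 * (Re z)\<^sup>2)"
    using assms by (simp add: G_pair add_divide_distrib)
  finally show ?thesis .
qed

lemma \<Phi>_axis_less: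
  assumes h: "0 < h" and s: "s \<noteq> 0"
  shows "\<Phi> 0 (sqrt (s\<^sup>2 + h\<^sup>2)) < \<Phi> s h"
proof -
  define q where "q = s\<^sup>2 + h\<^sup>2"
  have q: "0 < q" "h\<^sup>2 < q" using h s by (auto simp: q_def intro: add_pos_pos)
  define f where "f z = N q z / q + 4 * (Re z)\<^sup>2" for z
  define g where "g z = N q z / h\<^sup>2 + 4 * (Re z)\<^sup>2" for z
  have N0: "0 \<le> N q z" for z using q unfolding N_alt by simp
  have le: "f z \<le> g z" for z
    unfolding f_def g_def using N0[of z] q h by (intro add_mono divide_left_mono) auto
  have fpos: "0 < f z" if "z \<in> Z" for z
  proof -
    have "f z = G 0 (sqrt q) z * G 0 (sqrt q) (- z) / q"
      using q by (simp add: f_def G_pair add_divide_distrib)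
    then show ?thesis using q by (simp add: G_pos)
  qed
  \<comment> \<open>Strictness requires one root at which \<open>N q\<close> does not vanish; it
    vanishes at two points at most, and there are six roots.\<close>
  have "\<not> Z \<subseteq> {complex_of_real (sqrt q), - complex_of_real (sqrt q)}"
  proof
    assume "Z \<subseteq> {complex_of_real (sqrt q), - complex_of_real (sqrt q)}"
    then have "card Z \<le> card {complex_of_real (sqrt q), - complex_of_real (sqrt q)}" by (intro card_mono) auto
    also have "\<dots> \<le> 2" by (simp add: card_insert_if)
    finally show False using card_Z by simp
  qed
  then obtain w where w: "w \<in> Z" "w \<noteq> complex_of_real (sqrt q)" "w \<noteq> - complex_of_real (sqrt q)" by blast
  have "N q w \<noteq> 0"
  proof
    assume "N q w = 0"
    then have "(q - (cmod w)\<^sup>2)\<^sup>2 = 0" "4 * (Im w)\<^sup>2 * q = 0"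
      using q unfolding N_alt by (smt (verit) mult_nonneg_nonneg zero_le_power2)+
    then have im: "Im w = 0" and "q = (Re w)\<^sup>2" using q by (auto simp: cmod_power2)
    then have "\<bar>Re w\<bar> = sqrt q" by simp
    then have "Re w = sqrt q \<or> Re w = - sqrt q" by linarith
    then show False using w im by (auto simp: complex_eq_iff)
  qed
  then have lt: "f w < g w"
    unfolding f_def g_def using N0[of w] q h by (intro add_strict_right_mono divide_strict_left_mono) auto
  have "(\<Phi> 0 (sqrt q))\<^sup>2 = prod f Z" using \<Phi>_square[of "sqrt q" 0] q by (simp add: f_def)
  also have "\<dots> = f w * prod f (Z - {w})" using w finite_Z by (simp add: prod.remove)
  also have "\<dots> < g w * prod g (Z - {w})"
    using lt le fpos w by (intro mult_less_le_imp_less prod_mono prod_pos) (auto simp: less_imp_le)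
  also have "\<dots> = prod g Z" using w finite_Z by (simp add: prod.remove)
  also have "\<dots> = (\<Phi> s h)\<^sup>2" using \<Phi>_square[OF h, of s] by (simp add: g_def q_def)
  finally have "(\<Phi> 0 (sqrt q))\<^sup>2 < (\<Phi> s h)\<^sup>2" .
  moreover have "0 \<le> \<Phi> s h" unfolding \<Phi>_def using h G_pos[OF h] by (simp add: prod_nonneg less_imp_le)
  ultimately show ?thesis unfolding q_def by (rule power_less_imp_less_base)
qed

lemma julia_zeta_axis:
  obtains r where "0 < r" "julia_zeta p = Complex 0 r" "\<And>q. 0 < q \<Longrightarrow> axis_prod Z r \<le> axis_prod Z q"
proof -
  obtain r where r: "0 < r" "\<And>q. 0 < q \<Longrightarrow> axis_prod Z r \<le> axis_prod Z q"
    using axis_prod_min_exists[OF finite_Z Z_ne] by metis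
  have le: "\<Phi> 0 r \<le> \<Phi> s h" if h: "0 < h" for s h
  proof (cases "s = 0")
    case True
    then show ?thesis using r h by (simp add: \<Phi>_axis)
  next
    case False
    have "0 < sqrt (s\<^sup>2 + h\<^sup>2)" using h by (simp add: add_nonneg_pos)
    then have "\<Phi> 0 r \<le> \<Phi> 0 (sqrt (s\<^sup>2 + h\<^sup>2))" using r by (simp add: \<Phi>_axis)
    then show ?thesis using \<Phi>_axis_less[OF h False] by simp
  qed
  have unique: "s = 0 \<and> h = r" if h: "0 < h" and "\<Phi> s h \<le> \<Phi> 0 r" for s h
  proof -
    have "s = 0"
    proof (rule ccontr)
      assume s: "s \<noteq> 0"
      have "0 < sqrt (s\<^sup>2 + h\<^sup>2)" using h by (simp add: add_nonneg_pos)
      then show False using \<Phi>_axis_less[OF h s] le[of "sqrt (s\<^sup>2 + h\<^sup>2)" 0] that(2) by linarith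
    qed
    then have "axis_prod Z h \<le> axis_prod Z r" using that r h by (simp add: \<Phi>_axis)
    from axis_prod_min_unique[OF finite_Z Z_ne r(1) h r(2) this] \<open>s = 0\<close> show ?thesis by simp
  qed
  have "julia_zeta p = Complex 0 r"
    using r(1) le unique by (intro julia_zeta_eq) auto
  then show ?thesis using that r by blast
qed

end

section \<open>Reduction of even sextics\<close>

lemma reduced_even_sextic:
  fixes s1 s2 :: real
  defines "p \<equiv> [:- 1, 0, s2, 0, - s1, 0, 1:]"
  assumes card: "card {z. poly (map_poly complex_of_real p) z = 0} = 6"
  shows "reduced_form (even_sextic s1 s2) \<or> reduced_form (\<lambda>x z. even_sextic s1 s2 (- z) x)"
proof -
  \<comment> \<open>As f is even, f(-z, x) = f(z, x), so the coefficients of \<open>p\<close> are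
    simply reversed and its roots inverted.\<close>
  define q where "q = [:1, 0, - s1, 0, s2, 0, - 1:]"
  have deg: "Polynomial.degree p = 6" "Polynomial.degree q = 6" by (auto simp: p_def q_def)
  have bf: "even_sextic s1 s2 = binary_form p"
    by (intro ext) (simp add: even_sextic_def binary_form_def deg, simp add: p_def numeral_eq_Suc atMost_Suc algebra_simps)
  have bf': "(\<lambda>x z. even_sextic s1 s2 (- z) x) = binary_form q"
    by (intro ext) (simp add: even_sextic_def binary_form_def deg, simp add: q_def numeral_eq_Suc atMost_Suc algebra_simps)
  have pz: "poly (map_poly complex_of_real p) z = z ^ 6 - complex_of_real s1 * z ^ 4 + complex_of_real s2 * z ^ 2 - 1" for z
    by (simp add: p_def map_poly_pCons) (simp add: numeral_eq_Suc algebra_simps)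
  have qz: "poly (map_poly complex_of_real q) z = 1 - complex_of_real s1 * z ^ 2 + complex_of_real s2 * z ^ 4 - z ^ 6" for z
    by (simp add: q_def map_poly_pCons) (simp add: numeral_eq_Suc algebra_simps)
  interpret P: even_real_sextic p
    by unfold_locales (use deg card in \<open>auto simp: pz\<close>)
  have inv: "poly (map_poly complex_of_real q) (inverse z) = 0 \<longleftrightarrow> poly (map_poly complex_of_real p) z = 0" if "z \<noteq> 0" for z
  proof -
    have "z ^ 6 * poly (map_poly complex_of_real q) (inverse z) = poly (map_poly complex_of_real p) z"
      unfolding pz qz using that by (simp add: field_simps)
    then show ?thesis using that by (metis mult_eq_0_iff power_eq_0_iff)
  qed
  have Zq: "{z. poly (map_poly complex_of_real q) z = 0} = inverse ` P.Z"
  proof (intro equalityI subsetI)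
    fix z assume z: "z \<in> {z. poly (map_poly complex_of_real q) z = 0}"
    then have "z \<noteq> 0" by (auto simp: qz)
    then show "z \<in> inverse ` P.Z"
      using inv[of "inverse z"] z by (intro image_eqI[of _ _ "inverse z"]) (auto simp: P.Z_def)
  next
    fix z assume "z \<in> inverse ` P.Z"
    then obtain w where w: "w \<in> P.Z" "z = inverse w" by blast
    then have "w \<noteq> 0" using P.Z_ne(2) by auto
    then show "z \<in> {z. poly (map_poly complex_of_real q) z = 0}"
      using inv[of w] w by (simp add: P.Z_def)
  qed
  have card_q: "card {z. poly (map_poly complex_of_real q) z = 0} = 6"
    unfolding Zq using P.card_Z by (subst card_image) (auto simp: inj_on_def)
  interpret Q: even_real_sextic q
    by unfold_locales (use deg card_q in \<open>auto simp: qz\<close>)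
  obtain r where r: "0 < r" "julia_zeta p = Complex 0 r" "\<And>t. 0 < t \<Longrightarrow> axis_prod P.Z r \<le> axis_prod P.Z t"
    using P.julia_zeta_axis by metis
  obtain r' where r': "0 < r'" "julia_zeta q = Complex 0 r'" "\<And>t. 0 < t \<Longrightarrow> axis_prod Q.Z r' \<le> axis_prod Q.Z t"
    using Q.julia_zeta_axis by metis
  define c where "c = (\<Prod>z\<in>P.Z. (cmod z)\<^sup>2)"
  have c: "0 < c" unfolding c_def using P.Z_ne by (intro prod_pos) auto
  have eq: "a\<^sup>2 * (t + (inverse a)\<^sup>2 / t) = inverse t + a\<^sup>2 / inverse t" if "a \<noteq> 0" for a t :: real
  proof -
    have "a\<^sup>2 * (t + (inverse a)\<^sup>2 / t) = a\<^sup>2 * t + (a * inverse a)\<^sup>2 / t"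
      by (simp only: distrib_left power_mult_distrib times_divide_eq_right)
    then show ?thesis using that by (simp add: divide_inverse add.commute)
  qed
  \<comment> \<open>Inverting all roots exchanges t and 1 / t up to the constant factor c, so the
    two minimisers are inverse to each other.\<close>
  have axis: "axis_prod P.Z (inverse t) = c * axis_prod Q.Z t" if t: "0 < t" for t
  proof -
    have "axis_prod Q.Z t = (\<Prod>z\<in>P.Z. t + (cmod (inverse z))\<^sup>2 / t)"
      unfolding axis_prod_def Q.Z_def Zq by (subst prod.reindex) (auto simp: inj_on_def)
    then have "c * axis_prod Q.Z t = (\<Prod>z\<in>P.Z. (cmod z)\<^sup>2 * (t + (cmod (inverse z))\<^sup>2 / t))"
      by (simp add: c_def prod.distrib)
    also have "\<dots> = (\<Prod>z\<in>P.Z. inverse t + (cmod z)\<^sup>2 / inverse t)"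
    proof (rule prod.cong)
      fix z assume "z \<in> P.Z"
      then have "cmod z \<noteq> 0" using P.Z_ne by auto
      then show "(cmod z)\<^sup>2 * (t + (cmod (inverse z))\<^sup>2 / t) = inverse t + (cmod z)\<^sup>2 / inverse t"
        using eq by (simp only: norm_inverse)
    qed simp
    finally show ?thesis by (simp add: axis_prod_def)
  qed
  have "axis_prod P.Z (inverse r') \<le> axis_prod P.Z r"
    using axis[OF r'(1)] axis[of "inverse r"] r'(3)[of "inverse r"] r(1) c by simp
  then have "r = inverse r'"
    using axis_prod_min_unique[OF P.finite_Z P.Z_ne r(1) _ r(3)] r'(1) by simp
  \<comment> \<open>On the imaginary axis the fundamental domain is the ray from i upwards.\<close>
  then have "1 \<le> r \<or> 1 \<le> r'"
    using r'(1) by (cases "r' \<le> 1") (auto simp: one_le_inverse_iff)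
  then consider "1 \<le> r" | "1 \<le> r'" by blast
  then show ?thesis
  proof cases
    case 1
    then have "julia_zeta p \<in> fundamental_domain" using r by (simp add: fundamental_domain_def complex_norm)
    moreover have "p \<noteq> 0" using deg(1) by auto
    ultimately have "reduced_form (even_sextic s1 s2)"
      unfolding reduced_form_def by (intro exI[of _ p] conjI) (simp_all only: bf deg card not_False_eq_True)
    then show ?thesis ..
  next
    case 2
    then have "julia_zeta q \<in> fundamental_domain" using r' by (simp add: fundamental_domain_def complex_norm)
    moreover have "q \<noteq> 0" using deg(2) by auto
    ultimately have "reduced_form (\<lambda>x z. even_sextic s1 s2 (- z) x)"
      unfolding reduced_form_def by (intro exI[of _ q] conjI) (simp_all only: bf' deg card_q not_False_eq_True)
    then show ?thesis ..
  qed
qed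

text \<open>Separability of a rational polynomial does not depend on where its roots are taken,
  because gcd(P, P') is computed over the rationals. A gcd of positive degree would give a double
  root in the algebraically closed field; if it is constant, Bezout's identity excludes a common
  root of P and P' in any extension.\<close>

lemma common_root_transfer:
  fixes e1 :: "rat \<Rightarrow> 'k::alg_closed_field" and e2 :: "rat \<Rightarrow> 'l::field" and P :: "rat poly"
  assumes "field_embedding e1" "field_embedding e2" "P \<noteq> 0"
    and card: "card {a. poly (map_poly e1 P) a = 0} = Polynomial.degree P"
    and c: "poly (map_poly e2 P) c = 0"
  shows "poly (map_poly e2 (pderiv P)) c \<noteq> 0"
proof
  assume c': "poly (map_poly e2 (pderiv P)) c = 0"
  interpret e1: field_extension e1 by unfold_locales fact
  interpret e2: field_extension e2 by unfold_locales fact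
  define g where "g = gcd P (pderiv P)"
  have g0: "g \<noteq> 0" using assms(3) by (simp add: g_def)
  have deg_map: "Polynomial.degree (map_poly e1 q) = Polynomial.degree q" for q
    by (intro degree_map_poly) auto
  show False
  proof (cases "Polynomial.degree g = 0")
    case True
    then obtain d where d: "g = [:d:]" by (rule degree_eq_zeroE)
    obtain u v where "u * P + v * pderiv P = g"
      using bezout_coefficients_fst_snd[of P "pderiv P"] unfolding g_def by blast
    then have "e2.ev (u * P + v * pderiv P) c = e2.ev g c" by simp
    then have "e2.ev g c = 0" unfolding e2.ev_add e2.ev_mult using c c' by simp
    then show False using g0 d by simp
  next
    case False
    then obtain a where a: "e1.ev g a = 0"
      using alg_closed_imp_poly_has_root[of "map_poly e1 g"] unfolding deg_map by blast
    have dvd: "e1.ev q a = 0" if "g dvd q" for q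
      using that a by (auto simp: e1.ev_mult elim!: dvdE)
    define S where "S = map_poly e1 P"
    have S0: "S \<noteq> 0" using assms(3) deg_map[of P] by (auto simp: S_def map_poly_eq_0_iff)
    have Sa: "poly S a = 0" unfolding S_def by (rule dvd) (simp add: g_def)
    have "pderiv S = map_poly e1 (pderiv P)"
    proof (rule poly_eqI)
      fix n
      have "e1 (of_nat m) = of_nat m" for m by (induction m) (auto simp: e1.e_add)
      then show "Polynomial.coeff (pderiv S) n = Polynomial.coeff (map_poly e1 (pderiv P)) n"
        by (simp add: S_def coeff_pderiv coeff_map_poly e1.e_mult e1.e_add)
    qed
    then have S'a: "poly (pderiv S) a = 0" using dvd[of "pderiv P"] by (simp add: g_def)
    obtain T where T: "S = [:- a, 1:] * T" using Sa poly_eq_0_iff_dvd by blast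
    have T0: "T \<noteq> 0" using S0 T by auto
    have "poly T a = 0" using S'a unfolding T by (simp add: pderiv_mult pderiv_pCons del: mult_pCons_left)
    then have "{b. poly S b = 0} \<subseteq> {b. poly T b = 0}" unfolding T by auto
    then have "card {b. poly S b = 0} \<le> card {b. poly T b = 0}"
      using poly_roots_finite[OF T0] by (intro card_mono)
    also have "\<dots> \<le> Polynomial.degree T" using card_poly_roots_bound[OF T0] .
    also have "\<dots> < Polynomial.degree S" unfolding T using T0 by (subst degree_mult_eq) auto
    finally show False using card deg_map[of P] by (simp add: S_def)
  qed
qed

text \<open>The equation of the curve supplies six distinct roots in \<open>qbar\<close>, whereas
  reduction concerns complex roots. As the coefficients are rational, the passage goes through
  \<open>P\<close> over the rationals and chooses no embedding of \<open>qbar\<close> into the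
  complex numbers.\<close>

lemma even_sextic_distinct_complex_roots:
  fixes m1 m2 :: int
  assumes "has_equation (e :: qbar \<Rightarrow> 'f::field) (even_sextic (of_int m1) (of_int m2))"
  defines "p \<equiv> [:- 1, 0, of_int m2, 0, - of_int m1, 0, 1:] :: real poly"
  shows "card {z. poly (map_poly complex_of_real p) z = 0} = 6"
proof -
  define P :: "rat poly" where "P = [:- 1, 0, of_int m2, 0, - of_int m1, 0, 1:]"
  obtain q :: "qbar poly" where q: "even_sextic (of_int m1) (of_int m2) = binary_form q"
    "card {a. poly q a = 0} = 6"
    using assms(1) unfolding has_equation_def by blast
  have mapP: "map_poly to_ac P = [:- 1, 0, of_int m2, 0, - of_int m1, 0, 1:]"
    by (simp add: P_def map_poly_pCons)
  have "poly q a = poly (map_poly to_ac P) a" for a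
  proof -
    have "poly q a = binary_form q a 1" by (simp add: binary_form_def poly_altdef)
    also have "\<dots> = poly (map_poly to_ac P) a"
      unfolding q(1)[symmetric] mapP even_sextic_def by (simp add: numeral_eq_Suc algebra_simps)
    finally show ?thesis .
  qed
  then have card1: "card {a. poly (map_poly to_ac P) a = 0} = Polynomial.degree P"
    using q(2) by (simp add: P_def)
  have emb: "field_embedding (to_ac :: rat \<Rightarrow> qbar)" "field_embedding (of_rat :: rat \<Rightarrow> complex)"
    by (auto simp: field_embedding_def of_rat_add of_rat_mult)
  have P0: "P \<noteq> 0" by (simp add: P_def)
  have pP: "map_poly complex_of_real p = map_poly of_rat P"
    by (simp add: p_def P_def map_poly_pCons of_rat_minus)
  define C where "C = map_poly complex_of_real p"
  have C: "C = [:- 1, 0, of_int m2, 0, - of_int m1, 0, 1:]"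
    by (simp add: C_def p_def map_poly_pCons)
  have pderiv: "map_poly of_rat (pderiv P) = pderiv C"
    by (simp add: C P_def pderiv_pCons map_poly_pCons of_rat_minus of_rat_mult)
  have "\<not> [:- c, 1:] ^ 2 dvd C" for c
  proof
    assume "[:- c, 1:] ^ 2 dvd C"
    then obtain T where T: "C = [:- c, 1:] * ([:- c, 1:] * T)"
      by (metis dvdE mult.assoc power2_eq_square)
    then have "poly C c = 0" "poly (pderiv C) c = 0"
      by (auto simp: pderiv_mult simp del: mult_pCons_left)
    then show False
      using common_root_transfer[OF emb P0 card1] pP pderiv by (metis C_def)
  qed
  moreover have "C \<noteq> 0" by (simp add: C)
  ultimately have "card {z. poly C z = 0} = Polynomial.degree C" by (intro card_roots_squarefree)
  then show ?thesis by (simp add: C C_def[symmetric])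
qed

theorem theorem3:
  fixes e :: "qbar \<Rightarrow> 'f::field"
  assumes "represents_point_of_M2_Q e"
    and "Aut_group e \<cong> klein_four_group"
  shows "(\<exists>s1 s2 :: qbar. has_equation e (even_sextic s1 s2)) \<and>
    (\<forall>m1 m2 :: int. has_equation e (even_sextic (of_int m1) (of_int m2)) \<longrightarrow>
       (let f = even_sextic (of_int m1) (of_int m2) :: real \<Rightarrow> real \<Rightarrow> real
        in reduced_form f \<or> reduced_form (\<lambda>x z. f (- z) x)))"
proof (intro conjI allI impI)
  show "\<exists>s1 s2 :: qbar. has_equation e (even_sextic s1 s2)"
    using assms by (intro V4_even_equation) (auto simp: represents_point_of_M2_Q_def)
next
  fix m1 m2 :: int
  assume "has_equation e (even_sextic (of_int m1) (of_int m2))"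
  from reduced_even_sextic[OF even_sextic_distinct_complex_roots[OF this]]
  show "let f = even_sextic (of_int m1) (of_int m2) :: real \<Rightarrow> real \<Rightarrow> real
        in reduced_form f \<or> reduced_form (\<lambda>x z. f (- z) x)"
    by (simp add: Let_def)
qed

end
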